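(* Let $T$ be a rectangular standard Young tableau that contains at least one uniformly proper rectangular subtableau. Let $C_1,\dots,C_k$ be the components of the $m$-diagram $\varphi(T)$, let $\partial C_i$ be the set of endpoints of $C_i$, and let $T_{C_i}$ be the tableau corresponding to $C_i$. Then the promotion orbit length $|\mathcal{O}(T)|$ can be determined as follows. Let $N$ be the order of rotational symmetry of $\varphi(T)$, and let $$\ell=\min\{\,q\ge 1 : \text{for all } i,\ \text{if } \rho^{qN}(\partial C_i)=\partial C_j \text{ then } P^{qN}(T_{C_i})=T_{C_j}\,\},$$ where $P^{qN}(T_{C_i})$ denotes $qN$-fold component promotion. Then $|\mathcal{O}(T)|=\ell N$.
   Context: **Tableaux and promotion.** A standard Young tableau (SYT) of shape $\lambda\vdash n$ is a filling of the Young diagram of $\lambda$ with $1,\dots,n$, each used once, with rows strictly increasing left to right and columns strictly increasing top to bottom. It is rectangular if all rows have the same length. $|T|$ is the number of boxes of $T$. The content of a tableau is the collection of its entries. The promotion $P(T)$ of an SYT $T$ is obtained thus: erase $1$ from the top left corner, leaving an empty box; repeatedly slide into the empty box the smaller of the entries immediately to its right and immediately below it (if only one exists, slide that one), until no nonempty box lies to the right of or below the empty box; then decrement all entries by $1$ and put $|T|$ in the empty box. $\mathcal{O}(T)$ is the orbit of $T$ under $P$. **Subtableaux.** A skew tableau is a filling of a skew diagram such that for each box all entries to its right and below it are strictly larger. Two skew tableaux $S,S'$ with $|S|=|S'|=n$ are equivalent, $S\equiv S'$, if they become the same after each is left-justified (each row pushed left) and its entries are relabeled in order-preserving fashion by $1,\dots,n$;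 they are uniformly equivalent if in addition their contents have the form $\{k+i_1,\dots,k+i_n\}$ and $\{k'+i_1,\dots,k'+i_n\}$ for some $k,k'$. A (skew) subtableau $S\subsetneq T$ is uniformly proper if it has the same number of rows as $T$ (i.e. meets every row of $T$) and is uniformly equivalent to an SYT; it is a uniformly proper rectangular subtableau if in addition all its rows have the same length. **The $m$-diagram $\varphi(T)$.** Let $T$ have $r$ rows. For $1\le i\le r-1$, a noncrossing matching $\mathcal{M}_i$ on the entries of rows $i$ and $i+1$ is built by processing the entries $b$ of row $i+1$ from left to right and, for each, adding the arc $(a,b)$ where $a$ is the largest entry of row $i$ with $a\le b$ that is not yet on an arc of $\mathcal{M}_i$. Set $\varphi(T)=\bigcup_{i=1}^{r-1}\mathcal{M}_i$ (a set of arcs). Two arcs $(i,j),(i',j')$ cross if $i<i'<j<j'$ or $i'<i<j'<j$. **Components.** Let $M$ be an $m$-diagram. A nonempty proper subcollection $C\subsetneq M$ of arcs is a sub-diagram if (i) whenever $a$ is an endpoint of an arc in $C$, all arcs of $M$ with endpoint $a$ are in $C$, and (ii) no arc of $M$ not in $C$ crosses an arc in $C$. A component is a sub-diagram having no proper subcollection that forms a sub-diagram. $\partial C$ denotes the set of endpoints of $C$. For a component $C$ of $\varphi(T)$, $T_C$ is the rectangular tableau obtained by left-justifying the collection of boxes of $T$ with entries in $\partial C$. **Rotation and rotational symmetry.** $\rho:\{1,\dots,|T|\}\to\{1,\dots,|T|\}$ is the cyclic permutation $\rho(i)=i-1 \bmod |T|$ (so $\rho(1)=|T|$), applied elementwise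 to sets. If $\varphi(T)$ has components $C_1,\dots,C_k$, then $\varphi(T)$ has order $N$ rotational symmetry if $N$ is the smallest positive integer with $\{\rho^N(\partial C_1),\dots,\rho^N(\partial C_k)\}=\{\partial C_1,\dots,\partial C_k\}$. **Component promotion.** For $T_C$ (with $T$ fixed): if $1$ is not an entry, $P(T_C)$ is formed by decrementing every entry by $1$. If $1$ is an entry, $P(T_C)$ is formed by removing $1$ from the top left corner, performing the promotion sliding moves inside $T_C$, decrementing each entry by $1$, and filling the empty box with $|T|$. $P^q(T_C)$ is the result of applying this rule $q$ times (each time to the tableau produced by the previous step, always with the same $|T|$). *)

theory Defs
  imports Main "HOL-Library.While_Combinator"
begin

section \<open>Tableaux\<close>

text \<open>
  A filling of a finite set of boxes is a partial map from boxes \<open>(row, column)\<close> to entries.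
  Rows and columns are numbered from 0, rows from top to bottom and columns from left to right.
  The domain is the set of boxes, the range is the content.
\<close>

type_synonym tableau = "nat \<times> nat \<rightharpoonup> nat"

definition is_partition :: "nat list \<Rightarrow> bool" where
  "is_partition p \<longleftrightarrow> sorted_wrt (\<ge>) p \<and> 0 \<notin> set p"

definition young_diagram :: "nat list \<Rightarrow> (nat \<times> nat) set" where
  "young_diagram p = {(i, j). i < length p \<and> j < p ! i}"

definition skew_diagram :: "(nat \<times> nat) set \<Rightarrow> bool" where
  "skew_diagram D \<longleftrightarrow>
     (\<exists>p q. is_partition p \<and> is_partition q \<and> young_diagram q \<subseteq> young_diagram p \<and>
        D = young_diagram p - young_diagram q)"

definition increasing :: "tableau \<Rightarrow> bool" where
  "increasing T \<longleftrightarrow>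
     (\<forall>i j j' a b. T (i, j) = Some a \<and> T (i, j') = Some b \<and> j < j' \<longrightarrow> a < b) \<and>
     (\<forall>i i' j a b. T (i, j) = Some a \<and> T (i', j) = Some b \<and> i < i' \<longrightarrow> a < b)"

definition tableau_size :: "tableau \<Rightarrow> nat" where
  "tableau_size T = card (dom T)"

definition syt :: "tableau \<Rightarrow> bool" where
  "syt T \<longleftrightarrow>
     (\<exists>p. is_partition p \<and> dom T = young_diagram p) \<and>
     inj_on T (dom T) \<and> ran T = {1..tableau_size T} \<and> increasing T"

definition skew_tableau :: "tableau \<Rightarrow> bool" where
  "skew_tableau S \<longleftrightarrow> skew_diagram (dom S) \<and> increasing S"

definition tableau_rows :: "tableau \<Rightarrow> nat set" where
  "tableau_rows T = fst ` dom T"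

definition row_columns :: "tableau \<Rightarrow> nat \<Rightarrow> nat set" where
  "row_columns T i = {j. (i, j) \<in> dom T}"

definition rectangular :: "tableau \<Rightarrow> bool" where
  "rectangular T \<longleftrightarrow>
     (\<forall>i\<in>tableau_rows T. \<forall>i'\<in>tableau_rows T. card (row_columns T i) = card (row_columns T i'))"


section \<open>Promotion\<close>

text \<open>
  States of the sliding process are pairs of a filling and the position of the empty box,
  which is not in the domain of the filling.
\<close>

definition can_slide :: "tableau \<times> (nat \<times> nat) \<Rightarrow> bool" where
  "can_slide = (\<lambda>(T, (i, j)). (i, Suc j) \<in> dom T \<or> (Suc i, j) \<in> dom T)"

definition slide_source :: "tableau \<Rightarrow> nat \<times> nat \<Rightarrow> nat \<times> nat" where
  "slide_source T = (\<lambda>(i, j).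
     case (T (i, Suc j), T (Suc i, j)) of
       (Some a, Some b) \<Rightarrow> if a < b then (i, Suc j) else (Suc i, j)
     | (Some a, None) \<Rightarrow> (i, Suc j)
     | (None, _) \<Rightarrow> (Suc i, j))"

definition slide :: "tableau \<times> (nat \<times> nat) \<Rightarrow> tableau \<times> (nat \<times> nat)" where
  "slide = (\<lambda>(T, h). (T(h := T (slide_source T h), slide_source T h := None), slide_source T h))"

definition decrement :: "tableau \<Rightarrow> tableau" where
  "decrement T = map_option (\<lambda>v. v - 1) \<circ> T"

text \<open>
  Promotion with \<open>n\<close> as the entry that fills the last empty box; the entry 1 is supposed to be
  in the top left corner.
\<close>

definition promote_with :: "nat \<Rightarrow> tableau \<Rightarrow> tableau" where
  "promote_with n T =
     (let (T', h) = while can_slide slide (T((0, 0) := None), (0, 0))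
      in (decrement T')(h \<mapsto> n))"

definition promotion :: "tableau \<Rightarrow> tableau" where
  "promotion T = promote_with (tableau_size T) T"

definition promotion_orbit :: "tableau \<Rightarrow> tableau set" where
  "promotion_orbit T = {(promotion ^^ m) T | m. True}"

text \<open>Here \<open>n\<close> is the size of the ambient tableau, not of \<open>S\<close>.\<close>

definition component_promotion :: "nat \<Rightarrow> tableau \<Rightarrow> tableau" where
  "component_promotion n S = (if 1 \<in> ran S then promote_with n S else decrement S)"


section \<open>Subtableaux\<close>

text \<open>
  Left-justification keeps the order of the boxes in each row and closes all gaps, so that it
  also applies to collections of boxes that are not skew diagrams.
\<close>

definition left_justify :: "tableau \<Rightarrow> tableau" where
  "left_justify S = (\<lambda>(i, j).
     if j < card (row_columns S i) then S (i, sorted_list_of_set (row_columns S i) ! j) else None)"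

definition standardize :: "tableau \<Rightarrow> tableau" where
  "standardize S = map_option (\<lambda>v. card {u \<in> ran S. u \<le> v}) \<circ> S"

definition equivalent :: "tableau \<Rightarrow> tableau \<Rightarrow> bool" where
  "equivalent S S' \<longleftrightarrow>
     tableau_size S = tableau_size S' \<and>
     standardize (left_justify S) = standardize (left_justify S')"

definition uniformly_equivalent :: "tableau \<Rightarrow> tableau \<Rightarrow> bool" where
  "uniformly_equivalent S S' \<longleftrightarrow>
     equivalent S S' \<and> (\<exists>I k k'. ran S = (+) k ` I \<and> ran S' = (+) k' ` I)"

definition proper_subtableau :: "tableau \<Rightarrow> tableau \<Rightarrow> bool" where
  "proper_subtableau S T \<longleftrightarrow> skew_tableau S \<and> S \<subseteq>\<^sub>m T \<and> S \<noteq> T"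

definition uniformly_proper :: "tableau \<Rightarrow> tableau \<Rightarrow> bool" where
  "uniformly_proper S T \<longleftrightarrow>
     proper_subtableau S T \<and> tableau_rows S = tableau_rows T \<and>
     (\<exists>U. syt U \<and> uniformly_equivalent S U)"

definition uniformly_proper_rectangular :: "tableau \<Rightarrow> tableau \<Rightarrow> bool" where
  "uniformly_proper_rectangular S T \<longleftrightarrow> uniformly_proper S T \<and> rectangular S"


section \<open>m-diagrams and their components\<close>

type_synonym arc = "nat \<times> nat"

definition endpoints :: "arc set \<Rightarrow> nat set" where
  "endpoints M = fst ` M \<union> snd ` M"

definition row_entries :: "tableau \<Rightarrow> nat \<Rightarrow> nat list" where
  "row_entries T i = map (\<lambda>j. the (T (i, j))) (sorted_list_of_set (row_columns T i))"

definition add_arc :: "nat set \<Rightarrow> nat \<Rightarrow> arc set \<Rightarrow> arc set" where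
  "add_arc A b M =
     (let F = {a \<in> A. a \<le> b \<and> a \<notin> endpoints M} in if F = {} then M else insert (Max F, b) M)"

definition matching :: "tableau \<Rightarrow> nat \<Rightarrow> arc set" where
  "matching T i = fold (add_arc (set (row_entries T i))) (row_entries T (Suc i)) {}"

definition m_diagram :: "tableau \<Rightarrow> arc set" where
  "m_diagram T = (\<Union>i<card (tableau_rows T) - 1. matching T i)"

definition crosses :: "arc \<Rightarrow> arc \<Rightarrow> bool" where
  "crosses = (\<lambda>(i, j) (i', j'). i < i' \<and> i' < j \<and> j < j' \<or> i' < i \<and> i < j' \<and> j' < j)"

definition sub_diagram :: "arc set \<Rightarrow> arc set \<Rightarrow> bool" where
  "sub_diagram M C \<longleftrightarrow>
     C \<noteq> {} \<and> C \<subset> M \<and>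
     (\<forall>a\<in>endpoints C. \<forall>e\<in>M. a = fst e \<or> a = snd e \<longrightarrow> e \<in> C) \<and>
     (\<forall>e\<in>M - C. \<forall>c\<in>C. \<not> crosses e c)"

definition diagram_components :: "arc set \<Rightarrow> arc set set" where
  "diagram_components M = {C. sub_diagram M C \<and> \<not> (\<exists>D. D \<subset> C \<and> sub_diagram M D)}"

definition component_tableau :: "tableau \<Rightarrow> arc set \<Rightarrow> tableau" where
  "component_tableau T C = left_justify (T |` {x. \<exists>v\<in>endpoints C. T x = Some v})"

definition rotate_entry :: "nat \<Rightarrow> nat \<Rightarrow> nat" where
  "rotate_entry n i = (if i = 1 then n else i - 1)"

definition rotational_order :: "tableau \<Rightarrow> nat" where
  "rotational_order T =
     (LEAST N. N \<ge> 1 \<and>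
        (\<lambda>C. (rotate_entry (tableau_size T) ^^ N) ` endpoints C) ` diagram_components (m_diagram T)
        = endpoints ` diagram_components (m_diagram T))"

end

theory Submission
  imports Defs "HOL-Library.Disjoint_Sets"
begin

text \<open>
  A filling with distinct entries and left-justified increasing rows is determined by the rows of
  its entries, that is, by a word: a partial map from entries to rows. For a rectangular standard
  tableau the word is balanced: in every initial segment row \<open>i\<close> occurs at least as
  often as row \<open>i + 1\<close>, and in the whole word equally often. The excess of row
  \<open>i\<close> over row \<open>i + 1\<close> in initial segments controls everything: an arc
  of the \<open>m\<close>-diagram leads from an entry of row \<open>i\<close> to the first later
  position where the excess has dropped below its value at that entry, and the empty box of
  promotion moves down from row \<open>i\<close> at the first position after its arrival in that
  row where the excess vanishes. So promotion of a word follows a path \<open>1 = p\<^sub>0 <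
  p\<^sub>1 < p\<^sub>2 < \<dots>\<close> of such zeros: it removes the entry 1, lowers the
  letters at the other entries of the path by one, shifts everything by one and appends a letter
  of the bottom row (\<open>promote_with_tableau_of\<close>).

  The main idea is to look at a noncrossing partition of the entries into blocks on each of which
  the word is still balanced. Let \<open>B\<close> be the block of 1. A block that had entries on
  both sides of an element of \<open>B\<close> would cross \<open>B\<close>; so at each element of
  \<open>B\<close> every other block is complete or not yet begun, and contributes nothing to the
  excess. Hence the path stays inside \<open>B\<close> and is the path of the word restricted to
  \<open>B\<close> (\<open>slide_path_block\<close>). Promotion therefore restricts to component
  promotion on every block, and the rotated partition is again of this kind for the promoted word
  (\<open>promote_restrict\<close>, \<open>decomposition_promote\<close>).

  The endpoint sets of the components of \<open>\<phi>(T)\<close> form such a partition, and they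
  refine every other one, because arcs computed inside a block are arcs of the whole word, and
  arcs of different blocks neither meet nor cross (\<open>components_decomposition\<close>,
  \<open>component_in_block\<close>). The uniformly proper rectangular subtableau enters here: its
  content is an interval, so its content and the remaining entries are a partition with two
  blocks. This gives a sub-diagram, and as soon as there is one the components cover all arcs.

  It follows that \<open>m\<close> promotions fix \<open>T\<close> if and only if rotation by
  \<open>m\<close> permutes the endpoint sets and \<open>m\<close> component promotions carry each
  component tableau to the one that rotation prescribes
  (\<open>fixed_iff_components_fixed\<close>). If \<open>T\<close> is fixed, the rotated partition
  is one for \<open>T\<close> itself; it has as many blocks as the finest one, so they are equal.
  Conversely, the restrictions to the blocks determine the word. Promotion is injective, since the
  path can be read off from its last step backwards (\<open>promote_start_inj\<close>), so the
  orbit is a cycle and its length is the least positive such \<open>m\<close>. The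
  \<open>m\<close> for which rotation permutes the endpoint sets are the multiples of
  \<open>N\<close>, which turns the least \<open>m\<close> into \<open>l * N\<close>. A tableau
  with a single row has no arcs and is fixed by promotion.
\<close>

section \<open>Balanced words and their arcs\<close>

definition row_count :: "(nat \<rightharpoonup> nat) \<Rightarrow> nat \<Rightarrow> nat \<Rightarrow> nat" where
  "row_count w i x = card {a. a \<le> x \<and> w a = Some i}"

text \<open>
  The height at \<open>x\<close> of the lattice path that steps up at row \<open>i\<close> and
  down at row \<open>i + 1\<close>; an integer, so that sums over blocks and differences behave.
\<close>

definition excess :: "(nat \<rightharpoonup> nat) \<Rightarrow> nat \<Rightarrow> nat \<Rightarrow> int" where
  "excess w i x = int (row_count w i x) - int (row_count w (Suc i) x)"

definition balanced_word :: "nat \<Rightarrow> nat \<Rightarrow> (nat \<rightharpoonup> nat) \<Rightarrow> bool" where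
  "balanced_word n r w \<longleftrightarrow> dom w \<subseteq> {1..n} \<and> ran w \<subseteq> {..<r} \<and>
     (\<forall>i x. Suc i < r \<longrightarrow> 0 \<le> excess w i x) \<and> (\<forall>i. Suc i < r \<longrightarrow> excess w i n = 0)"

lemma balanced_word_dom: "balanced_word n r w \<Longrightarrow> w a = Some i \<Longrightarrow> 1 \<le> a \<and> a \<le> n"
  unfolding balanced_word_def by (auto simp: subset_iff dom_def)

lemma balanced_word_0: "balanced_word n r w \<Longrightarrow> w 0 = None"
  using balanced_word_dom[of n r w 0] by (cases "w 0") auto

lemma balanced_word_row: "balanced_word n r w \<Longrightarrow> w a = Some i \<Longrightarrow> i < r"
  unfolding balanced_word_def by (auto simp: subset_iff ran_def)

lemma balanced_word_excess: "balanced_word n r w \<Longrightarrow> Suc i < r \<Longrightarrow> 0 \<le> excess w i x"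
  unfolding balanced_word_def by auto

lemma balanced_word_excess_end: "balanced_word n r w \<Longrightarrow> Suc i < r \<Longrightarrow> n \<le> x \<Longrightarrow> excess w i x = 0"
proof -
  assume w: "balanced_word n r w" and i: "Suc i < r" and x: "n \<le> x"
  have "{a. a \<le> x \<and> w a = Some k} = {a. a \<le> n \<and> w a = Some k}" for k
    using balanced_word_dom[OF w] x by force
  then show "excess w i x = 0" using w i unfolding balanced_word_def excess_def row_count_def by simp
qed

lemma row_count_Suc: "row_count w i (Suc x) = row_count w i x + (if w (Suc x) = Some i then 1 else 0)"
proof -
  have "{a. a \<le> Suc x \<and> w a = Some i} =
        (if w (Suc x) = Some i then insert (Suc x) {a. a \<le> x \<and> w a = Some i}
         else {a. a \<le> x \<and> w a = Some i})"
    by (auto simp: le_Suc_eq)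
  then show ?thesis unfolding row_count_def by simp
qed

lemma row_count_0: "w 0 = None \<Longrightarrow> row_count w i 0 = 0"
  unfolding row_count_def by (auto simp: card_eq_0_iff)

lemma row_count_mono: "x \<le> y \<Longrightarrow> row_count w i x \<le> row_count w i y"
  unfolding row_count_def by (rule card_mono) auto

lemma excess_Suc: "excess w i (Suc x) = excess w i x + (if w (Suc x) = Some i then 1 else 0)
    - (if w (Suc x) = Some (Suc i) then 1 else 0)"
  unfolding excess_def row_count_Suc by auto

lemma excess_opener: "balanced_word n r w \<Longrightarrow> Suc i < r \<Longrightarrow> w a = Some i \<Longrightarrow> 1 \<le> excess w i a"
  using excess_Suc[of w i "a - 1"] balanced_word_dom[of n r w a i] balanced_word_excess[of n r w i "a - 1"]
  by auto

text \<open>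
  The matching of openers in row \<open>i\<close> with closers in row \<open>i + 1\<close>, read
  as parentheses: the closer is the first return of the path below the level reached at the
  opener.
\<close>

definition arc :: "(nat \<rightharpoonup> nat) \<Rightarrow> nat \<Rightarrow> nat \<Rightarrow> nat \<Rightarrow> bool" where
  "arc w i a b \<longleftrightarrow> w a = Some i \<and> w b = Some (Suc i) \<and> a < b \<and> excess w i b = excess w i a - 1 \<and>
     (\<forall>x. a \<le> x \<and> x < b \<longrightarrow> excess w i a \<le> excess w i x)"

lemma arc_above: "arc w i a b \<Longrightarrow> a \<le> x \<Longrightarrow> x < b \<Longrightarrow> excess w i a \<le> excess w i x"
  unfolding arc_def by blast

lemma arcD: "arc w i a b \<Longrightarrow>
    w a = Some i \<and> w b = Some (Suc i) \<and> a < b \<and> excess w i b = excess w i a - 1"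
  unfolding arc_def by blast

text \<open>
  The path moves by steps of size at most one, so at the first position below a level it is
  exactly one below, and the step that leads there is a closer.
\<close>

lemma first_descent:
  assumes lt: "a < y" and hy: "excess w i y < excess w i a"
  defines "b \<equiv> LEAST x. a < x \<and> excess w i x < excess w i a"
  shows "a < b" "b \<le> y" "w b = Some (Suc i)" "excess w i b = excess w i a - 1"
    "\<And>x. a \<le> x \<Longrightarrow> x < b \<Longrightarrow> excess w i a \<le> excess w i x"
proof -
  have b: "a < b \<and> excess w i b < excess w i a"
    unfolding b_def by (rule LeastI[of _ y]) (use lt hy in simp)
  show "a < b" using b by simp
  show "b \<le> y" unfolding b_def by (rule Least_le) (use lt hy in simp)
  show below: "excess w i a \<le> excess w i x" if "a \<le> x" "x < b" for x
    using not_less_Least[of x "\<lambda>x. a < x \<and> excess w i x < excess w i a"] that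
    unfolding b_def by (cases "x = a") auto
  obtain b' where b': "b = Suc b'" using b by (cases b) auto
  have "excess w i a \<le> excess w i b'" using below[of b'] b b' by simp
  then show "w b = Some (Suc i)" "excess w i b = excess w i a - 1"
    using excess_Suc[of w i b'] b b' by (auto split: if_splits)
qed

lemma arc_from:
  assumes w: "balanced_word n r w" and i: "Suc i < r" and a: "w a = Some i"
  shows "\<exists>b. arc w i a b"
proof -
  have "1 \<le> excess w i a" using excess_opener[OF w i a] .
  then have n: "excess w i n < excess w i a" using balanced_word_excess_end[OF w i, of n] by simp
  moreover have "a < n" using n balanced_word_dom[OF w a] by (cases "a = n") auto
  ultimately show ?thesis using first_descent[of a n w i] a unfolding arc_def by blast
qed

lemma arc_closer_not_less: "arc w i a b \<Longrightarrow> arc w i a b' \<Longrightarrow> \<not> b < b'"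
  using arc_above[of w i a b' b] arcD[of w i a b] by auto

lemma arc_closer_unique: "arc w i a b \<Longrightarrow> arc w i a b' \<Longrightarrow> b = b'"
  using arc_closer_not_less by (meson linorder_neqE_nat)

lemma arc_opener_not_less: "arc w i a b \<Longrightarrow> arc w i a' b \<Longrightarrow> \<not> a < a'"
proof
  assume *: "arc w i a b" "arc w i a' b" "a < a'"
  obtain x where x: "a' = Suc x" using * by (cases a') auto
  have "excess w i a \<le> excess w i x"
    using arc_above[OF *(1), of x] arcD[OF *(2)] *(3) x by linarith
  moreover have "excess w i a' = excess w i x + 1" using excess_Suc[of w i x] arcD[OF *(2)] x by simp
  ultimately show False using arcD[OF *(1)] arcD[OF *(2)] by linarith
qed

lemma arc_opener_unique: "arc w i a b \<Longrightarrow> arc w i a' b \<Longrightarrow> a = a'"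
  using arc_opener_not_less by (meson linorder_neqE_nat)

lemma card_rows_eq:
  assumes w: "balanced_word n r w" and i: "Suc i < r"
  shows "card {a. w a = Some (Suc i)} = card {a. w a = Some i}"
proof -
  have "w a = Some k \<longleftrightarrow> a \<le> n \<and> w a = Some k" for k a
    using balanced_word_dom[OF w, of a k] by blast
  then show ?thesis using balanced_word_excess_end[OF w i, of n] unfolding excess_def row_count_def by simp
qed

lemma finite_row: "balanced_word n r w \<Longrightarrow> finite {a. w a = Some i}"
proof (rule finite_subset)
  assume w: "balanced_word n r w"
  show "{a. w a = Some i} \<subseteq> {1..n}"
  proof
    fix a assume "a \<in> {a. w a = Some i}"
    then show "a \<in> {1..n}" using balanced_word_dom[OF w, of a i] by simp
  qed
qed simp

text \<open>
  Openers have distinct closers, and there are equally many of both, so no closer is left over.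
\<close>

lemma arc_to:
  assumes w: "balanced_word n r w" and i: "Suc i < r" and b: "w b = Some (Suc i)"
  shows "\<exists>a. arc w i a b"
proof -
  let ?A = "{a. w a = Some i}" and ?B = "{b. w b = Some (Suc i)}"
  have "\<forall>a\<in>?A. \<exists>b. arc w i a b" using arc_from[OF w i] by simp
  then obtain f where f: "\<forall>a\<in>?A. arc w i a (f a)" by (rule bchoice[THEN exE])
  have sub: "f ` ?A \<subseteq> ?B"
  proof
    fix b assume "b \<in> f ` ?A"
    then obtain a where "arc w i a b" using f by blast
    then show "b \<in> ?B" using arcD by simp
  qed
  have "inj_on f ?A"
  proof (rule inj_onI)
    fix a a' assume "a \<in> ?A" "a' \<in> ?A" "f a = f a'"
    then have "arc w i a (f a)" "arc w i a' (f a)" using f by auto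
    then show "a = a'" by (rule arc_opener_unique)
  qed
  then have "card (f ` ?A) = card ?B" using card_rows_eq[OF w i] by (simp add: card_image)
  then have "f ` ?A = ?B" by (intro card_subset_eq[OF finite_row[OF w] sub])
  then obtain a where "a \<in> ?A" "b = f a" using b by blast
  then show ?thesis using f by blast
qed

lemma arc_nested:
  assumes w: "balanced_word n r w" and i: "Suc i < r" and ab: "arc w i a b"
    and a': "w a' = Some i" "a < a'" "a' < b"
  shows "\<exists>b'<b. arc w i a' b'"
proof -
  obtain b' where b': "arc w i a' b'" using arc_from[OF w i a'(1)] by blast
  obtain x where x: "a' = Suc x" using a' by (cases a') auto
  have "excess w i a \<le> excess w i x" using arc_above[OF ab, of x] a' x by linarith
  then have "excess w i b < excess w i a'"
    using excess_Suc[of w i x] arcD[OF ab] a' x by simp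
  then have "\<not> b < b'" using arc_above[OF b', of b] a' by auto
  moreover have "b' \<noteq> b" using arc_opener_not_less[OF ab] b' a' by blast
  ultimately have "b' < b" by simp
  then show ?thesis using b' by blast
qed

lemma endpoints_iff: "x \<in> endpoints M \<longleftrightarrow> (\<exists>y. (x, y) \<in> M \<or> (y, x) \<in> M)"
  unfolding endpoints_def by (auto simp: image_iff) force+

text \<open>
  When the closer \<open>b\<close> is processed, every opener strictly between \<open>b\<close>
  and its partner \<open>a\<close> has been matched already, by \<open>arc_nested\<close>, while
  \<open>a\<close> is free. So the largest free opener is \<open>a\<close>.
\<close>

lemma greedy_matching_prefix:
  assumes w: "balanced_word n r w" and i: "Suc i < r"
  shows "sorted_wrt (<) bs \<Longrightarrow> set bs \<subseteq> {b. w b = Some (Suc i)} \<Longrightarrow>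
    (\<forall>b\<in>set bs. \<forall>b'<b. w b' = Some (Suc i) \<longrightarrow> b' \<in> set bs) \<Longrightarrow>
    fold (add_arc {a. w a = Some i}) bs {} = {(a, b). arc w i a b \<and> b \<in> set bs}"
proof (induction bs rule: rev_induct)
  case Nil
  then show ?case by simp
next
  case (snoc b bs)
  let ?A = "{a. w a = Some i}" and ?M = "{(a, b). arc w i a b \<and> b \<in> set bs}"
  have less: "x < b" if "x \<in> set bs" for x
    using snoc.prems(1) that by (auto simp: sorted_wrt_append)
  have "\<forall>x\<in>set bs. \<forall>b'<x. w b' = Some (Suc i) \<longrightarrow> b' \<in> set bs"
  proof (intro ballI allI impI)
    fix x b' assume x: "x \<in> set bs" "b' < x" "w b' = Some (Suc i)"
    then have "b' \<in> set (bs @ [b])" using snoc.prems(3) by simp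
    moreover have "b' \<noteq> b" using less[OF x(1)] x(2) by simp
    ultimately show "b' \<in> set bs" by simp
  qed
  then have IH: "fold (add_arc ?A) bs {} = ?M"
  proof (intro snoc.IH)
    show "sorted_wrt (<) bs" using snoc.prems(1) by (simp add: sorted_wrt_append)
    show "set bs \<subseteq> {b. w b = Some (Suc i)}" using snoc.prems(2) by simp
  qed
  have bs: "b' \<in> set bs" if "b' < b" "w b' = Some (Suc i)" for b'
    using snoc.prems(3) that by auto
  have "w b = Some (Suc i)" using snoc.prems(2) by simp
  then obtain a where a: "arc w i a b" using arc_to[OF w i] by blast
  have open_iff: "x \<in> endpoints ?M \<longleftrightarrow> (\<exists>b'\<in>set bs. arc w i x b')" if "x \<in> ?A" for x
    using that arcD[of w i _ x] unfolding endpoints_iff by auto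
  let ?F = "{x \<in> ?A. x \<le> b \<and> x \<notin> endpoints ?M}"
  have "a \<in> ?F"
  proof -
    have "\<not> arc w i a b'" if "b' \<in> set bs" for b'
      using arc_closer_unique[OF a] less[OF that] by blast
    then show ?thesis using arcD[OF a] open_iff[of a] by auto
  qed
  moreover have "x \<le> a" if "x \<in> ?F" for x
  proof (rule ccontr)
    assume "\<not> x \<le> a"
    moreover have "x \<noteq> b" using that arcD[OF a] by auto
    ultimately have "w x = Some i" "a < x" "x < b" using that by auto
    then obtain b' where "b' < b" "arc w i x b'" using arc_nested[OF w i a] by blast
    then show False using that open_iff[of x] bs[of b'] arcD[of w i x b'] by blast
  qed
  ultimately have "Max ?F = a" by (intro Max_eqI) (auto intro: finite_subset[of _ "{..b}"])
  moreover have "?F \<noteq> {}" using \<open>a \<in> ?F\<close> by blast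
  ultimately have "add_arc ?A b ?M = insert (a, b) ?M"
    unfolding add_arc_def Let_def by (simp only: if_False)
  also have "\<dots> = {(x, y). arc w i x y \<and> y \<in> set (bs @ [b])}"
  proof -
    have "arc w i x b \<longleftrightarrow> x = a" for x using a arc_opener_unique[OF a, of x] by blast
    then show ?thesis by auto
  qed
  finally show ?case using IH by simp
qed

definition arcs :: "nat \<Rightarrow> (nat \<rightharpoonup> nat) \<Rightarrow> (nat \<times> nat) set" where
  "arcs r w = {(a, b). \<exists>i. Suc i < r \<and> arc w i a b}"

lemma arcs_less: "(a, b) \<in> arcs r w \<Longrightarrow> a < b"
  unfolding arcs_def arc_def by auto

lemma arcs_dom: "(a, b) \<in> arcs r w \<Longrightarrow> a \<in> dom w \<and> b \<in> dom w"
  unfolding arcs_def arc_def by auto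

lemma endpoints_arcs:
  assumes w: "balanced_word n r w" and r: "2 \<le> r"
  shows "endpoints (arcs r w) = dom w"
proof
  show "endpoints (arcs r w) \<subseteq> dom w"
    unfolding endpoints_iff subset_iff using arcs_dom by blast
  show "dom w \<subseteq> endpoints (arcs r w)"
  proof
    fix a assume "a \<in> dom w"
    then obtain i where i: "w a = Some i" by auto
    have "i < r" using balanced_word_row[OF w i] .
    show "a \<in> endpoints (arcs r w)"
    proof (cases "Suc i < r")
      case True
      then show ?thesis using arc_from[OF w True i]
        unfolding endpoints_iff arcs_def by blast
    next
      case False
      then obtain k where k: "i = Suc k" using r \<open>i < r\<close> by (cases i) auto
      then have "Suc k < r" "w a = Some (Suc k)" using i \<open>i < r\<close> by auto
      then show ?thesis using arc_to[OF w]
        unfolding endpoints_iff arcs_def by blast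
    qed
  qed
qed

section \<open>Promotion of words\<close>

text \<open>
  The entries that change rows during promotion: entry number \<open>i\<close> of this path leaves
  row \<open>i\<close> for the row above it, and the first one, 1, is removed. Slides in row
  \<open>i\<close> go right until the entry below the empty box comes before the entry to its
  right, and that entry below is the first zero of the excess.
\<close>

fun slide_path :: "(nat \<rightharpoonup> nat) \<Rightarrow> nat \<Rightarrow> nat" where
  "slide_path w 0 = 1"
| "slide_path w (Suc i) = (LEAST p. slide_path w i < p \<and> excess w i p = 0)"

declare slide_path.simps(2) [simp del]

lemma excess_0: "balanced_word n r w \<Longrightarrow> excess w i 0 = 0"
  using row_count_0[of w] balanced_word_0[of n r w] unfolding excess_def by simp

lemma first_letter:
  assumes w: "balanced_word n r w" and 1: "1 \<in> dom w"
  shows "w 1 = Some 0"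
proof -
  obtain i where i: "w 1 = Some i" using 1 by auto
  show ?thesis
  proof (cases i)
    case (Suc k)
    then have "excess w k 1 = - 1" using excess_Suc[of w k 0] excess_0[OF w, of k] i by simp
    moreover have "Suc k < r" using balanced_word_row[OF w i] Suc by simp
    ultimately show ?thesis using balanced_word_excess[OF w, of k 1] by simp
  qed (use i in simp)
qed

text \<open>
  The excess is positive at the letter \<open>i\<close> where the path enters, so its first zero
  is reached by a letter \<open>i + 1\<close>.
\<close>

lemma slide_path_step:
  assumes w: "balanced_word n r w" and i: "Suc i < r" and p: "w (slide_path w i) = Some i"
  shows "slide_path w i < slide_path w (Suc i)" "excess w i (slide_path w (Suc i)) = 0"
    "\<And>x. slide_path w i \<le> x \<Longrightarrow> x < slide_path w (Suc i) \<Longrightarrow> 1 \<le> excess w i x"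
    "w (slide_path w (Suc i)) = Some (Suc i)"
proof -
  let ?p = "slide_path w i" and ?q = "slide_path w (Suc i)"
  have pos: "1 \<le> excess w i ?p" using excess_opener[OF w i p] .
  have end0: "excess w i (n + 1 + ?p) = 0" using balanced_word_excess_end[OF w i, of "n + 1 + ?p"] by simp
  have q: "?p < ?q \<and> excess w i ?q = 0"
    unfolding slide_path.simps(2) by (rule LeastI[of _ "n + 1 + ?p"]) (use end0 in simp)
  then show pq: "?p < ?q" and q0: "excess w i ?q = 0" by auto
  show above: "1 \<le> excess w i x" if x: "?p \<le> x" "x < ?q" for x
  proof (cases "x = ?p")
    case False
    then have "excess w i x \<noteq> 0"
      using not_less_Least[of x "\<lambda>p. ?p < p \<and> excess w i p = 0"] x
      unfolding slide_path.simps(2) by auto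
    then show ?thesis using balanced_word_excess[OF w i, of x] by simp
  qed (use pos in simp)
  obtain x where x: "?q = Suc x" using pq by (cases ?q) auto
  then have "1 \<le> excess w i x" using above[of x] pq by simp
  then show "w ?q = Some (Suc i)" using excess_Suc[of w i x] q0 x by (auto split: if_splits)
qed

lemma slide_path_letter:
  assumes w: "balanced_word n r w" and 1: "1 \<in> dom w"
  shows "i < r \<Longrightarrow> w (slide_path w i) = Some i"
proof (induction i)
  case 0
  then show ?case using first_letter[OF w 1] by simp
next
  case (Suc i)
  then show ?case using slide_path_step(4)[OF w Suc.prems] by simp
qed

lemma slide_path_less:
  assumes w: "balanced_word n r w" and 1: "1 \<in> dom w" and i: "Suc i < r"
  shows "slide_path w i < slide_path w (Suc i)"
  using slide_path_step(1)[OF w i] slide_path_letter[OF w 1, of i] i by simp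

lemma slide_path_zero:
  assumes w: "balanced_word n r w" and 1: "1 \<in> dom w" and i: "Suc i < r"
  shows "excess w i (slide_path w (Suc i)) = 0"
  using slide_path_step(2)[OF w i] slide_path_letter[OF w 1, of i] i by simp

lemma slide_path_pos:
  assumes w: "balanced_word n r w" and 1: "1 \<in> dom w" and i: "Suc i < r"
    and x: "slide_path w i \<le> x" "x < slide_path w (Suc i)"
  shows "1 \<le> excess w i x"
  using slide_path_step(3)[OF w i _ x] slide_path_letter[OF w 1, of i] i by simp

lemma slide_path_bounds:
  assumes w: "balanced_word n r w" and 1: "1 \<in> dom w"
  shows "i < r \<Longrightarrow> Suc i \<le> slide_path w i \<and> slide_path w i \<le> n"
proof (induction i)
  case 0
  then show ?case using balanced_word_dom[OF w, of 1] 1 by auto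
next
  case (Suc i)
  then show ?case using slide_path_less[OF w 1 Suc.prems] slide_path_letter[OF w 1 Suc.prems]
      balanced_word_dom[OF w, of "slide_path w (Suc i)" "Suc i"] by simp
qed

text \<open>
  Promotion of a word that contains 1, as \<open>promote_with_tableau_of\<close> shows; it is kept
  apart from the case without 1, where no box slides.
\<close>

definition promote_start :: "nat \<Rightarrow> nat \<Rightarrow> (nat \<rightharpoonup> nat) \<Rightarrow> (nat \<rightharpoonup> nat)" where
  "promote_start n r w = (\<lambda>x. if x = n then Some (r - 1) else if x = 0 then None
     else if Suc x \<in> slide_path w ` {1..<r} then Some (the (w (Suc x)) - 1) else w (Suc x))"

lemma promote_start_iff:
  assumes w: "balanced_word n r w" and 1: "1 \<in> dom w" and x: "0 < x" "x \<noteq> n"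
  shows "promote_start n r w x = Some i \<longleftrightarrow>
    w (Suc x) = Some i \<and> Suc x \<noteq> slide_path w i \<or> Suc i < r \<and> Suc x = slide_path w (Suc i)"
proof (cases "\<exists>k. 1 \<le> k \<and> k < r \<and> Suc x = slide_path w k")
  case True
  then obtain k where k: "1 \<le> k" "k < r" "Suc x = slide_path w k" by blast
  obtain k' where k': "k = Suc k'" using k by (cases k) auto
  have let_k: "w (Suc x) = Some k" using slide_path_letter[OF w 1 k(2)] k(3) by simp
  have "Suc x \<in> slide_path w ` {1..<r}" using k by auto
  then have "promote_start n r w x = Some k'" using x k' let_k unfolding promote_start_def by simp
  moreover have "Suc i < r \<and> Suc x = slide_path w (Suc i) \<longleftrightarrow> i = k'"
  proof
    assume *: "Suc i < r \<and> Suc x = slide_path w (Suc i)"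
    then have "w (Suc x) = Some (Suc i)" using slide_path_letter[OF w 1, of "Suc i"] by simp
    then show "i = k'" using let_k k' by simp
  qed (use k k' in simp)
  moreover have "\<not> (w (Suc x) = Some i \<and> Suc x \<noteq> slide_path w i)"
    using let_k k(3) by auto
  ultimately show ?thesis by auto
next
  case False
  then have "Suc x \<notin> slide_path w ` {1..<r}" by auto
  then have "promote_start n r w x = w (Suc x)" using x unfolding promote_start_def by simp
  moreover have "Suc x \<noteq> slide_path w i" if "w (Suc x) = Some i"
    using balanced_word_row[OF w that] False x by (cases i) auto
  moreover have "\<not> (Suc i < r \<and> Suc x = slide_path w (Suc i))" using False by auto
  ultimately show ?thesis by auto
qed

lemma promote_start_0: "n \<noteq> 0 \<Longrightarrow> promote_start n r w 0 = None"
  unfolding promote_start_def by simp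

lemma promote_start_n: "promote_start n r w n = Some (r - 1)"
  unfolding promote_start_def by simp

text \<open>
  Bookkeeping for one position: a set gains the element in case \<open>D\<close> and loses it in
  case \<open>C\<close>.
\<close>

lemma of_bool_exchange:
  "(A \<longleftrightarrow> B \<and> \<not> C \<or> D) \<Longrightarrow> (C \<Longrightarrow> B) \<Longrightarrow> (D \<Longrightarrow> \<not> B) \<Longrightarrow>
    of_bool A + of_bool C = (of_bool B + of_bool D :: nat)"
  by (cases B; cases C; cases D) simp_all

text \<open>
  Row \<open>i\<close> loses its path entry to the row above and gains the next path entry from
  the row below; for \<open>i = 0\<close> the loss is the removed entry 1. Since path entries are
  compared with \<open>Suc x\<close>, both sides speak of the entries before the decrement.
\<close>

lemma row_count_promote_start:
  assumes w: "balanced_word n r w" and 1: "1 \<in> dom w" and i: "i < r"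
  shows "x < n \<Longrightarrow> row_count (promote_start n r w) i x + of_bool (slide_path w i \<le> Suc x) =
    row_count w i (Suc x) + of_bool (Suc i < r \<and> slide_path w (Suc i) \<le> Suc x)"
proof (induction x)
  case 0
  have "row_count (promote_start n r w) i 0 = 0"
    using row_count_0[of "promote_start n r w" i] promote_start_0[of n r w] 0 by simp
  moreover have "row_count w i (Suc 0) = of_bool (i = 0)"
    using row_count_Suc[of w i 0] row_count_0[of w i] balanced_word_0[OF w] first_letter[OF w 1] by simp
  moreover have "slide_path w i \<le> 1 \<longleftrightarrow> i = 0"
    using slide_path_bounds[OF w 1 i] by (cases i) auto
  moreover have "\<not> (Suc i < r \<and> slide_path w (Suc i) \<le> 1)"
    using slide_path_bounds[OF w 1, of "Suc i"] by auto
  ultimately show ?case by auto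
next
  case (Suc x)
  let ?y = "Suc (Suc x)"
  have "of_bool (promote_start n r w (Suc x) = Some i) + of_bool (slide_path w i = ?y) =
      (of_bool (w ?y = Some i) + of_bool (Suc i < r \<and> slide_path w (Suc i) = ?y) :: nat)"
  proof (rule of_bool_exchange)
    show "promote_start n r w (Suc x) = Some i \<longleftrightarrow>
        w ?y = Some i \<and> \<not> slide_path w i = ?y \<or> Suc i < r \<and> slide_path w (Suc i) = ?y"
      using promote_start_iff[OF w 1, of "Suc x" i] Suc.prems by auto
    show "w ?y = Some i" if "slide_path w i = ?y" using slide_path_letter[OF w 1 i] that by simp
    show "w ?y \<noteq> Some i" if "Suc i < r \<and> slide_path w (Suc i) = ?y"
      using slide_path_letter[OF w 1, of "Suc i"] that by simp
  qed
  moreover have le: "of_bool (p \<le> ?y) = of_bool (p \<le> Suc x) + (of_bool (p = ?y) :: nat)" for p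
    by (simp add: of_bool_def)
  moreover have "of_bool (Suc i < r \<and> slide_path w (Suc i) \<le> ?y) =
      of_bool (Suc i < r \<and> slide_path w (Suc i) \<le> Suc x) + (of_bool (Suc i < r \<and> slide_path w (Suc i) = ?y) :: nat)"
    using le[of "slide_path w (Suc i)"] by (cases "Suc i < r") simp_all
  moreover have "row_count (promote_start n r w) i (Suc x) = row_count (promote_start n r w) i x + of_bool (promote_start n r w (Suc x) = Some i)"
    "row_count w i ?y = row_count w i (Suc x) + of_bool (w ?y = Some i)"
    unfolding row_count_Suc[of _ _ x] row_count_Suc[of _ _ "Suc x"] by simp_all
  ultimately show ?case using Suc.IH Suc.prems by simp
qed

lemma row_count_promote_start_end:
  assumes w: "balanced_word n r w" and 1: "1 \<in> dom w" and i: "i < r" and x: "n \<le> x"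
  shows "row_count (promote_start n r w) i x = row_count w i n"
proof -
  obtain m where m: "n = Suc m" using slide_path_bounds[OF w 1 i] by (cases n) auto
  have beyond: "promote_start n r w y = None" if "n < y" for y
  proof (cases "promote_start n r w y")
    case (Some k)
    then have "w (Suc y) = Some k \<or> Suc k < r \<and> Suc y = slide_path w (Suc k)"
      using promote_start_iff[OF w 1, of y k] that by auto
    then show ?thesis using balanced_word_dom[OF w, of "Suc y" k] slide_path_bounds[OF w 1, of "Suc k"] that
      by auto
  qed simp
  have "{a. a \<le> x \<and> promote_start n r w a = Some i} = {a. a \<le> n \<and> promote_start n r w a = Some i}"
    using beyond x by (metis (no_types, lifting) linorder_not_less option.discI order_trans)
  then have "row_count (promote_start n r w) i x = row_count (promote_start n r w) i n"
    unfolding row_count_def by simp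
  also have "\<dots> = row_count (promote_start n r w) i m + of_bool (i = r - 1)"
    using row_count_Suc[of "promote_start n r w" i m] promote_start_n[of n r w] m by auto
  also have "\<dots> = row_count w i n"
    using row_count_promote_start[OF w 1 i, of m] m slide_path_bounds[OF w 1 i] slide_path_bounds[OF w 1, of "Suc i"] i
    by (cases "Suc i < r") (auto simp: of_bool_def)
  finally show ?thesis .
qed

lemma excess_promote_start:
  assumes w: "balanced_word n r w" and 1: "1 \<in> dom w" and i: "Suc i < r" and x: "x < n"
  shows "excess (promote_start n r w) i x = excess w i (Suc x) - of_bool (slide_path w i \<le> Suc x)
    + 2 * of_bool (slide_path w (Suc i) \<le> Suc x)
    - of_bool (Suc (Suc i) < r \<and> slide_path w (Suc (Suc i)) \<le> Suc x)"
  using row_count_promote_start[OF w 1 _ x, of i] row_count_promote_start[OF w 1 _ x, of "Suc i"] i unfolding excess_def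
  by (auto simp: of_bool_def split: if_splits)

text \<open>
  The excess of row \<open>i\<close> drops only between the path entries of rows \<open>i\<close>
  and \<open>i + 1\<close>, by one, and there it was positive.
\<close>

lemma excess_promote_start_nonneg:
  assumes w: "balanced_word n r w" and 1: "1 \<in> dom w" and i: "Suc i < r" and x: "x < n"
  shows "0 \<le> excess (promote_start n r w) i x"
  using excess_promote_start[OF w 1 i x] balanced_word_excess[OF w i, of "Suc x"] slide_path_pos[OF w 1 i, of "Suc x"]
    slide_path_less[OF w 1 i] slide_path_less[OF w 1, of "Suc i"]
  by (auto simp: of_bool_def split: if_splits)

lemma dom_promote_start:
  assumes w: "balanced_word n r w" and 1: "1 \<in> dom w" and r: "0 < r"
  shows "x \<in> dom (promote_start n r w) \<longleftrightarrow> x = n \<or> 0 < x \<and> Suc x \<in> dom w"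
proof (cases "x = n \<or> x = 0")
  case True
  then show ?thesis using promote_start_n[of n r w] promote_start_0[of n r w] by (cases "n = 0") auto
next
  case False
  then have "promote_start n r w x = Some i \<Longrightarrow> Suc x \<in> dom w" for i
    using promote_start_iff[OF w 1, of x i] slide_path_letter[OF w 1, of "Suc i"] by auto
  moreover have "x \<in> dom (promote_start n r w)" if "w (Suc x) = Some i" for i
    using False that unfolding promote_start_def by auto
  ultimately show ?thesis using False by blast
qed

lemma balanced_promote_start:
  assumes w: "balanced_word n r w" and 1: "1 \<in> dom w" and r: "0 < r"
  shows "balanced_word n r (promote_start n r w)"
  unfolding balanced_word_def
proof (intro conjI allI impI)
  have n: "1 \<le> n" using slide_path_bounds[OF w 1 r] by simp
  show "dom (promote_start n r w) \<subseteq> {1..n}"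
  proof
    fix x assume "x \<in> dom (promote_start n r w)"
    then have "x = n \<or> 0 < x \<and> Suc x \<in> dom w" using dom_promote_start[OF w 1 r] by blast
    then show "x \<in> {1..n}" using balanced_word_dom[OF w, of "Suc x"] n by auto
  qed
  show "ran (promote_start n r w) \<subseteq> {..<r}"
  proof
    fix k assume "k \<in> ran (promote_start n r w)"
    then obtain x where x: "promote_start n r w x = Some k" unfolding ran_def by blast
    then have "x \<noteq> 0" using promote_start_0[of n r w] n by (intro notI) auto
    show "k \<in> {..<r}"
    proof (cases "x = n")
      case True
      then show ?thesis using x promote_start_n[of n r w] r by simp
    next
      case False
      then have "w (Suc x) = Some k \<or> Suc k < r"
        using promote_start_iff[OF w 1, of x k] x \<open>x \<noteq> 0\<close> by auto
      then show ?thesis using balanced_word_row[OF w, of "Suc x" k] by auto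
    qed
  qed
  fix i assume i: "Suc i < r"
  have end0: "excess (promote_start n r w) i x = 0" if "n \<le> x" for x
    using row_count_promote_start_end[OF w 1 _ that, of i] row_count_promote_start_end[OF w 1 _ that, of "Suc i"] i
      balanced_word_excess_end[OF w i, of n] unfolding excess_def by simp
  then show "excess (promote_start n r w) i n = 0" by simp
  show "0 \<le> excess (promote_start n r w) i x" for x
    using end0[of x] excess_promote_start_nonneg[OF w 1 i, of x] by (cases "x < n") auto
qed

text \<open>
  In the promoted word the path entry from row \<open>i + 1\<close> is the last position before
  the next path entry whose preceding excess is zero: from that path entry on, up to the next one,
  the excess is at least one. Two words with the same promotion that agree in the next path entry
  therefore agree in this one.
\<close>

lemma slide_path_eq_if_promote_start_eq:
  assumes w: "balanced_word n r w" "1 \<in> dom w" and v: "balanced_word n r v" "1 \<in> dom v"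
    and eq: "promote_start n r w = promote_start n r v" and i: "Suc i < r"
    and next_eq: "Suc (Suc i) < r \<Longrightarrow> slide_path w (Suc (Suc i)) = slide_path v (Suc (Suc i))"
  shows "\<not> slide_path w (Suc i) < slide_path v (Suc i)"
proof
  assume less: "slide_path w (Suc i) < slide_path v (Suc i)"
  obtain x where x: "slide_path v (Suc i) = Suc (Suc x)"
    using slide_path_bounds[OF v, of "Suc i"] i by (metis Suc_le_D Suc_le_mono)
  have "Suc (Suc x) \<le> n" using slide_path_bounds[OF v i] x by simp
  then have xn: "x < n" by simp
  have "slide_path v i \<le> Suc x" using slide_path_less[OF v i] x by simp
  moreover have "\<not> (Suc (Suc i) < r \<and> slide_path v (Suc (Suc i)) \<le> Suc x)"
    using slide_path_less[OF v, of "Suc i"] x by auto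
  moreover have "excess v i (Suc x) = 1"
    using excess_Suc[of v i "Suc x"] x slide_path_zero[OF v i] slide_path_letter[OF v i] by simp
  ultimately have "excess (promote_start n r v) i x = 0"
    using excess_promote_start[OF v i xn] x by (auto simp: of_bool_def split: if_splits)
  moreover have "excess (promote_start n r w) i x \<ge> 1"
  proof -
    have "\<not> (Suc (Suc i) < r \<and> slide_path w (Suc (Suc i)) \<le> Suc x)"
      using next_eq slide_path_less[OF v, of "Suc i"] x by auto
    moreover have "slide_path w i \<le> Suc x" "slide_path w (Suc i) \<le> Suc x"
      using less x slide_path_less[OF w i] by auto
    ultimately show ?thesis
      using excess_promote_start[OF w i xn] balanced_word_excess[OF w(1) i, of "Suc x"]
      by (auto simp: of_bool_def split: if_splits)
  qed
  ultimately show False using eq by simp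
qed

text \<open>
  The path is recovered from its end backwards, and undoing the change of letters recovers the
  word.
\<close>

lemma promote_start_inj:
  assumes w: "balanced_word n r w" "1 \<in> dom w" and v: "balanced_word n r v" "1 \<in> dom v"
    and eq: "promote_start n r w = promote_start n r v"
  shows "w = v"
proof -
  have slide_path_eq: "slide_path w i = slide_path v i" if "1 \<le> i" "i < r" for i
    using that
  proof (induction "r - i" arbitrary: i)
    case (Suc m)
    have next_eq: "slide_path w (Suc i) = slide_path v (Suc i)" if "Suc i < r"
      using Suc that by auto
    obtain k where k: "i = Suc k" using Suc.prems by (cases i) auto
    have "\<not> slide_path w i < slide_path v i" "\<not> slide_path v i < slide_path w i"
      using slide_path_eq_if_promote_start_eq[OF w v eq, of k] slide_path_eq_if_promote_start_eq[OF v w eq[symmetric], of k]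
        next_eq Suc.prems k by auto
    then show ?case by simp
  qed simp
  show ?thesis
  proof
    fix y
    consider "y = 0" | "y = 1" | "n < y" | x where "y = Suc x" "0 < x" "x < n"
      by (cases y) (auto, metis Suc_lessI not_less_eq zero_less_iff_neq_zero)
    then show "w y = v y"
    proof cases
      case 1
      then show ?thesis using balanced_word_0 w v by metis
    next
      case 2
      then show ?thesis using first_letter w v by metis
    next
      case 3
      then show ?thesis using balanced_word_dom[OF w(1), of y] balanced_word_dom[OF v(1), of y]
        by (cases "w y"; cases "v y") auto
    next
      case 4
      have "w y = Some i \<Longrightarrow> v y = Some i" if w: "balanced_word n r w" "1 \<in> dom w"
        and v: "balanced_word n r v" "1 \<in> dom v"
        and eq: "promote_start n r w = promote_start n r v" and ch: "\<And>i. 1 \<le> i \<Longrightarrow> i < r \<Longrightarrow> slide_path w i = slide_path v i"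
        for i w v
      proof (cases "y = slide_path w i")
        case True
        assume "w y = Some i"
        then have i: "i < r" using balanced_word_row[OF w(1)] by blast
        moreover have "i \<noteq> 0" using True 4 by (intro notI) simp
        ultimately show ?thesis using True ch[of i] slide_path_letter[OF v i] by simp
      next
        case False
        assume wy: "w y = Some i"
        then have "promote_start n r v x = Some i" using promote_start_iff[OF w, of x i] 4 False eq by auto
        moreover have "y \<noteq> slide_path v (Suc i)" if "Suc i < r"
          using ch[of "Suc i"] that slide_path_letter[OF w that] wy by auto
        ultimately show ?thesis using promote_start_iff[OF v, of x i] 4 by auto
      qed
      note imp = this
      show ?thesis
        using imp[OF w v eq slide_path_eq] imp[OF v w eq[symmetric] slide_path_eq[symmetric]]
        by (cases "w y"; cases "v y") auto
    qed
  qed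
qed

definition shift_word :: "(nat \<rightharpoonup> nat) \<Rightarrow> (nat \<rightharpoonup> nat)" where
  "shift_word w = (\<lambda>x. if x = 0 then None else w (Suc x))"

lemma row_count_shift_word:
  assumes "w 0 = None" "1 \<notin> dom w"
  shows "row_count (shift_word w) i x = row_count w i (Suc x)"
proof (induction x)
  case 0
  have "w (Suc 0) = None" using assms by auto
  then show ?case using row_count_Suc[of w i 0] row_count_0[of w i] assms(1) row_count_0[of "shift_word w" i]
    unfolding shift_word_def by simp
next
  case (Suc x)
  then show ?case unfolding row_count_Suc[of _ _ "Suc x"] row_count_Suc[of "shift_word w" i x]
    by (simp add: shift_word_def)
qed

lemma balanced_shift_word:
  assumes w: "balanced_word n r w" and 1: "1 \<notin> dom w"
  shows "balanced_word n r (shift_word w)"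
proof -
  have excess: "excess (shift_word w) i x = excess w i (Suc x)" for i x
    using row_count_shift_word[OF balanced_word_0[OF w] 1] unfolding excess_def by simp
  have "dom (shift_word w) \<subseteq> {1..n}"
  proof
    fix x assume "x \<in> dom (shift_word w)"
    then show "x \<in> {1..n}" using balanced_word_dom[OF w, of "Suc x"] unfolding shift_word_def
      by (auto split: if_splits)
  qed
  moreover have "ran (shift_word w) \<subseteq> ran w"
    unfolding shift_word_def ran_def by (auto split: if_splits)
  ultimately show ?thesis
    using w balanced_word_excess_end[OF w, of _ "Suc n"] unfolding balanced_word_def excess by auto
qed

definition promote :: "nat \<Rightarrow> nat \<Rightarrow> (nat \<rightharpoonup> nat) \<Rightarrow> (nat \<rightharpoonup> nat)" where
  "promote n r w = (if 1 \<in> dom w then promote_start n r w else shift_word w)"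

lemma balanced_promote:
  assumes w: "balanced_word n r w" and r: "0 < r"
  shows "balanced_word n r (promote n r w)"
  using balanced_promote_start[OF w _ r] balanced_shift_word[OF w] unfolding promote_def by simp

section \<open>Tableaux of words\<close>

text \<open>
  For an entry \<open>a\<close> of row \<open>i\<close> this is its column in the left-justified
  filling.
\<close>

definition column :: "(nat \<rightharpoonup> nat) \<Rightarrow> nat \<Rightarrow> nat \<Rightarrow> nat" where
  "column w i a = card {b. b < a \<and> w b = Some i}"

lemma column_mono: "a \<le> a' \<Longrightarrow> column w i a \<le> column w i a'"
  unfolding column_def by (rule card_mono) auto

lemma column_Suc: "column w i (Suc a) = row_count w i a"
  unfolding column_def row_count_def by (simp add: less_Suc_eq_le)

lemma row_count_eq_column: "row_count w i a = column w i a + (if w a = Some i then 1 else 0)"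
proof -
  have "{b. b \<le> a \<and> w b = Some i} = (if w a = Some i then insert a {b. b < a \<and> w b = Some i}
      else {b. b < a \<and> w b = Some i})"
    by (auto simp: le_less)
  then show ?thesis unfolding row_count_def column_def by simp
qed

lemma column_less: "w a = Some i \<Longrightarrow> a < a' \<Longrightarrow> column w i a < column w i a'"
  using row_count_eq_column[of w i a] column_mono[of "Suc a" a' w i] column_Suc[of w i a] by simp

lemma column_cong: "(\<And>b. v b = Some i \<longleftrightarrow> w b = Some i) \<Longrightarrow> column v i a = column w i a"
  unfolding column_def by simp

lemma column_remove:
  assumes "\<And>b. v b = Some i \<longleftrightarrow> w b = Some i \<and> b \<noteq> p" and p: "w p = Some i"
  shows "column w i a = column v i a + (if p < a then 1 else 0)"
proof -
  have "{b. b < a \<and> v b = Some i} = {b. b < a \<and> w b = Some i} - {p}"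
    using assms(1) by blast
  moreover have "p \<in> {b. b < a \<and> w b = Some i} \<longleftrightarrow> p < a" using p by simp
  moreover have "finite {b. b < a \<and> w b = Some i}" by simp
  ultimately show ?thesis unfolding column_def
    using card.remove[of "{b. b < a \<and> w b = Some i}" p] by (cases "p < a") auto
qed

lemma column_inj:
  assumes "w a = Some i" "w a' = Some i" "column w i a = column w i a'"
  shows "a = a'"
  using column_less[of w a i a'] column_less[of w a' i a] assms by (cases a a' rule: linorder_cases) auto

lemma column_surj:
  "k < row_count w i x \<Longrightarrow> w 0 = None \<Longrightarrow> \<exists>a\<le>x. w a = Some i \<and> column w i a = k"
proof (induction x)
  case 0
  then show ?case using row_count_0[of w i] by simp
next
  case (Suc x)
  show ?case
  proof (cases "k < row_count w i x")
    case True
    then show ?thesis using Suc.IH Suc.prems(2) le_SucI by blast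
  next
    case False
    then have "w (Suc x) = Some i" "k = row_count w i x"
      using Suc.prems(1) unfolding row_count_Suc by (auto split: if_splits)
    then show ?thesis using column_Suc[of w i x] by auto
  qed
qed

definition tableau_of :: "(nat \<rightharpoonup> nat) \<Rightarrow> tableau" where
  "tableau_of w = (\<lambda>(i, j). if \<exists>a. w a = Some i \<and> column w i a = j
     then Some (THE a. w a = Some i \<and> column w i a = j) else None)"

lemma tableau_of_iff: "tableau_of w (i, j) = Some a \<longleftrightarrow> w a = Some i \<and> column w i a = j"
proof -
  have the: "(THE a. w a = Some i \<and> column w i a = j) = b" if "w b = Some i \<and> column w i b = j" for b
    using that column_inj[of w _ i b] by (intro the_equality) auto
  show ?thesis
  proof (cases "\<exists>a. w a = Some i \<and> column w i a = j")
    case True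
    then obtain b where b: "w b = Some i \<and> column w i b = j" by blast
    then have "tableau_of w (i, j) = Some b" using the[OF b] True unfolding tableau_of_def by simp
    then show ?thesis using b column_inj[of w a i b] by auto
  next
    case False
    then show ?thesis unfolding tableau_of_def by auto
  qed
qed

lemma tableau_of_eqI:
  assumes "\<And>i j a. T (i, j) = Some a \<longleftrightarrow> w a = Some i \<and> column w i a = j"
  shows "T = tableau_of w"
proof
  fix x :: "nat \<times> nat"
  obtain i j where x: "x = (i, j)" by (cases x)
  have "T (i, j) = Some a \<longleftrightarrow> tableau_of w (i, j) = Some a" for a
    using assms tableau_of_iff by simp
  then show "T x = tableau_of w x" unfolding x by (metis not_None_eq)
qed

lemma tableau_of_inj:
  assumes "tableau_of w = tableau_of v"
  shows "w = v"
proof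
  fix a
  have "w a = Some i \<longleftrightarrow> v a = Some i" for i
    using tableau_of_iff[of w i _ a] tableau_of_iff[of v i _ a] assms by auto
  then show "w a = v a" by (metis not_None_eq)
qed

lemma ran_tableau_of: "ran (tableau_of w) = dom w"
proof -
  have "a \<in> ran (tableau_of w) \<longleftrightarrow> a \<in> dom w" for a
  proof
    assume "a \<in> ran (tableau_of w)"
    then obtain x where x: "tableau_of w x = Some a" unfolding ran_def by blast
    obtain i j where "x = (i, j)" by (cases x)
    then show "a \<in> dom w" using x tableau_of_iff[of w i j a] by auto
  next
    assume "a \<in> dom w"
    then obtain i where "w a = Some i" by auto
    then show "a \<in> ran (tableau_of w)"
      using tableau_of_iff[of w i "column w i a" a] unfolding ran_def by blast
  qed
  then show ?thesis by blast
qed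

lemma tableau_of_shift_word:
  assumes 0: "w 0 = None" and 1: "1 \<notin> dom w"
  shows "decrement (tableau_of w) = tableau_of (shift_word w)"
proof (rule tableau_of_eqI)
  fix i j a
  have "w (Suc 0) = None" using 1 by auto
  then have *: "column (shift_word w) i a = column w i (Suc a)" for a
    using row_count_shift_word[OF 0 1, of i "a - 1"] column_Suc[of "shift_word w" i "a - 1"] column_Suc[of w i a]
      row_count_eq_column[of w i 1] row_count_eq_column[of w i 0] column_Suc[of w i 0] 0
    by (cases a) (auto simp: column_def shift_word_def)
  have "decrement (tableau_of w) (i, j) = Some a \<longleftrightarrow> (\<exists>b. tableau_of w (i, j) = Some b \<and> b - 1 = a)"
    unfolding decrement_def by simp
  also have "\<dots> \<longleftrightarrow> (\<exists>b. w b = Some i \<and> column w i b = j \<and> b - 1 = a)"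
    unfolding tableau_of_iff by simp
  also have "\<dots> \<longleftrightarrow> w (Suc a) = Some i \<and> a \<noteq> 0 \<and> column w i (Suc a) = j"
  proof
    assume "\<exists>b. w b = Some i \<and> column w i b = j \<and> b - 1 = a"
    then obtain b where b: "w b = Some i" "column w i b = j" "b - 1 = a" by blast
    have "b \<noteq> 0" using b(1) 0 by (cases "b = 0") auto
    moreover have "b \<noteq> 1" using b(1) \<open>w (Suc 0) = None\<close> by (cases "b = 1") auto
    ultimately have "b = Suc a" "a \<noteq> 0" using b(3) by auto
    then show "w (Suc a) = Some i \<and> a \<noteq> 0 \<and> column w i (Suc a) = j" using b by simp
  next
    assume "w (Suc a) = Some i \<and> a \<noteq> 0 \<and> column w i (Suc a) = j"
    then show "\<exists>b. w b = Some i \<and> column w i b = j \<and> b - 1 = a"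
      by (intro exI[of _ "Suc a"]) simp
  qed
  finally show "decrement (tableau_of w) (i, j) = Some a \<longleftrightarrow> shift_word w a = Some i \<and> column (shift_word w) i a = j"
    unfolding * by (simp add: shift_word_def)
qed

text \<open>
  The rows of the entries after \<open>k\<close> downward moves of the empty box, before
  decrementing.
\<close>

fun stage :: "(nat \<rightharpoonup> nat) \<Rightarrow> nat \<Rightarrow> (nat \<rightharpoonup> nat)" where
  "stage w 0 = w(1 := None)"
| "stage w (Suc k) = (stage w k)(slide_path w (Suc k) \<mapsto> k)"

lemma stage_row:
  assumes w: "balanced_word n r w" and 1: "1 \<in> dom w"
  shows "k < r \<Longrightarrow> stage w k a = Some i \<longleftrightarrow>
    (if i < k then w a = Some i \<and> a \<noteq> slide_path w i \<or> a = slide_path w (Suc i)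
     else if i = k then w a = Some k \<and> a \<noteq> slide_path w k else w a = Some i)"
proof (induction k arbitrary: i)
  case 0
  then show ?case using first_letter[OF w 1] by auto
next
  case (Suc k)
  have p: "w (slide_path w (Suc k)) = Some (Suc k)" "w (slide_path w k) = Some k"
    using slide_path_letter[OF w 1] Suc.prems by auto
  show ?case
  proof (cases "a = slide_path w (Suc k)")
    case True
    then have "w a = Some (Suc k)" using p by simp
    moreover have "a = slide_path w (Suc i) \<longleftrightarrow> i = k" if "i < Suc k"
    proof
      assume "a = slide_path w (Suc i)"
      then have "w a = Some (Suc i)" using slide_path_letter[OF w 1, of "Suc i"] that Suc.prems by simp
      then show "i = k" using \<open>w a = Some (Suc k)\<close> by simp
    qed (use True in simp)
    moreover have "stage w (Suc k) a = Some k" using True by simp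
    ultimately show ?thesis using True by (cases "i < Suc k"; cases "i = Suc k") auto
  next
    case False
    then have "stage w (Suc k) a = stage w k a" by simp
    then show ?thesis using Suc.IH[of i] Suc.prems False by (auto simp: less_Suc_eq)
  qed
qed

text \<open>
  The filling of the word \<open>v\<close> with the empty box kept at \<open>(i, j)\<close>: in
  row \<open>i\<close> the entries from column \<open>j\<close> on are displaced by one.
\<close>

definition tableau_with_hole :: "(nat \<rightharpoonup> nat) \<Rightarrow> nat \<Rightarrow> nat \<Rightarrow> tableau \<Rightarrow> bool" where
  "tableau_with_hole v i j S \<longleftrightarrow> (\<forall>i' j' a. S (i', j') = Some a \<longleftrightarrow>
     v a = Some i' \<and> j' = column v i' a + (if i' = i \<and> j \<le> column v i' a then 1 else 0))"

lemma tableau_with_holeD: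
  "tableau_with_hole v i j S \<Longrightarrow> S (i', j') = Some a \<longleftrightarrow>
     v a = Some i' \<and> j' = column v i' a + (if i' = i \<and> j \<le> column v i' a then 1 else 0)"
  unfolding tableau_with_hole_def by blast

lemma tableau_with_hole_right:
  assumes S: "tableau_with_hole v i j S" and a: "v a = Some i" "column v i a = j"
  shows "tableau_with_hole v i (Suc j) (S((i, j) \<mapsto> a, (i, Suc j) := None))"
  unfolding tableau_with_hole_def
proof (intro allI)
  fix i' j' b
  let ?S = "S((i, j) \<mapsto> a, (i, Suc j) := None)"
  let ?R = "v b = Some i' \<and> j' = column v i' b + (if i' = i \<and> Suc j \<le> column v i' b then 1 else 0)"
  consider "i' = i" "j' = j" | "i' = i" "j' = Suc j" | "(i', j') \<noteq> (i, j)" "(i', j') \<noteq> (i, Suc j)"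
    by auto
  then show "?S (i', j') = Some b \<longleftrightarrow> ?R"
  proof cases
    case 1
    then have "?S (i', j') = Some a" by simp
    moreover have "?R \<longleftrightarrow> a = b"
    proof
      assume ?R
      then have "v b = Some i" "column v i b = j"
        using 1 by (auto split: if_splits)
      then show "a = b" using a column_inj[of v b i a] by simp
    qed (use 1 a in auto)
    ultimately show ?thesis by simp
  next
    case 2
    have "\<not> ?R" using 2 a by auto
    then show ?thesis using 2 by simp
  next
    case 3
    then have "?S (i', j') = S (i', j')" by auto
    then show ?thesis using tableau_with_holeD[OF S, of i' j' b] 3 by auto
  qed
qed

text \<open>
  The entry \<open>b\<close> from below may fill the empty box because exactly \<open>j\<close>
  entries of the upper row are smaller; the gap it leaves in its old row is the new empty box.
\<close>

lemma tableau_with_hole_down: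
  assumes S: "tableau_with_hole v i j S" and b: "v b = Some (Suc i)" "column v (Suc i) b = j" "column v i b = j"
  shows "tableau_with_hole (v(b \<mapsto> i)) (Suc i) j (S((i, j) \<mapsto> b, (Suc i, j) := None))"
  unfolding tableau_with_hole_def
proof (intro allI)
  let ?v = "v(b \<mapsto> i)"
  let ?S = "S((i, j) \<mapsto> b, (Suc i, j) := None)"
  have column_i: "column ?v i a = column v i a + (if b < a then 1 else 0)" for a
    by (rule column_remove) (use b in auto)
  have column_Si: "column v (Suc i) a = column ?v (Suc i) a + (if b < a then 1 else 0)" for a
    by (rule column_remove) (use b in auto)
  have column_other: "column ?v k a = column v k a" if "k \<noteq> i" "k \<noteq> Suc i" for k a
    by (rule column_cong) (use b that in auto)
  fix i' j' a
  let ?R = "?v a = Some i' \<and> j' = column ?v i' a + (if i' = Suc i \<and> j \<le> column ?v i' a then 1 else 0)"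
  consider "i' = i" | "i' = Suc i" | "i' \<noteq> i" "i' \<noteq> Suc i" by blast
  then show "?S (i', j') = Some a \<longleftrightarrow> ?R"
  proof cases
    case 1
    have pos: "column ?v i a = column v i a + (if j \<le> column v i a then 1 else 0)" if "v a = Some i"
      using column_less[of v a i b] column_mono[of b a v i] b that column_i[of a]
      by (cases a b rule: linorder_cases) auto
    show ?thesis
    proof (cases "a = b")
      case True
      have "S (i, j') \<noteq> Some b" using tableau_with_holeD[OF S, of i j' b] b by auto
      then show ?thesis using 1 True b column_i[of b] by auto
    next
      case False
      have "S (i, j) \<noteq> Some a" using tableau_with_holeD[OF S, of i j a] by auto
      then show ?thesis using 1 False tableau_with_holeD[OF S, of i j' a] pos by auto
    qed
  next
    case 2
    have pos: "column v (Suc i) a = column ?v (Suc i) a + (if j \<le> column ?v (Suc i) a then 1 else 0)"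
      if "v a = Some (Suc i)" "a \<noteq> b"
      using column_less[of v a "Suc i" b] column_less[of v b "Suc i" a] b that column_Si[of a]
      by (cases a b rule: linorder_cases) auto
    show ?thesis
    proof (cases "a = b")
      case True
      have "S (Suc i, j') = Some b \<Longrightarrow> j' = j"
        using tableau_with_holeD[OF S, of "Suc i" j' b] b by auto
      then show ?thesis using 2 True by auto
    next
      case False
      have "S (Suc i, j) \<noteq> Some a"
        using tableau_with_holeD[OF S, of "Suc i" j a] column_inj[of v a "Suc i" b] b False by auto
      then show ?thesis using 2 False tableau_with_holeD[OF S, of "Suc i" j' a] pos by auto
    qed
  next
    case 3
    then show ?thesis using tableau_with_holeD[OF S, of i' j' a] column_other[of i' a] b by auto
  qed
qed

section \<open>Sliding computes promotion of words\<close>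

text \<open>
  The last clause records that no earlier column of row \<open>i\<close> was a place to move down,
  so that the next downward move happens at the first zero of the excess.
\<close>

definition slide_inv :: "(nat \<rightharpoonup> nat) \<Rightarrow> nat \<Rightarrow> nat \<Rightarrow> tableau \<times> (nat \<times> nat) \<Rightarrow> bool" where
  "slide_inv w r c = (\<lambda>(S, (i, j)). i < r \<and> j < c \<and> tableau_with_hole (stage w i) i j S \<and>
     column w i (slide_path w i) \<le> j \<and>
     (Suc i < r \<longrightarrow> (\<forall>b. w b = Some (Suc i) \<longrightarrow> slide_path w i < b \<longrightarrow> column w (Suc i) b < j \<longrightarrow> excess w i b \<noteq> 0)))"

lemma row_count_row:
  assumes w: "balanced_word n r w"
  shows "i < r \<Longrightarrow> row_count w i n = row_count w 0 n"
proof (induction i)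
  case (Suc i)
  then show ?case using balanced_word_excess_end[OF w Suc.prems, of n] unfolding excess_def by simp
qed simp

lemma column_less_row_count: "balanced_word n r w \<Longrightarrow> w a = Some i \<Longrightarrow> column w i a < row_count w i n"
  using row_count_eq_column[of w i a] row_count_mono[of a n w i] balanced_word_dom[of n r w a i] by simp

context
  fixes n r w
  assumes w: "balanced_word n r w" and 1: "1 \<in> dom w"
begin

lemma hole_right:
  assumes S: "tableau_with_hole (stage w i) i j S" and i: "i < r" and j: "column w i (slide_path w i) \<le> j"
  shows "S (i, Suc j) = Some a \<longleftrightarrow> w a = Some i \<and> column w i a = Suc j"
    and "S (i, Suc j) = Some a \<Longrightarrow> stage w i a = Some i \<and> column (stage w i) i a = j"
proof -
  have row: "stage w i a = Some i \<longleftrightarrow> w a = Some i \<and> a \<noteq> slide_path w i" for a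
    using stage_row[OF w 1 i, of a i] by simp
  have p: "w (slide_path w i) = Some i" using slide_path_letter[OF w 1 i] .
  have rem: "column w i a = column (stage w i) i a + (if slide_path w i < a then 1 else 0)"
    by (rule column_remove[OF row p])
  have "S (i, Suc j) = Some a \<longleftrightarrow> stage w i a = Some i \<and> column (stage w i) i a = j"
    using tableau_with_holeD[OF S, of i "Suc j" a] by auto
  moreover have "stage w i a = Some i \<and> column (stage w i) i a = j \<longleftrightarrow> w a = Some i \<and> column w i a = Suc j"
  proof
    assume *: "stage w i a = Some i \<and> column (stage w i) i a = j"
    then have "w a = Some i" "a \<noteq> slide_path w i" using row[of a] by auto
    then show "w a = Some i \<and> column w i a = Suc j"
      using * rem column_less[of w a i "slide_path w i"] j by (cases a "slide_path w i" rule: linorder_cases) auto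
  next
    assume *: "w a = Some i \<and> column w i a = Suc j"
    then have "slide_path w i < a"
      using j column_mono[of a "slide_path w i" w i] by (cases "slide_path w i < a") auto
    then show "stage w i a = Some i \<and> column (stage w i) i a = j" using * row[of a] rem by simp
  qed
  ultimately show "S (i, Suc j) = Some a \<longleftrightarrow> w a = Some i \<and> column w i a = Suc j"
    and "S (i, Suc j) = Some a \<Longrightarrow> stage w i a = Some i \<and> column (stage w i) i a = j" by blast+
qed

lemma hole_below:
  assumes S: "tableau_with_hole (stage w i) i j S" and i: "i < r"
  shows "S (Suc i, j) = Some b \<longleftrightarrow> w b = Some (Suc i) \<and> column w (Suc i) b = j"
proof -
  have row: "stage w i a = Some (Suc i) \<longleftrightarrow> w a = Some (Suc i)" for a
    using stage_row[OF w 1 i, of a "Suc i"] by simp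
  have "column (stage w i) (Suc i) b = column w (Suc i) b" by (rule column_cong[OF row])
  then show ?thesis using tableau_with_holeD[OF S, of "Suc i" j b] row[of b] by auto
qed

text \<open>
  The entry \<open>b\<close> in column \<open>j\<close> of the lower row has \<open>j + 1\<close>
  entries of its row up to it, so the excess vanishes if and only if the entry of the upper row in
  column \<open>j + 1\<close> is absent or comes later.
\<close>

lemma below_height:
  assumes i: "Suc i < r" and b: "w b = Some (Suc i)" "column w (Suc i) b = j"
  shows "excess w i b = 0 \<longleftrightarrow> \<not> (\<exists>a<b. w a = Some i \<and> column w i a = Suc j)"
proof -
  have excess: "excess w i b = int (row_count w i b) - int (Suc j)"
    using row_count_eq_column[of w "Suc i" b] b unfolding excess_def by simp
  then have "Suc j \<le> row_count w i b" using balanced_word_excess[OF w i, of b] by simp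
  moreover have "Suc j < row_count w i b \<longleftrightarrow> (\<exists>a<b. w a = Some i \<and> column w i a = Suc j)"
  proof
    assume "Suc j < row_count w i b"
    then obtain a where a: "a \<le> b" "w a = Some i" "column w i a = Suc j"
      using column_surj[of "Suc j" w i b] balanced_word_0[OF w] by blast
    moreover have "a \<noteq> b" using a b by auto
    ultimately show "\<exists>a<b. w a = Some i \<and> column w i a = Suc j" by (intro exI[of _ a]) auto
  next
    assume "\<exists>a<b. w a = Some i \<and> column w i a = Suc j"
    then obtain a where "a < b" "w a = Some i" "column w i a = Suc j" by blast
    then show "Suc j < row_count w i b" using row_count_eq_column[of w i a] row_count_mono[of a b w i] by simp
  qed
  ultimately show ?thesis using excess by auto
qed

lemma down_is_slide_path:
  assumes i: "Suc i < r" and b: "w b = Some (Suc i)" "column w (Suc i) b = j" "excess w i b = 0"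
    and j: "column w i (slide_path w i) \<le> j"
    and minimal: "\<And>b. w b = Some (Suc i) \<Longrightarrow> slide_path w i < b \<Longrightarrow> column w (Suc i) b < j \<Longrightarrow> excess w i b \<noteq> 0"
  shows "slide_path w (Suc i) = b" "column (stage w i) i b = j"
proof -
  let ?p = "slide_path w i" and ?q = "slide_path w (Suc i)"
  have i': "i < r" using i by simp
  have p: "w ?p = Some i" using slide_path_letter[OF w 1 i'] .
  have row_count: "row_count w i b = Suc j"
    using row_count_eq_column[of w "Suc i" b] b unfolding excess_def by simp
  then have column: "column w i b = Suc j" using row_count_eq_column[of w i b] b by simp
  then have less: "?p < b" using j column_mono[of b ?p w i] by (cases "?p < b") auto
  then have "?q \<le> b" unfolding slide_path.simps(2) using b by (intro Least_le) simp
  moreover have "\<not> ?q < b"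
  proof
    assume q: "?q < b"
    have "w ?q = Some (Suc i)" using slide_path_letter[OF w 1 i] .
    moreover have "column w (Suc i) ?q < j" using column_less[of w ?q "Suc i" b] calculation q b by simp
    ultimately show False using minimal[of ?q] slide_path_less[OF w 1 i] slide_path_zero[OF w 1 i] by simp
  qed
  ultimately show "?q = b" by simp
  have "column w i b = column (stage w i) i b + (if ?p < b then 1 else 0)"
  proof (rule column_remove)
    show "stage w i a = Some i \<longleftrightarrow> w a = Some i \<and> a \<noteq> ?p" for a
      using stage_row[OF w 1 i', of a i] by simp
  qed (use p in simp)
  then show "column (stage w i) i b = j" using column less by simp
qed

lemma slide_inv_slide:
  assumes inv: "slide_inv w r (row_count w 0 n) s" and can: "can_slide s"
  shows "slide_inv w r (row_count w 0 n) (slide s) \<and>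
    fst (snd (slide s)) + snd (snd (slide s)) = Suc (fst (snd s) + snd (snd s))"
proof -
  obtain S i j where s: "s = (S, (i, j))" by (cases s) auto
  have i: "i < r" and j: "j < row_count w 0 n" and S: "tableau_with_hole (stage w i) i j S"
    and p: "column w i (slide_path w i) \<le> j"
    and minimal: "Suc i < r \<Longrightarrow> w b = Some (Suc i) \<Longrightarrow> slide_path w i < b \<Longrightarrow>
      column w (Suc i) b < j \<Longrightarrow> excess w i b \<noteq> 0" for b
    using inv unfolding slide_inv_def s by auto
  note right_iff = hole_right(1)[OF S i p] and right = hole_right(2)[OF S i p]
    and below_iff = hole_below[OF S i]
  have go_right: ?thesis if a: "S (i, Suc j) = Some a" and source: "slide_source S (i, j) = (i, Suc j)"
    and above: "\<And>b. Suc i < r \<Longrightarrow> w b = Some (Suc i) \<Longrightarrow> column w (Suc i) b = j \<Longrightarrow> a < b" for a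
  proof -
    have sl: "slide s = (S((i, j) \<mapsto> a, (i, Suc j) := None), (i, Suc j))"
      unfolding slide_def s using source a by simp
    have wa: "w a = Some i" "column w i a = Suc j" using a right_iff by auto
    have "tableau_with_hole (stage w i) i (Suc j) (S((i, j) \<mapsto> a, (i, Suc j) := None))"
      using tableau_with_hole_right[OF S] right[OF a] by blast
    moreover have "Suc j < row_count w 0 n"
      using column_less_row_count[OF w wa(1)] wa row_count_row[OF w i] by simp
    moreover have "excess w i b \<noteq> 0" if i: "Suc i < r" and b: "w b = Some (Suc i)" "slide_path w i < b"
      "column w (Suc i) b < Suc j" for b
    proof (cases "column w (Suc i) b = j")
      case True
      then show ?thesis using below_height[OF i b(1) True] above[OF i b(1) True] wa by blast
    next
      case False
      then show ?thesis using minimal[OF i b(1,2)] b(3) by simp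
    qed
    ultimately show ?thesis using i p unfolding sl unfolding slide_inv_def s by auto
  qed
  have go_down: ?thesis if b: "S (Suc i, j) = Some b" and source: "slide_source S (i, j) = (Suc i, j)"
    and right_none: "\<And>a. S (i, Suc j) = Some a \<Longrightarrow> b \<le> a" for b
  proof -
    have sl: "slide s = (S((i, j) \<mapsto> b, (Suc i, j) := None), (Suc i, j))"
      unfolding slide_def s using source b by simp
    have wb: "w b = Some (Suc i)" "column w (Suc i) b = j" using b below_iff by auto
    have Si: "Suc i < r" using balanced_word_row[OF w wb(1)] .
    have "excess w i b = 0"
      using below_height[OF Si wb] right_none right_iff by (meson leD)
    note slide_path = down_is_slide_path[OF Si wb this p minimal[OF Si]]
    have stage_b: "stage w i b = Some (Suc i)"
      using stage_row[OF w 1 i, of b "Suc i"] wb by simp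
    have "column (stage w i) (Suc i) b = j"
      using tableau_with_holeD[OF S, of "Suc i" j b] b by simp
    then have "tableau_with_hole (stage w (Suc i)) (Suc i) j (S((i, j) \<mapsto> b, (Suc i, j) := None))"
      using tableau_with_hole_down[OF S stage_b] slide_path by simp
    moreover have "column w (Suc i) (slide_path w (Suc i)) \<le> j" using slide_path wb by simp
    moreover have "\<not> column w (Suc (Suc i)) b' < j"
      if i2: "Suc (Suc i) < r" and b': "w b' = Some (Suc (Suc i))" "slide_path w (Suc i) < b'" "excess w (Suc i) b' = 0" for b'
    proof -
      have "Suc (column w (Suc (Suc i)) b') = row_count w (Suc (Suc i)) b'"
        using row_count_eq_column[of w "Suc (Suc i)" b'] b' by simp
      also have "\<dots> = row_count w (Suc i) b'" using b' unfolding excess_def by simp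
      also have "\<dots> \<ge> Suc j"
        using row_count_mono[of b b' w "Suc i"] row_count_eq_column[of w "Suc i" b] wb slide_path b' by simp
      finally show ?thesis by simp
    qed
    ultimately show ?thesis using Si j unfolding sl unfolding slide_inv_def s by auto
  qed
  show ?thesis
  proof (cases "S (i, Suc j)")
    case None
    then obtain b where b: "S (Suc i, j) = Some b" using can unfolding can_slide_def s by auto
    show ?thesis by (rule go_down[OF b]) (use None b in \<open>auto simp: slide_source_def\<close>)
  next
    case (Some a)
    show ?thesis
    proof (cases "S (Suc i, j)")
      case None
      show ?thesis
      proof (rule go_right[OF Some])
        show "slide_source S (i, j) = (i, Suc j)" using None Some by (simp add: slide_source_def)
        show "a < b" if "w b = Some (Suc i)" "column w (Suc i) b = j" for b
          using below_iff[of b] that None by simp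
      qed
    next
      case (Some b)
      show ?thesis
      proof (cases "a < b")
        case True
        show ?thesis
        proof (rule go_right[OF \<open>S (i, Suc j) = Some a\<close>])
          show "slide_source S (i, j) = (i, Suc j)"
            using True Some \<open>S (i, Suc j) = Some a\<close> by (simp add: slide_source_def)
          show "a < b'" if "w b' = Some (Suc i)" "column w (Suc i) b' = j" for b'
            using below_iff[of b'] that Some True by simp
        qed
      next
        case False
        show ?thesis
          by (rule go_down[OF Some])
            (use False Some \<open>S (i, Suc j) = Some a\<close> in \<open>auto simp: slide_source_def\<close>)
      qed
    qed
  qed
qed

lemma slide_inv_end:
  assumes inv: "slide_inv w r (row_count w 0 n) (S, (i, j))" and cannot: "\<not> can_slide (S, (i, j))"
  shows "i = r - 1" "j = row_count w 0 n - 1" "tableau_with_hole (stage w i) i j S"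
proof -
  have i: "i < r" and j: "j < row_count w 0 n" and S: "tableau_with_hole (stage w i) i j S"
    and p: "column w i (slide_path w i) \<le> j"
    using inv unfolding slide_inv_def by auto
  have none: "S (i, Suc j) = None" "S (Suc i, j) = None"
    using cannot unfolding can_slide_def by auto
  have 0: "w 0 = None" using balanced_word_0[OF w] .
  have "\<not> Suc i < r"
  proof
    assume Si: "Suc i < r"
    then obtain b where "w b = Some (Suc i)" "column w (Suc i) b = j"
      using column_surj[of j w "Suc i" n] row_count_row[OF w Si] j 0 by auto
    then show False using hole_below[OF S i, of b] none by simp
  qed
  then show "i = r - 1" using i by simp
  have "\<not> Suc j < row_count w 0 n"
  proof
    assume "Suc j < row_count w 0 n"
    then obtain a where "w a = Some i" "column w i a = Suc j"
      using column_surj[of "Suc j" w i n] row_count_row[OF w i] 0 by auto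
    then show False using hole_right(1)[OF S i p, of a] none by simp
  qed
  then show "j = row_count w 0 n - 1" using j by simp
  show "tableau_with_hole (stage w i) i j S" using S .
qed

lemma slide_inv_start:
  shows "slide_inv w r (row_count w 0 n) ((tableau_of w)((0, 0) := None), (0, 0))"
proof -
  have r: "0 < r" using balanced_word_row[OF w first_letter[OF w 1]] .
  have w1: "w 1 = Some 0" using first_letter[OF w 1] .
  have column1: "column w 0 1 = 0" using column_Suc[of w 0 0] row_count_0[of w 0] balanced_word_0[OF w] by simp
  have row0: "(w(1 := None)) a = Some 0 \<longleftrightarrow> w a = Some 0 \<and> a \<noteq> 1" for a by simp
  have rem0: "column w 0 a = column (w(1 := None)) 0 a + (if 1 < a then 1 else 0)" for a
    by (rule column_remove[OF row0 w1])
  have rem: "column (w(1 := None)) i a = column w i a" if "i \<noteq> 0" for i a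
    by (rule column_cong) (use that w1 in auto)
  have "tableau_with_hole (w(1 := None)) 0 0 ((tableau_of w)((0, 0) := None))"
    unfolding tableau_with_hole_def
  proof (intro allI)
    fix i j a
    show "((tableau_of w)((0, 0) := None)) (i, j) = Some a \<longleftrightarrow>
      (w(1 := None)) a = Some i \<and> j = column (w(1 := None)) i a +
        (if i = 0 \<and> 0 \<le> column (w(1 := None)) i a then 1 else 0)"
    proof (cases "i = 0")
      case False
      then show ?thesis using rem[of i a] tableau_of_iff[of w i j a] w1 by auto
    next
      case True
      show ?thesis
      proof (cases "a = 1")
        case True
        have "((tableau_of w)((0, 0) := None)) (i, j) \<noteq> Some 1"
          using tableau_of_iff[of w i j 1] w1 column1 by auto
        then show ?thesis using True by simp
      next
        case False
        have S: "((tableau_of w)((0, 0) := None)) (0, j) = Some a \<longleftrightarrow> j \<noteq> 0 \<and> w a = Some 0 \<and> column w 0 a = j"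
          using tableau_of_iff[of w 0 j a] by simp
        show ?thesis
        proof (cases "w a = Some 0")
          case wa: True
          then have "1 < a" using False balanced_word_dom[OF w wa] by simp
          then have "column w 0 a = Suc (column (w(1 := None)) 0 a)" using rem0[of a] by simp
          then show ?thesis using S wa False \<open>i = 0\<close> by auto
        next
          case wa: False
          then show ?thesis using S False \<open>i = 0\<close> by simp
        qed
      qed
    qed
  qed
  moreover have "0 < row_count w 0 n"
    using row_count_eq_column[of w 0 1] w1 row_count_mono[of 1 n w 0] balanced_word_dom[OF w w1] by simp
  ultimately show ?thesis using r column1 unfolding slide_inv_def by simp
qed

lemma promote_start_stage: "0 < x \<Longrightarrow> x \<noteq> n \<Longrightarrow> promote_start n r w x = stage w (r - 1) (Suc x)"
proof -
  assume x: "0 < x" "x \<noteq> n"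
  have r: "0 < r" using balanced_word_row[OF w first_letter[OF w 1]] .
  have "promote_start n r w x = Some i \<longleftrightarrow> stage w (r - 1) (Suc x) = Some i" for i
  proof -
    have "i < r" if "w (Suc x) = Some i" using balanced_word_row[OF w that] .
    then show ?thesis
      using promote_start_iff[OF w 1 x, of i] stage_row[OF w 1, of "r - 1" "Suc x" i] r
      by (auto split: if_splits)
  qed
  then show ?thesis by (metis not_None_eq)
qed

lemma stage_bounds: "stage w (r - 1) x = Some i \<Longrightarrow> 2 \<le> x \<and> x \<le> n"
proof -
  assume x: "stage w (r - 1) x = Some i"
  have r: "0 < r" using balanced_word_row[OF w first_letter[OF w 1]] .
  consider "w x = Some i" "x \<noteq> slide_path w i" | "Suc i < r" "x = slide_path w (Suc i)"
    using stage_row[OF w 1, of "r - 1" x i] r x balanced_word_row[OF w, of x i]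
    by (auto split: if_splits)
  then show ?thesis
  proof cases
    case row: 1
    then have "x \<noteq> 1" using first_letter[OF w 1] by (intro notI) auto
    then show ?thesis using balanced_word_dom[OF w row(1)] by simp
  next
    case 2
    then show ?thesis using slide_path_bounds[OF w \<open>1 \<in> dom w\<close>, of "Suc i"] by simp
  qed
qed

text \<open>
  The invariant determines the final filling: the empty box ends in the bottom right corner, and
  nothing in the bottom row is displaced by it.
\<close>

lemma promote_with_tableau_of: "promote_with n (tableau_of w) = tableau_of (promote_start n r w)"
proof -
  let ?c = "row_count w 0 n" and ?s = "((tableau_of w)((0, 0) := None), (0, 0))"
  let ?m = "measure (\<lambda>(S, (i, j)). r + ?c - (i + j))"
  have r: "0 < r" using balanced_word_row[OF w first_letter[OF w 1]] .
  have n: "1 \<le> n" using slide_path_bounds[OF w 1 r] by simp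
  define v where "v = stage w (r - 1)"
  have row: "v a = Some (r - 1) \<longleftrightarrow> w a = Some (r - 1) \<and> a \<noteq> slide_path w (r - 1)" for a
    using stage_row[OF w 1, of "r - 1" a "r - 1"] r unfolding v_def by simp
  have p: "w (slide_path w (r - 1)) = Some (r - 1)" using slide_path_letter[OF w 1] r by simp
  have rem: "column w (r - 1) a = column v (r - 1) a + (if slide_path w (r - 1) < a then 1 else 0)" for a
    by (rule column_remove[OF row p])
  have bottom: "column v (r - 1) a < ?c - 1" if "v a = Some (r - 1)" for a
  proof -
    have a: "w a = Some (r - 1)" "a \<noteq> slide_path w (r - 1)" using that row by auto
    have "column w (r - 1) b < ?c" if "w b = Some (r - 1)" for b
      using column_less_row_count[OF w that] row_count_row[OF w, of "r - 1"] r by simp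
    from this[OF a(1)] this[OF p] show ?thesis
      using rem[of a] a column_less[of w a "r - 1" "slide_path w (r - 1)"]
      by (cases a "slide_path w (r - 1)" rule: linorder_cases) (auto simp: less_diff_conv)
  qed
  have v01: "v 0 = None" "v (Suc 0) = None"
    using stage_bounds[of 0] stage_bounds[of "Suc 0"] unfolding v_def
    by (cases "stage w (r - 1) 0"; cases "stage w (r - 1) (Suc 0)"; simp)+
  have promote_start_v: "promote_start n r w x = v (Suc x)" if "x < n" for x
    using promote_start_stage[of x] that promote_start_0[of n r w] v01 unfolding v_def by (cases "x = 0") auto
  have column_promote_start: "column (promote_start n r w) i a = column v i (Suc a)" if "a \<le> n" for i a
  proof -
    have "{b. b < Suc a \<and> v b = Some i} = Suc ` {b. b < a \<and> promote_start n r w b = Some i}"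
    proof (intro set_eqI iffI)
      fix b assume b: "b \<in> {b. b < Suc a \<and> v b = Some i}"
      then obtain b' where "b = Suc b'" using v01 by (cases b) auto
      then show "b \<in> Suc ` {b. b < a \<and> promote_start n r w b = Some i}"
        using b promote_start_v[of b'] that by auto
    next
      fix b assume "b \<in> Suc ` {b. b < a \<and> promote_start n r w b = Some i}"
      then obtain b' where b': "b = Suc b'" "b' < a" "promote_start n r w b' = Some i" by blast
      then show "b \<in> {b. b < Suc a \<and> v b = Some i}" using promote_start_v[of b'] that by auto
    qed
    then show ?thesis unfolding column_def by (simp add: card_image)
  qed
  have final: "(decrement S)((i, j) \<mapsto> n) = tableau_of (promote_start n r w)"
    if inv: "slide_inv w r ?c (S, (i, j))" and cannot: "\<not> can_slide (S, (i, j))" for S i j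
  proof (rule tableau_of_eqI)
    fix i' j' a
    note ij = slide_inv_end[OF inv cannot]
    have S: "tableau_with_hole v (r - 1) (?c - 1) S" using ij unfolding v_def by simp
    have S_iff: "S (i', j') = Some b \<longleftrightarrow> v b = Some i' \<and> column v i' b = j'" for b
      using tableau_with_holeD[OF S, of i' j' b] bottom[of b] by (cases "i' = r - 1") auto
    have c: "column v (r - 1) (Suc n) = ?c - 1"
    proof -
      have "slide_path w (r - 1) < Suc n" using slide_path_bounds[OF w 1, of "r - 1"] r by simp
      then show ?thesis
        using rem[of "Suc n"] column_Suc[of w "r - 1" n] row_count_row[OF w, of "r - 1"] r by simp
    qed
    have vn: "v (Suc n) = None" using stage_bounds[of "Suc n"] unfolding v_def
      by (cases "stage w (r - 1) (Suc n)") auto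
    show "((decrement S)((i, j) \<mapsto> n)) (i', j') = Some a \<longleftrightarrow>
        promote_start n r w a = Some i' \<and> column (promote_start n r w) i' a = j'"
    proof (cases "(i', j') = (i, j)")
      case True
      have "promote_start n r w a = Some i' \<and> column (promote_start n r w) i' a = j' \<longleftrightarrow> a = n"
      proof
        assume *: "promote_start n r w a = Some i' \<and> column (promote_start n r w) i' a = j'"
        show "a = n"
        proof (rule ccontr)
          assume "a \<noteq> n"
          have "a < n"
            using balanced_word_dom[OF balanced_promote_start[OF w 1 r], of a i'] * \<open>a \<noteq> n\<close> by simp
          then have "v (Suc a) = Some (r - 1)" "column v (r - 1) (Suc a) = ?c - 1"
            using * promote_start_v[of a] column_promote_start[of a i'] True ij by auto
          then show False using bottom[of "Suc a"] by simp
        qed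
      next
        assume "a = n"
        then show "promote_start n r w a = Some i' \<and> column (promote_start n r w) i' a = j'"
          using promote_start_n[of n r w] column_promote_start[of n i'] True ij c by simp
      qed
      then show ?thesis using True by auto
    next
      case False
      have "((decrement S)((i, j) \<mapsto> n)) (i', j') = Some a \<longleftrightarrow> (\<exists>b. S (i', j') = Some b \<and> b - 1 = a)"
        using False unfolding decrement_def by auto
      also have "\<dots> \<longleftrightarrow> (\<exists>b. v b = Some i' \<and> column v i' b = j' \<and> b - 1 = a)"
        unfolding S_iff by simp
      also have "\<dots> \<longleftrightarrow> v (Suc a) = Some i' \<and> column v i' (Suc a) = j'"
      proof
        assume "\<exists>b. v b = Some i' \<and> column v i' b = j' \<and> b - 1 = a"
        then obtain b where b: "v b = Some i'" "column v i' b = j'" "b - 1 = a" by blast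
        have "2 \<le> b" using stage_bounds[of b i'] b unfolding v_def by simp
        then have "b = Suc a" using b(3) by simp
        then show "v (Suc a) = Some i' \<and> column v i' (Suc a) = j'" using b by simp
      next
        assume "v (Suc a) = Some i' \<and> column v i' (Suc a) = j'"
        then show "\<exists>b. v b = Some i' \<and> column v i' b = j' \<and> b - 1 = a"
          by (intro exI[of _ "Suc a"]) simp
      qed
      also have "\<dots> \<longleftrightarrow> promote_start n r w a = Some i' \<and> column (promote_start n r w) i' a = j'"
      proof (cases "a < n")
        case True
        then show ?thesis using promote_start_v[of a] column_promote_start[of a i'] by simp
      next
        case a: False
        have "v (Suc a) \<noteq> Some i'" using stage_bounds[of "Suc a" i'] a unfolding v_def by auto
        moreover have "\<not> (promote_start n r w a = Some i' \<and> column (promote_start n r w) i' a = j')"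
        proof
          assume *: "promote_start n r w a = Some i' \<and> column (promote_start n r w) i' a = j'"
          then have "a = n" using balanced_word_dom[OF balanced_promote_start[OF w 1 r], of a i'] a by simp
          then show False using * False promote_start_n[of n r w] column_promote_start[of n i'] ij c by simp
        qed
        ultimately show ?thesis by blast
      qed
      finally show ?thesis .
    qed
  qed
  have "case while can_slide slide ?s of (S, h) \<Rightarrow> (decrement S)(h \<mapsto> n) = tableau_of (promote_start n r w)"
  proof (rule while_rule[where P = "slide_inv w r ?c" and r = ?m])
    show "slide_inv w r ?c ?s" by (rule slide_inv_start)
    show "slide_inv w r ?c (slide s)" if "slide_inv w r ?c s" "can_slide s" for s
      using slide_inv_slide[OF that] by blast
    show "case s of (S, h) \<Rightarrow> (decrement S)(h \<mapsto> n) = tableau_of (promote_start n r w)"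
      if "slide_inv w r ?c s" "\<not> can_slide s" for s
      using final that by (cases s) auto
    show "(slide s, s) \<in> ?m" if "slide_inv w r ?c s" "can_slide s" for s
    proof -
      obtain S i j S' i' j' where s: "s = (S, (i, j))" "slide s = (S', (i', j'))"
        by (metis prod.exhaust)
      then have "i < r" "j < ?c" "i' + j' = Suc (i + j)"
        using slide_inv_slide[OF that] that unfolding slide_inv_def by auto
      then show ?thesis using s by simp
    qed
  qed simp
  then show ?thesis unfolding promote_with_def Let_def by (auto split: prod.splits)
qed

end

lemma component_promotion_tableau_of:
  assumes w: "balanced_word n r w"
  shows "component_promotion n (tableau_of w) = tableau_of (promote n r w)"
  using promote_with_tableau_of[OF w] tableau_of_shift_word[of w] balanced_word_0[OF w]
  unfolding component_promotion_def promote_def ran_tableau_of by simp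

section \<open>Noncrossing decompositions\<close>

definition noncrossing :: "nat set set \<Rightarrow> bool" where
  "noncrossing P \<longleftrightarrow> (\<forall>B\<in>P. \<forall>B'\<in>P. \<forall>a b c d. a < b \<longrightarrow> b < c \<longrightarrow> c < d \<longrightarrow>
     a \<in> B \<longrightarrow> c \<in> B \<longrightarrow> b \<in> B' \<longrightarrow> d \<in> B' \<longrightarrow> B = B')"

text \<open>
  These partitions are what promotion respects; the components of the \<open>m\<close>-diagram
  give the finest one.
\<close>

definition decomposition :: "nat \<Rightarrow> nat \<Rightarrow> (nat \<rightharpoonup> nat) \<Rightarrow> nat set set \<Rightarrow> bool" where
  "decomposition n r w P \<longleftrightarrow> partition_on (dom w) P \<and> noncrossing P \<and>
     (\<forall>B\<in>P. balanced_word n r (w |` B))"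

lemma noncrossingD:
  "noncrossing P \<Longrightarrow> B \<in> P \<Longrightarrow> B' \<in> P \<Longrightarrow> a \<in> B \<Longrightarrow> c \<in> B \<Longrightarrow> b \<in> B' \<Longrightarrow> d \<in> B' \<Longrightarrow>
    a < b \<Longrightarrow> b < c \<Longrightarrow> c < d \<Longrightarrow> B = B'"
  unfolding noncrossing_def by blast

lemma block_unique: "disjoint P \<Longrightarrow> B \<in> P \<Longrightarrow> B' \<in> P \<Longrightarrow> x \<in> B \<Longrightarrow> x \<in> B' \<Longrightarrow> B = B'"
  unfolding disjoint_def by blast

lemma restrict_iff: "(w |` B) a = Some i \<longleftrightarrow> a \<in> B \<and> w a = Some i"
  unfolding restrict_map_def by simp

lemma excess_gap:
  assumes "x \<le> y" and gap: "\<And>z. x < z \<Longrightarrow> z \<le> y \<Longrightarrow> z \<notin> B"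
  shows "excess (w |` B) i x = excess (w |` B) i y"
proof -
  have "{a. a \<le> x \<and> (w |` B) a = Some k} = {a. a \<le> y \<and> (w |` B) a = Some k}" for k
    using assms restrict_iff[of w B] by (auto simp: not_le[symmetric])
  then show ?thesis unfolding excess_def row_count_def by simp
qed

locale decomposed =
  fixes n r :: nat and w :: "nat \<rightharpoonup> nat" and P :: "nat set set"
  assumes w: "balanced_word n r w" and dec: "decomposition n r w P"
begin

lemma blocks: "\<Union>P = dom w" "{} \<notin> P" "disjoint P" "noncrossing P"
  and block_balanced: "B \<in> P \<Longrightarrow> balanced_word n r (w |` B)"
  using dec unfolding decomposition_def partition_on_def by auto

lemma finite_P: "finite P"
proof -
  have "dom w \<subseteq> {1..n}" using w unfolding balanced_word_def by blast
  then have "finite (\<Union>P)" unfolding blocks(1) by (rule finite_subset) simp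
  then show ?thesis by (rule finite_UnionD)
qed

lemma block_dom: "B \<in> P \<Longrightarrow> B \<subseteq> dom w"
  using blocks(1) by blast

lemma block_bounds: "B \<in> P \<Longrightarrow> a \<in> B \<Longrightarrow> 1 \<le> a \<and> a \<le> n"
  using block_dom[of B] balanced_word_dom[OF w, of a] by blast

lemma excess_sum: "excess w i x = (\<Sum>B\<in>P. excess (w |` B) i x)"
proof -
  have "row_count w k x = (\<Sum>B\<in>P. row_count (w |` B) k x)" for k
  proof -
    have "{a. a \<le> x \<and> w a = Some k} = (\<Union>B\<in>P. {a. a \<le> x \<and> (w |` B) a = Some k})"
      using blocks(1) by (auto simp: restrict_iff)
    also have "card \<dots> = (\<Sum>B\<in>P. card {a. a \<le> x \<and> (w |` B) a = Some k})"
    proof (rule card_UN_disjoint[OF finite_P])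
      show "\<forall>B\<in>P. \<forall>B'\<in>P. B \<noteq> B' \<longrightarrow>
          {a. a \<le> x \<and> (w |` B) a = Some k} \<inter> {a. a \<le> x \<and> (w |` B') a = Some k} = {}"
        using block_unique[OF blocks(3)] by (auto simp: restrict_iff)
    qed simp
    finally show ?thesis unfolding row_count_def .
  qed
  then show ?thesis unfolding excess_def by (simp add: sum_subtractf)
qed

lemma excess_split: "B \<in> P \<Longrightarrow> excess w i x = excess (w |` B) i x + (\<Sum>B'\<in>P - {B}. excess (w |` B') i x)"
  unfolding excess_sum by (rule sum.remove[OF finite_P])

lemma excess_block_0: "B \<in> P \<Longrightarrow> (\<And>z. z \<in> B \<Longrightarrow> x < z) \<Longrightarrow> excess (w |` B) i x = 0"
  using excess_gap[of 0 x B w i] excess_0[OF block_balanced, of B i] by force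

lemma excess_block_end: "B \<in> P \<Longrightarrow> Suc i < r \<Longrightarrow> (\<And>z. z \<in> B \<Longrightarrow> z \<le> x) \<Longrightarrow> excess (w |` B) i x = 0"
  using excess_gap[of x "max x n" B w i] balanced_word_excess_end[OF block_balanced, of B i "max x n"]
  by force

text \<open>
  Between two elements of \<open>B\<close> another block lies completely or not at all, so its
  excess starts and returns to the same value there and is not smaller in between.
\<close>

lemma excess_other_block:
  assumes B: "B \<in> P" "a \<in> B" "b \<in> B" and B': "B' \<in> P" "B' \<noteq> B" and i: "Suc i < r"
    and x: "a \<le> x" "x \<le> b"
  shows "excess (w |` B') i a \<le> excess (w |` B') i x" "excess (w |` B') i b = excess (w |` B') i a"
proof -
  have ab: "a \<notin> B'" "b \<notin> B'" using B B' block_unique[OF blocks(3)] by blast+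
  have *: "excess (w |` B') i a \<le> excess (w |` B') i x \<and> excess (w |` B') i b = excess (w |` B') i a"
  proof (cases "\<exists>y\<in>B'. a < y \<and> y < b")
    case True
    then obtain y where y: "y \<in> B'" "a < y" "y < b" by blast
    have inside: "a < z \<and> z < b" if "z \<in> B'" for z
    proof -
      have "\<not> z < a" using noncrossingD[OF blocks(4) B'(1) B(1) that y(1) B(2,3)] y B'(2) by blast
      moreover have "\<not> b < z"
        using noncrossingD[OF blocks(4) B(1) B'(1) B(2,3) y(1) that] y B'(2) by blast
      moreover have "z \<noteq> a" "z \<noteq> b" using ab that by auto
      ultimately show ?thesis by simp
    qed
    have "excess (w |` B') i a = 0" using excess_block_0[OF B'(1), of a i] inside by simp
    moreover have "excess (w |` B') i b = 0"
      using excess_block_end[OF B'(1) i, of b] inside by (simp add: less_imp_le)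
    ultimately show ?thesis using balanced_word_excess[OF block_balanced[OF B'(1)] i, of x] by simp
  next
    case False
    then have gap: "z \<notin> B'" if "a < z" "z \<le> b" for z
      using that ab by (cases "z = b") auto
    show ?thesis using excess_gap[of a x B' w i] excess_gap[of a b B' w i] gap x by simp
  qed
  then show "excess (w |` B') i a \<le> excess (w |` B') i x" "excess (w |` B') i b = excess (w |` B') i a"
    by auto
qed

lemma arc_of_block:
  assumes B: "B \<in> P" and i: "Suc i < r" and arc: "arc (w |` B) i a b"
  shows "arc w i a b"
proof -
  have ab: "a \<in> B" "b \<in> B" "w a = Some i" "w b = Some (Suc i)" "a < b"
    using arcD[OF arc] by (auto simp: restrict_iff)
  have "excess w i b = excess w i a - 1"
  proof -
    have "(\<Sum>B'\<in>P - {B}. excess (w |` B') i b) = (\<Sum>B'\<in>P - {B}. excess (w |` B') i a)"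
      using excess_other_block(2)[OF B ab(1,2) _ _ i, of _ b] ab by (intro sum.cong) auto
    then show ?thesis using excess_split[OF B, of i] arcD[OF arc] by simp
  qed
  moreover have "excess w i a \<le> excess w i x" if x: "a \<le> x" "x < b" for x
  proof -
    have "(\<Sum>B'\<in>P - {B}. excess (w |` B') i a) \<le> (\<Sum>B'\<in>P - {B}. excess (w |` B') i x)"
      using excess_other_block(1)[OF B ab(1,2) _ _ i] x by (intro sum_mono) auto
    then show ?thesis using excess_split[OF B, of i] arc_above[OF arc x] by simp
  qed
  ultimately show ?thesis using ab unfolding arc_def by simp
qed

text \<open>
  The partner computed inside the block is the partner in the whole word, by uniqueness of
  closers.
\<close>

lemma arc_in_block:
  assumes B: "B \<in> P" and i: "Suc i < r" and arc: "arc w i a b"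
  shows "a \<in> B \<longleftrightarrow> b \<in> B"
proof -
  have fwd: "b \<in> B" if B: "B \<in> P" and a: "a \<in> B" for B
  proof -
    have "(w |` B) a = Some i" using arcD[OF arc] a by (simp add: restrict_iff)
    then obtain b' where b': "arc (w |` B) i a b'" using arc_from[OF block_balanced[OF B] i] by blast
    then have "b' = b" using arc_closer_unique[OF arc_of_block[OF B i b'] arc] by simp
    then show ?thesis using arcD[OF b'] by (simp add: restrict_iff)
  qed
  have "a \<in> dom w" using arcD[OF arc] by auto
  then obtain B' where B': "B' \<in> P" "a \<in> B'" using blocks(1) by blast
  then show ?thesis using fwd[OF B'] fwd[OF B] block_unique[OF blocks(3) B B'(1)] by blast
qed

text \<open>
  A block with elements on both sides of \<open>c\<close> would cross the block that contains 1
  and \<open>c\<close>.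
\<close>

lemma excess_first_block:
  assumes B: "B \<in> P" "1 \<in> B" and B': "B' \<in> P" "B' \<noteq> B" and i: "Suc i < r" and c: "c \<in> B"
  shows "excess (w |` B') i c = 0"
proof -
  have "c \<notin> B'" using block_unique[OF blocks(3)] B B' c by blast
  have no_straddle: False if "y \<in> B'" "z \<in> B'" "y < c" "c < z" for y z
  proof -
    have "1 \<notin> B'" using block_unique[OF blocks(3)] B B' by blast
    then have "1 < y" using block_bounds[OF B'(1) that(1)] that(1) by (cases "y = 1") auto
    then show False using noncrossingD[OF blocks(4) B(1) B'(1) B(2) c that(1,2)] that B'(2) by blast
  qed
  show ?thesis
  proof (cases "\<exists>y\<in>B'. y < c")
    case True
    then have "z \<le> c" if "z \<in> B'" for z using no_straddle[OF _ that] by (meson not_le)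
    then show ?thesis using excess_block_end[OF B'(1) i] by blast
  next
    case False
    then have "c < z" if "z \<in> B'" for z
      using that \<open>c \<notin> B'\<close> by (cases c z rule: linorder_cases) auto
    then show ?thesis using excess_block_0[OF B'(1)] by blast
  qed
qed

lemma excess_eq_first_block:
  assumes B: "B \<in> P" "1 \<in> B" and i: "Suc i < r" and c: "c \<in> B"
  shows "excess w i c = excess (w |` B) i c"
proof -
  have "(\<Sum>B'\<in>P - {B}. excess (w |` B') i c) = 0"
    using excess_first_block[OF B _ _ i c] by (intro sum.neutral) blast
  then show ?thesis using excess_split[OF B(1), of i c] by simp
qed

lemma excess_block_le: "B \<in> P \<Longrightarrow> Suc i < r \<Longrightarrow> excess (w |` B) i x \<le> excess w i x"
  using excess_split[of B i x] balanced_word_excess[OF block_balanced, of _ i x]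
    sum_nonneg[of "P - {B}" "\<lambda>B'. excess (w |` B') i x"] by simp

text \<open>
  At elements of \<open>B\<close> both excesses agree, and elsewhere the excess of
  \<open>B\<close> is at most that of the whole word; so the first zero of each is a zero of the
  other.
\<close>

lemma slide_path_block:
  assumes B: "B \<in> P" "1 \<in> B"
  shows "i < r \<Longrightarrow> slide_path (w |` B) i = slide_path w i"
proof (induction i)
  case (Suc i)
  let ?v = "w |` B"
  let ?p = "slide_path w (Suc i)" and ?q = "slide_path ?v (Suc i)"
  have v: "balanced_word n r ?v" using block_balanced[OF B(1)] .
  have 1: "1 \<in> dom w" "1 \<in> dom ?v" using B block_dom[OF B(1)] by (auto simp: dom_def)
  have IH: "slide_path ?v i = slide_path w i" using Suc by simp
  have "excess ?v i ?p = 0"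
    using excess_block_le[OF B(1) Suc.prems, of ?p] slide_path_zero[OF w 1(1) Suc.prems]
      balanced_word_excess[OF v Suc.prems, of ?p] by simp
  then have "?q \<le> ?p" unfolding slide_path.simps(2)[of ?v]
    using slide_path_less[OF w 1(1) Suc.prems] IH by (intro Least_le) simp
  moreover have "?q \<in> B" using slide_path_letter[OF v 1(2) Suc.prems] by (simp add: restrict_iff)
  then have "excess w i ?q = 0"
    using excess_eq_first_block[OF B Suc.prems] slide_path_zero[OF v 1(2) Suc.prems] by simp
  then have "?p \<le> ?q" unfolding slide_path.simps(2)[of w]
    using slide_path_less[OF v 1(2) Suc.prems] IH by (intro Least_le) simp
  ultimately show ?case by simp
qed simp

end

lemma rotate_image_iff:
  assumes "B \<subseteq> {1..n}"
  shows "x \<in> rotate_entry n ` B \<longleftrightarrow> x = n \<and> 1 \<in> B \<or> 1 \<le> x \<and> Suc x \<in> B"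
proof
  assume "x \<in> rotate_entry n ` B"
  then obtain y where y: "y \<in> B" "x = rotate_entry n y" by blast
  then show "x = n \<and> 1 \<in> B \<or> 1 \<le> x \<and> Suc x \<in> B"
    using assms unfolding rotate_entry_def by (cases "y = 1"; cases y) auto
next
  assume "x = n \<and> 1 \<in> B \<or> 1 \<le> x \<and> Suc x \<in> B"
  then show "x \<in> rotate_entry n ` B"
  proof
    assume "x = n \<and> 1 \<in> B"
    then show ?thesis by (intro image_eqI[of _ _ 1]) (auto simp: rotate_entry_def)
  next
    assume "1 \<le> x \<and> Suc x \<in> B"
    then show ?thesis by (intro image_eqI[of _ _ "Suc x"]) (auto simp: rotate_entry_def)
  qed
qed

lemma inj_on_rotate: "inj_on (rotate_entry n) {1..n}"
  unfolding inj_on_def rotate_entry_def by auto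

text \<open>
  Only the entry 1 changes its place in the order, from first to last; a crossing that involves it
  stays a crossing with the roles of the two blocks exchanged.
\<close>

lemma noncrossing_rotate:
  assumes P: "noncrossing P" and sub: "\<And>B. B \<in> P \<Longrightarrow> B \<subseteq> {1..n}"
  shows "noncrossing ((`) (rotate_entry n) ` P)"
  unfolding noncrossing_def
proof (intro ballI allI impI)
  fix D D' a b c d
  assume D: "D \<in> (`) (rotate_entry n) ` P" "D' \<in> (`) (rotate_entry n) ` P"
    and abcd: "a < b" "b < c" "c < d" and mem: "a \<in> D" "c \<in> D" "b \<in> D'" "d \<in> D'"
  obtain B B' where B: "B \<in> P" "D = rotate_entry n ` B" and B': "B' \<in> P" "D' = rotate_entry n ` B'"
    using D by blast
  note iff = rotate_image_iff[OF sub[OF B(1)]] and iff' = rotate_image_iff[OF sub[OF B'(1)]]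
  have dn: "d \<le> n" using mem(4) sub[OF B'(1)] unfolding B' iff' by auto
  have abc: "Suc a \<in> B" "Suc c \<in> B" "Suc b \<in> B'" "1 \<le> a"
    using mem abcd dn unfolding B B' iff iff' by auto
  have "B = B'"
  proof (cases "Suc d \<in> B'")
    case True
    then show ?thesis
      using noncrossingD[OF P B(1) B'(1) abc(1,2,3)] abcd by simp
  next
    case False
    then have "1 \<in> B'" using mem unfolding B' iff' by auto
    then show ?thesis using noncrossingD[OF P B'(1) B(1) _ abc(3,1,2)] abcd abc(4) by simp
  qed
  then show "D = D'" using B B' by simp
qed

text \<open>
  The path runs inside the block of 1, so that block is promoted as if it were alone and all
  others are merely shifted.
\<close>

lemma (in decomposed) promote_restrict:
  assumes full: "dom w = {1..n}" and r: "0 < r" and n: "1 \<le> n" and B: "B \<in> P"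
  shows "promote n r w |` (rotate_entry n ` B) = promote n r (w |` B)"
proof (rule ext)
  fix x
  have 1: "1 \<in> dom w" using full n by simp
  have v: "balanced_word n r (w |` B)" using block_balanced[OF B] .
  have sub: "B \<subseteq> {1..n}" using block_dom[OF B] full by simp
  note rot = rotate_image_iff[OF sub, of x]
  obtain B1 where B1: "B1 \<in> P" "1 \<in> B1" using 1 blocks(1) by blast
  have 11: "1 \<in> dom (w |` B1)" using B1 1 by (auto simp: dom_def)
  have slide_path_B1: "slide_path w k \<in> B1" if "k < r" for k
    using slide_path_block[OF B1 that] slide_path_letter[OF block_balanced[OF B1(1)] 11 that]
    by (simp add: restrict_iff)
  have w_promote: "promote n r w = promote_start n r w" using 1 unfolding promote_def by simp
  show "(promote n r w |` (rotate_entry n ` B)) x = promote n r (w |` B) x"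
  proof (cases "1 \<in> B")
    case True
    then have oneB: "1 \<in> dom (w |` B)" using 1 by (auto simp: dom_def)
    have "B = B1" using block_unique[OF blocks(3) B B1(1) True B1(2)] .
    have image: "slide_path (w |` B) ` {1..<r} = slide_path w ` {1..<r}"
      using slide_path_block[OF B True] by (intro image_cong) auto
    have v_promote: "promote n r (w |` B) = promote_start n r (w |` B)" using oneB unfolding promote_def by simp
    consider "x = n" | "x = 0" "x \<noteq> n" | "0 < x" "x \<noteq> n" "Suc x \<in> B" | "0 < x" "x \<noteq> n" "Suc x \<notin> B"
      by auto
    then show ?thesis
    proof cases
      case 1
      then show ?thesis using rot True unfolding w_promote v_promote by (simp add: promote_start_n)
    next
      case 2
      then show ?thesis unfolding w_promote v_promote by (simp add: promote_start_0 restrict_map_def)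
    next
      case 3
      then show ?thesis using rot unfolding w_promote v_promote
        by (simp add: promote_start_def image[unfolded One_nat_def])
    next
      case 4
      then have "Suc x \<notin> slide_path w ` {1..<r}" using slide_path_B1 \<open>B = B1\<close> by auto
      then show ?thesis using 4 rot unfolding w_promote v_promote
        by (simp add: promote_start_def image[unfolded One_nat_def])
    qed
  next
    case False
    then have v_promote: "promote n r (w |` B) = shift_word (w |` B)"
      unfolding promote_def by (auto simp: restrict_map_def)
    have "B1 \<noteq> B" using False B1 by blast
    show ?thesis
    proof (cases "Suc x \<in> B \<and> x \<noteq> 0")
      case True
      then have "Suc x \<notin> slide_path w ` {1..<r}"
        using slide_path_B1 block_unique[OF blocks(3) B B1(1)] \<open>B1 \<noteq> B\<close> by fastforce
      moreover have "x \<noteq> n" using True sub by auto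
      ultimately show ?thesis using True rot unfolding w_promote v_promote
        by (simp add: promote_start_def shift_word_def restrict_map_def)
    next
      case F: False
      then have "x \<notin> rotate_entry n ` B" using rot False by auto
      then show ?thesis using F unfolding v_promote by (auto simp: shift_word_def restrict_map_def)
    qed
  qed
qed

lemma dom_promote:
  assumes w: "balanced_word n r w" and full: "dom w = {1..n}" and r: "0 < r" and n: "1 \<le> n"
  shows "dom (promote n r w) = {1..n}"
proof -
  have 1: "1 \<in> dom w" using full n by simp
  have "x \<in> dom (promote_start n r w) \<longleftrightarrow> x \<in> {1..n}" for x
    using dom_promote_start[OF w 1 r, of x] full n by auto
  then have "dom (promote_start n r w) = {1..n}" by (rule set_eqI)
  then show ?thesis using 1 unfolding promote_def by simp
qed

lemma (in decomposed) decomposition_promote: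
  assumes full: "dom w = {1..n}" and r: "0 < r" and n: "1 \<le> n"
  shows "decomposition n r (promote n r w) ((`) (rotate_entry n) ` P)"
  unfolding decomposition_def partition_on_def
proof (intro conjI ballI)
  have sub: "B \<subseteq> {1..n}" if "B \<in> P" for B using block_dom[OF that] full by simp
  have "rotate_entry n ` {1..n} = {1..n}"
  proof (rule set_eqI)
    fix x show "x \<in> rotate_entry n ` {1..n} \<longleftrightarrow> x \<in> {1..n}"
      unfolding rotate_image_iff[OF subset_refl] using n by auto
  qed
  then show "\<Union> ((`) (rotate_entry n) ` P) = dom (promote n r w)"
    using blocks(1) full dom_promote[OF w full r n] by (metis image_Union)
  show "{} \<notin> (`) (rotate_entry n) ` P" using blocks(2) by auto
  show "noncrossing ((`) (rotate_entry n) ` P)" using noncrossing_rotate[OF blocks(4) sub] .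
  show "disjoint ((`) (rotate_entry n) ` P)"
    unfolding disjoint_def
  proof (intro ballI impI)
    fix D D' assume D: "D \<in> (`) (rotate_entry n) ` P" "D' \<in> (`) (rotate_entry n) ` P" "D \<noteq> D'"
    then obtain B B' where B: "B \<in> P" "D = rotate_entry n ` B" "B' \<in> P" "D' = rotate_entry n ` B'"
      by blast
    then have "B \<inter> B' = {}" using D blocks(3) unfolding disjoint_def by blast
    then show "D \<inter> D' = {}"
      using inj_on_image_Int[OF inj_on_rotate sub[OF B(1)] sub[OF B(3)]] B by auto
  qed
  fix D assume "D \<in> (`) (rotate_entry n) ` P"
  then obtain B where B: "B \<in> P" "D = rotate_entry n ` B" by blast
  then show "balanced_word n r (promote n r w |` D)"
    using promote_restrict[OF full r n B(1)] balanced_promote[OF block_balanced[OF B(1)] r] by simp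
qed

section \<open>Components of arc diagrams\<close>

text \<open>
  Sub-diagrams are the nonempty proper sets of arcs closed under this symmetric relation;
  components are the minimal ones among them.
\<close>

definition touch :: "arc \<Rightarrow> arc \<Rightarrow> bool" where
  "touch c e \<longleftrightarrow> fst c = fst e \<or> fst c = snd e \<or> snd c = fst e \<or> snd c = snd e \<or> crosses e c"

lemma touch_sym: "touch c e \<longleftrightarrow> touch e c"
  unfolding touch_def crosses_def by (auto split: prod.splits)

lemma sub_diagram_iff:
  "sub_diagram M C \<longleftrightarrow> C \<noteq> {} \<and> C \<subset> M \<and> (\<forall>c\<in>C. \<forall>e\<in>M. touch c e \<longrightarrow> e \<in> C)"
proof -
  have "(\<forall>a\<in>endpoints C. \<forall>e\<in>M. a = fst e \<or> a = snd e \<longrightarrow> e \<in> C) \<longleftrightarrow>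
    (\<forall>c\<in>C. \<forall>e\<in>M. fst c = fst e \<or> fst c = snd e \<or> snd c = fst e \<or> snd c = snd e \<longrightarrow> e \<in> C)"
    unfolding endpoints_def by auto
  then show ?thesis unfolding sub_diagram_def touch_def by blast
qed

lemma sub_diagramD: "sub_diagram M C \<Longrightarrow> c \<in> C \<Longrightarrow> e \<in> M \<Longrightarrow> touch c e \<Longrightarrow> e \<in> C"
  unfolding sub_diagram_iff by blast

lemma sub_diagram_Diff:
  assumes C: "sub_diagram M C" and D: "sub_diagram M D" and "D \<subset> C"
  shows "sub_diagram M (C - D)"
  unfolding sub_diagram_iff
proof (intro conjI ballI impI)
  fix c e assume *: "c \<in> C - D" "e \<in> M" "touch c e"
  have "e \<in> C" using sub_diagramD[OF C] * by blast
  moreover have "e \<notin> D" using sub_diagramD[OF D, of e c] * C touch_sym[of c e]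
    unfolding sub_diagram_iff by blast
  ultimately show "e \<in> C - D" by blast
qed (use assms in \<open>auto simp: sub_diagram_iff\<close>)

lemma sub_diagram_compl:
  assumes C: "sub_diagram M C"
  shows "sub_diagram M (M - C)"
  unfolding sub_diagram_iff
proof (intro conjI ballI impI)
  fix c e assume *: "c \<in> M - C" "e \<in> M" "touch c e"
  then show "e \<in> M - C" using sub_diagramD[OF C, of e c] touch_sym[of c e] by blast
qed (use assms in \<open>auto simp: sub_diagram_iff\<close>)

lemma component_sub: "C \<in> diagram_components M \<Longrightarrow> sub_diagram M C"
  unfolding diagram_components_def by blast

lemma component_minimal:
  assumes C: "C \<in> diagram_components M" and X: "X \<subseteq> C" "X \<noteq> {}"
    and closed: "\<And>c e. c \<in> X \<Longrightarrow> e \<in> C \<Longrightarrow> touch c e \<Longrightarrow> e \<in> X"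
  shows "X = C"
proof (rule ccontr)
  assume "X \<noteq> C"
  have sub: "sub_diagram M C" using component_sub[OF C] .
  have "sub_diagram M X"
    unfolding sub_diagram_iff
  proof (intro conjI ballI impI)
    fix c e assume *: "c \<in> X" "e \<in> M" "touch c e"
    then have "e \<in> C" using sub_diagramD[OF sub, of c e] X by blast
    then show "e \<in> X" using closed * by blast
  qed (use X sub in \<open>auto simp: sub_diagram_iff\<close>)
  then show False using C X \<open>X \<noteq> C\<close> unfolding diagram_components_def by blast
qed

text \<open>
  A sub-diagram or its complement contains the arc \<open>e\<close>; a smallest sub-diagram
  containing \<open>e\<close> is minimal, since removing a sub-diagram that avoids
  \<open>e\<close> would make it smaller.
\<close>

lemma component_exists:
  assumes "finite M" and sub: "sub_diagram M C" and e: "e \<in> M"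
  shows "\<exists>D\<in>diagram_components M. e \<in> D"
proof -
  have "\<exists>D. sub_diagram M D \<and> e \<in> D"
    using sub sub_diagram_compl[OF sub] e by blast
  then obtain D where D: "sub_diagram M D \<and> e \<in> D"
    and least: "\<And>X. sub_diagram M X \<and> e \<in> X \<Longrightarrow> card D \<le> card X"
    using ex_has_least_nat[of "\<lambda>D. sub_diagram M D \<and> e \<in> D" _ card] by blast
  have fin: "finite D" using D \<open>finite M\<close> finite_subset unfolding sub_diagram_iff by blast
  have "\<not> sub_diagram M X" if X: "X \<subset> D" for X
  proof
    assume subX: "sub_diagram M X"
    show False
    proof (cases "e \<in> X")
      case True
      then show False using least[of X] subX psubset_card_mono[OF fin X] by simp
    next
      case False
      then have "card D \<le> card (D - X)"
        using least[of "D - X"] sub_diagram_Diff[of M D X] subX X D by blast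
      moreover have "D - X \<subset> D" using subX X unfolding sub_diagram_iff by blast
      ultimately show False using psubset_card_mono[OF fin, of "D - X"] by simp
    qed
  qed
  then show ?thesis using D unfolding diagram_components_def by blast
qed

lemma component_overlap:
  assumes C: "C \<in> diagram_components M" and C': "C' \<in> diagram_components M"
    and c: "c \<in> C" "c' \<in> C'" "touch c c'"
  shows "C = C'"
proof -
  have sub: "sub_diagram M C" "sub_diagram M C'" using component_sub C C' by auto
  have CM: "C \<subseteq> M" "C' \<subseteq> M" using sub unfolding sub_diagram_iff by blast+
  then have "c \<in> M" using c by blast
  then have "c \<in> C'" using sub_diagramD[OF sub(2) c(2), of c] c(3) touch_sym[of c c'] by blast
  then have ne: "C \<inter> C' \<noteq> {}" using c by blast
  have "C \<inter> C' = C"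
  proof (rule component_minimal[OF C _ ne])
    fix c e assume "c \<in> C \<inter> C'" "e \<in> C" "touch c e"
    then show "e \<in> C \<inter> C'" using sub_diagramD[OF sub(2), of c e] CM by blast
  qed blast
  moreover have "C \<inter> C' = C'"
  proof (rule component_minimal[OF C' _ ne])
    fix c e assume "c \<in> C \<inter> C'" "e \<in> C'" "touch c e"
    then show "e \<in> C \<inter> C'" using sub_diagramD[OF sub(1), of c e] CM by blast
  qed blast
  ultimately show ?thesis by blast
qed

lemma endpointsE:
  assumes "v \<in> endpoints C"
  obtains c where "c \<in> C" "v = fst c \<or> v = snd c"
  using assms unfolding endpoints_def by auto

lemma endpointsI: "c \<in> C \<Longrightarrow> fst c \<in> endpoints C \<and> snd c \<in> endpoints C"
  unfolding endpoints_def by auto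

lemma component_endpoints_disjoint:
  assumes C: "C \<in> diagram_components M" and C': "C' \<in> diagram_components M"
    and v: "v \<in> endpoints C" "v \<in> endpoints C'"
  shows "C = C'"
proof -
  obtain c c' where "c \<in> C" "v = fst c \<or> v = snd c" "c' \<in> C'" "v = fst c' \<or> v = snd c'"
    using v by (meson endpointsE)
  then show ?thesis using component_overlap[OF C C', of c c'] unfolding touch_def by auto
qed

text \<open>
  The arcs of \<open>C\<close> under a chord that none of them crosses are closed under touching,
  so by minimality they are none or all.
\<close>

lemma component_one_side:
  assumes C: "C \<in> diagram_components M" and less: "\<And>c. c \<in> M \<Longrightarrow> fst c < snd c"
    and xy: "x \<notin> endpoints C" "y \<notin> endpoints C" "x < y"
    and uncrossed: "\<And>c. c \<in> C \<Longrightarrow> \<not> crosses (x, y) c"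
    and uv: "u \<in> endpoints C" "v \<in> endpoints C" "x < u" "u < y"
  shows "x < v \<and> v < y"
proof -
  have "C \<subseteq> M" using component_sub[OF C] unfolding sub_diagram_iff by blast
  let ?in = "\<lambda>z. x < z \<and> z < y"
  have same: "?in (fst c) \<longleftrightarrow> ?in (snd c)" if c: "c \<in> C" for c
  proof -
    have "fst c < snd c" using c \<open>C \<subseteq> M\<close> less by blast
    moreover have "fst c \<noteq> x" "fst c \<noteq> y" "snd c \<noteq> x" "snd c \<noteq> y"
      using endpointsI[OF c] xy by auto
    ultimately show ?thesis using uncrossed[OF c] xy(3)
      unfolding crosses_def by (auto simp: case_prod_beta)
  qed
  let ?X = "{c \<in> C. ?in (fst c)}"
  have "?X = C"
  proof (rule component_minimal[OF C])
    obtain c where c: "c \<in> C" "u = fst c \<or> u = snd c" using uv(1) by (rule endpointsE)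
    then have "c \<in> ?X" using same[OF c(1)] uv(3,4) by auto
    then show "?X \<noteq> {}" by blast
    show "e \<in> ?X" if "c \<in> ?X" "e \<in> C" "touch c e" for c e
      using that same[of c] same[of e] unfolding touch_def crosses_def by (auto simp: case_prod_beta)
  qed auto
  moreover obtain c where c: "c \<in> C" "v = fst c \<or> v = snd c" using uv(2) by (rule endpointsE)
  ultimately have "?in (fst c)" by blast
  then show ?thesis using same[OF c(1)] c(2) by auto
qed

text \<open>
  No arc of \<open>C\<close> crosses an arc of \<open>C'\<close>, so \<open>C\<close> lies on one
  side of each arc of \<open>C'\<close>. Hence no arc of \<open>C'\<close> crosses the chord from
  \<open>a\<close> to \<open>c\<close>, and \<open>C'\<close> lies on one side of this chord,
  which its endpoints \<open>b\<close> and \<open>d\<close> contradict.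
\<close>

lemma components_noncrossing:
  assumes less: "\<And>c. c \<in> M \<Longrightarrow> fst c < snd c"
  shows "noncrossing (endpoints ` diagram_components M)"
  unfolding noncrossing_def
proof (intro ballI allI impI, rule ccontr)
  fix B B' a b c d
  assume B: "B \<in> endpoints ` diagram_components M" "B' \<in> endpoints ` diagram_components M"
    and abcd: "a < b" "b < c" "c < d" and mem: "a \<in> B" "c \<in> B" "b \<in> B'" "d \<in> B'" and ne: "B \<noteq> B'"
  obtain C C' where C: "C \<in> diagram_components M" "B = endpoints C"
    and C': "C' \<in> diagram_components M" "B' = endpoints C'" using B by blast
  have disj: "v \<notin> endpoints C'" if "v \<in> endpoints C" for v
    using component_endpoints_disjoint[OF C(1) C'(1) that] ne C C' by blast
  have uncrossed: "\<not> crosses (a, c) e" if e: "e \<in> C'" for e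
  proof -
    have e_less: "fst e < snd e"
      using e component_sub[OF C'(1)] less unfolding sub_diagram_iff by blast
    have "\<not> crosses (fst e, snd e) f" if "f \<in> C" for f
      using component_overlap[OF C(1) C'(1) that e] ne C C' unfolding touch_def by auto
    moreover have "fst e \<notin> endpoints C" "snd e \<notin> endpoints C"
      using endpointsI[OF e] disj by blast+
    ultimately have side: "fst e < v \<and> v < snd e"
      if "u \<in> endpoints C" "v \<in> endpoints C" "fst e < u" "u < snd e" for u v
      using component_one_side[OF C(1) less, of "fst e" "snd e" u v] e_less that by blast
    show ?thesis
      using side[of a c] side[of c a] mem C abcd unfolding crosses_def by (auto simp: case_prod_beta)
  qed
  have "a < d \<and> d < c"
    using component_one_side[OF C'(1) less _ _ _ uncrossed, of b d] disj mem C C' abcd by auto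
  then show False using abcd by simp
qed

lemma finite_arcs: "balanced_word n r w \<Longrightarrow> finite (arcs r w)"
proof -
  assume w: "balanced_word n r w"
  have "finite (dom w)" using w unfolding balanced_word_def by (auto intro: finite_subset)
  moreover have "arcs r w \<subseteq> dom w \<times> dom w"
    using arcs_dom[of _ _ r w] by (auto simp del: domIff)
  ultimately show ?thesis by (meson finite_SigmaI finite_subset)
qed

text \<open>
  A set of arcs closed under sharing endpoints matches the openers and closers among its endpoints
  perfectly, each opener before its closer.
\<close>

lemma closed_balanced:
  assumes w: "balanced_word n r w" and X: "X \<subseteq> arcs r w"
    and closed: "\<And>c e. c \<in> X \<Longrightarrow> e \<in> arcs r w \<Longrightarrow> touch c e \<Longrightarrow> e \<in> X"
  shows "balanced_word n r (w |` endpoints X)"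
proof -
  let ?v = "w |` endpoints X"
  have arc_end: "a \<in> endpoints X \<longleftrightarrow> b \<in> endpoints X" if ab: "arc w i a b" and i: "Suc i < r" for i a b
  proof -
    have M: "(a, b) \<in> arcs r w" using ab i unfolding arcs_def by blast
    have "(a, b) \<in> X" if "a \<in> endpoints X \<or> b \<in> endpoints X"
    proof -
      obtain c where "c \<in> X" "touch c (a, b)"
        using \<open>a \<in> endpoints X \<or> b \<in> endpoints X\<close> unfolding touch_def by (auto elim!: endpointsE)
      then show ?thesis using closed M by blast
    qed
    then show ?thesis using endpointsI[of "(a, b)" X, unfolded fst_conv snd_conv] by blast
  qed
  have le: "row_count ?v (Suc i) x \<le> row_count ?v i x" if i: "Suc i < r" for i x
  proof -
    let ?A = "{a. a \<le> x \<and> ?v a = Some i}" and ?B = "{b. b \<le> x \<and> ?v b = Some (Suc i)}"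
    have "\<forall>b\<in>?B. \<exists>a. arc w i a b" 
      using arc_to[OF w i] by (simp add: restrict_iff)
    then obtain f where f: "\<forall>b\<in>?B. arc w i (f b) b" by (rule bchoice[THEN exE])
    have "inj_on f ?B"
    proof (rule inj_onI)
      fix b b' assume "b \<in> ?B" "b' \<in> ?B" "f b = f b'"
      then have "arc w i (f b) b" "arc w i (f b) b'" using f by auto
      then show "b = b'" by (rule arc_closer_unique)
    qed
    moreover have "f ` ?B \<subseteq> ?A"
    proof
      fix a assume "a \<in> f ` ?B"
      then obtain b where b: "b \<in> ?B" "arc w i a b" using f by blast
      then have "a \<in> endpoints X" using arc_end[OF b(2) i] by (simp add: restrict_iff)
      then show "a \<in> ?A" using arcD[OF b(2)] b(1) by (simp add: restrict_iff)
    qed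
    ultimately show ?thesis unfolding row_count_def by (intro card_inj_on_le) auto
  qed
  have ge: "row_count ?v i n \<le> row_count ?v (Suc i) n" if i: "Suc i < r" for i
  proof -
    let ?A = "{a. a \<le> n \<and> ?v a = Some i}" and ?B = "{b. b \<le> n \<and> ?v b = Some (Suc i)}"
    have "\<forall>a\<in>?A. \<exists>b. arc w i a b" 
      using arc_from[OF w i] by (simp add: restrict_iff)
    then obtain f where f: "\<forall>a\<in>?A. arc w i a (f a)" by (rule bchoice[THEN exE])
    have "inj_on f ?A"
    proof (rule inj_onI)
      fix a a' assume "a \<in> ?A" "a' \<in> ?A" "f a = f a'"
      then have "arc w i a (f a)" "arc w i a' (f a)" using f by auto
      then show "a = a'" by (rule arc_opener_unique)
    qed
    moreover have "f ` ?A \<subseteq> ?B"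
    proof
      fix b assume "b \<in> f ` ?A"
      then obtain a where a: "a \<in> ?A" "arc w i a b" using f by blast
      then have "b \<in> endpoints X" using arc_end[OF a(2) i] by (simp add: restrict_iff)
      moreover have "w b = Some (Suc i)" using arcD[OF a(2)] by simp
      ultimately show "b \<in> ?B" using balanced_word_dom[OF w, of b "Suc i"] by (simp add: restrict_iff)
    qed
    ultimately show ?thesis unfolding row_count_def by (intro card_inj_on_le) auto
  qed
  have "dom ?v \<subseteq> dom w" "ran ?v \<subseteq> ran w"
    by (auto simp: restrict_map_def ran_def split: if_splits)
  then show ?thesis
    using w le[of _ n] le ge unfolding balanced_word_def excess_def by (auto intro: le_antisym)
qed

text \<open>
  Arcs stay inside blocks, and arcs of different blocks cannot touch.
\<close>

lemma sub_diagram_block: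
  assumes w: "balanced_word n r w" and r: "2 \<le> r" and dec: "decomposition n r w P"
    and B: "B \<in> P" "B \<noteq> dom w"
  shows "sub_diagram (arcs r w) {c \<in> arcs r w. fst c \<in> B}"
proof -
  interpret decomposed n r w P by unfold_locales (fact w dec)+
  let ?X = "{c \<in> arcs r w. fst c \<in> B}"
  have end_B: "fst c \<in> D \<longleftrightarrow> snd c \<in> D" if "c \<in> arcs r w" "D \<in> P" for c D
    using that arc_in_block unfolding arcs_def by auto
  have has_arc: "\<exists>c\<in>arcs r w. fst c \<in> D" if D: "D \<in> P" for D
  proof -
    obtain x where x: "x \<in> D" using blocks(2) D by (metis ex_in_conv)
    then have "x \<in> endpoints (arcs r w)" using endpoints_arcs[OF w r] block_dom[OF D] by blast
    then obtain c where "c \<in> arcs r w" "x = fst c \<or> x = snd c" by (rule endpointsE)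
    then show ?thesis using end_B[of c D] D x by blast
  qed
  show ?thesis
    unfolding sub_diagram_iff
  proof (intro conjI ballI impI)
    show "?X \<noteq> {}" using has_arc[OF B(1)] by blast
    have "\<exists>B'\<in>P. B' \<noteq> B" using B block_dom[OF B(1)] blocks(1) by blast
    then obtain B' where B': "B' \<in> P" "B' \<noteq> B" by blast
    then obtain c where "c \<in> arcs r w" "fst c \<in> B'" using has_arc by blast
    then have "c \<notin> ?X" using block_unique[OF blocks(3) B(1) B'(1)] B'(2) by blast
    then show "?X \<subset> arcs r w" using \<open>c \<in> arcs r w\<close> by blast
  next
    fix c e assume *: "c \<in> ?X" "e \<in> arcs r w" "touch c e"
    have c: "fst c \<in> B" "snd c \<in> B" using * end_B[of c B] B by auto
    obtain D where D: "D \<in> P" "fst e \<in> D"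
      using arcs_dom[of "fst e" "snd e" r w] * blocks(1) by auto
    then have e: "snd e \<in> D" using end_B[of e D] * by blast
    have "D = B"
    proof (cases "crosses e c")
      case False
      then consider "fst e \<in> B" | "snd e \<in> B" using *(3) c unfolding touch_def by auto
      then show ?thesis using D e block_unique[OF blocks(3) D(1) B(1)] by cases blast+
    next
      case True
      then show ?thesis using noncrossingD[OF blocks(4) D(1) B(1) D(2) e c]
          noncrossingD[OF blocks(4) B(1) D(1) c D(2) e] unfolding crosses_def by (auto simp: case_prod_beta)
    qed
    then show "e \<in> ?X" using D * by blast
  qed
qed

text \<open>
  The arcs of a component inside one block are closed under touching, so they are the whole
  component.
\<close>

lemma component_in_block:
  assumes w: "balanced_word n r w" and r: "2 \<le> r" and dec: "decomposition n r w P"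
    and C: "C \<in> diagram_components (arcs r w)"
  shows "\<exists>B\<in>P. endpoints C \<subseteq> B"
proof -
  interpret decomposed n r w P by unfold_locales (fact w dec)+
  have sub: "sub_diagram (arcs r w) C" using component_sub[OF C] .
  then obtain c where c: "c \<in> C" "c \<in> arcs r w" unfolding sub_diagram_iff by blast
  obtain B where B: "B \<in> P" "fst c \<in> B"
    using arcs_dom[of "fst c" "snd c" r w] c blocks(1) by auto
  have CM: "C \<subseteq> arcs r w" using sub unfolding sub_diagram_iff by blast
  show ?thesis
  proof (cases "B = dom w")
    case True
    have "endpoints C \<subseteq> endpoints (arcs r w)" using CM unfolding endpoints_def by blast
    then show ?thesis using True B endpoints_arcs[OF w r] by blast
  next
    case False
    let ?X = "{c \<in> arcs r w. fst c \<in> B}"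
    have X: "sub_diagram (arcs r w) ?X" using sub_diagram_block[OF w r dec B(1) False] .
    have "C \<inter> ?X = C"
      by (rule component_minimal[OF C]) (use sub_diagramD[OF X] CM c B in auto)
    then have "fst e \<in> B \<and> snd e \<in> B" if "e \<in> C" for e
    proof -
      have e: "e \<in> arcs r w" "fst e \<in> B" using that \<open>C \<inter> ?X = C\<close> by blast+
      then obtain i where "Suc i < r" "arc w i (fst e) (snd e)" unfolding arcs_def by auto
      then show ?thesis using arc_in_block[OF B(1)] e by blast
    qed
    then have "endpoints C \<subseteq> B" unfolding endpoints_def by auto
    then show ?thesis using B by blast
  qed
qed

lemma components_decomposition:
  assumes w: "balanced_word n r w" and r: "2 \<le> r" and sub: "sub_diagram (arcs r w) C0"
  shows "decomposition n r w (endpoints ` diagram_components (arcs r w))"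
  unfolding decomposition_def
proof (intro conjI ballI)
  let ?K = "diagram_components (arcs r w)"
  have CM: "C \<subseteq> arcs r w" "C \<noteq> {}" if "C \<in> ?K" for C
    using component_sub[OF that] unfolding sub_diagram_iff by blast+
  show "partition_on (dom w) (endpoints ` ?K)"
    unfolding partition_on_def
  proof (intro conjI)
    have "v \<in> \<Union> (endpoints ` ?K)" if v: "v \<in> endpoints (arcs r w)" for v
    proof -
      obtain e where e: "e \<in> arcs r w" "v = fst e \<or> v = snd e" using v by (rule endpointsE)
      then obtain C where "C \<in> ?K" "e \<in> C"
        using component_exists[OF finite_arcs[OF w] sub] by blast
      then show ?thesis using e endpointsI[of e C] by auto
    qed
    moreover have "endpoints C \<subseteq> endpoints (arcs r w)" if "C \<in> ?K" for C
      using CM(1)[OF that] unfolding endpoints_def by blast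
    ultimately show "\<Union> (endpoints ` ?K) = dom w" unfolding endpoints_arcs[OF w r, symmetric] by blast
    show "disjoint (endpoints ` ?K)"
      unfolding disjoint_def using component_endpoints_disjoint by fast
    show "{} \<notin> endpoints ` ?K" using CM(2) unfolding endpoints_def by auto
  qed
  show "noncrossing (endpoints ` ?K)"
    by (rule components_noncrossing) (use arcs_less in auto)
  fix B assume "B \<in> endpoints ` ?K"
  then obtain C where C: "C \<in> ?K" "B = endpoints C" by blast
  then show "balanced_word n r (w |` B)"
    using closed_balanced[OF w CM(1)[OF C(1)]] sub_diagramD[OF component_sub[OF C(1)]] by blast
qed

text \<open>
  Sending a block to the block around it is surjective, hence injective when the numbers of blocks
  agree; then every coarse block contains a single fine one and equals it.
\<close>

lemma refinement_eq:
  assumes P: "partition_on A P" and Q: "partition_on A Q" and "finite A"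
    and refine: "\<And>B. B \<in> P \<Longrightarrow> \<exists>B'\<in>Q. B \<subseteq> B'" and card: "card P \<le> card Q"
  shows "P = Q"
proof -
  have finP: "finite P" using finite_UnionD P \<open>finite A\<close> unfolding partition_on_def by blast
  have "\<forall>B\<in>P. \<exists>B'. B' \<in> Q \<and> B \<subseteq> B'" using refine by blast
  then obtain f where f: "\<forall>B\<in>P. f B \<in> Q \<and> B \<subseteq> f B" by (rule bchoice[THEN exE])
  have meet: "f B = B'" if "B \<in> P" "B' \<in> Q" "x \<in> B" "x \<in> B'" for B B' x
    using f that Q unfolding partition_on_def disjoint_def by blast
  have cover: "\<exists>B\<in>P. x \<in> B \<and> f B = B'" if "B' \<in> Q" "x \<in> B'" for x B'
  proof -
    have "x \<in> \<Union>P" using that P Q unfolding partition_on_def by auto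
    then show ?thesis using meet that by blast
  qed
  have "Q \<subseteq> f ` P"
  proof
    fix B' assume B': "B' \<in> Q"
    then obtain x where "x \<in> B'" using Q unfolding partition_on_def by (metis ex_in_conv)
    then show "B' \<in> f ` P" using cover[OF B'] by blast
  qed
  then have surj: "f ` P = Q" using f by blast
  then have "inj_on f P" using card card_image_le[OF finP, of f] by (intro eq_card_imp_inj_on finP) simp
  have "f B = B" if B: "B \<in> P" for B
  proof
    show "B \<subseteq> f B" using f B by blast
    show "f B \<subseteq> B"
    proof
      fix x assume "x \<in> f B"
      then obtain B2 where "B2 \<in> P" "x \<in> B2" "f B2 = f B" using cover f B by blast
      then show "x \<in> B" using \<open>inj_on f P\<close> B unfolding inj_on_def by blast
    qed
  qed
  then show ?thesis using surj by force
qed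

section \<open>Words of tableaux\<close>

definition word_of :: "tableau \<Rightarrow> (nat \<rightharpoonup> nat)" where
  "word_of S = (\<lambda>a. if \<exists>x. S x = Some a then Some (fst (SOME x. S x = Some a)) else None)"

text \<open>
  What left-justification needs in order to depend only on the word: it says nothing about the
  shape, so that it also covers the boxes of a component.
\<close>

definition row_increasing :: "tableau \<Rightarrow> bool" where
  "row_increasing S \<longleftrightarrow> finite (dom S) \<and> inj_on S (dom S) \<and>
     (\<forall>i j j' a b. S (i, j) = Some a \<and> S (i, j') = Some b \<and> j < j' \<longrightarrow> a < b)"

lemma row_increasing_inj: "row_increasing S \<Longrightarrow> S x = Some a \<Longrightarrow> S y = Some a \<Longrightarrow> x = y"
  unfolding row_increasing_def inj_on_def by (metis domI)

lemma row_increasing_submap: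
  assumes "row_increasing T" and "S \<subseteq>\<^sub>m T"
  shows "row_increasing S"
proof -
  have S: "T x = Some a" if "S x = Some a" for x a
    using assms(2) that unfolding map_le_def by (metis domI)
  have "finite (dom S)"
    using finite_subset[OF map_le_implies_dom_le[OF assms(2)]] assms(1)
    unfolding row_increasing_def by simp
  moreover have "inj_on S (dom S)"
  proof (rule inj_onI)
    fix x y assume "x \<in> dom S" "y \<in> dom S" "S x = S y"
    then obtain a where "S x = Some a" "S y = Some a" by auto
    then show "x = y" using row_increasing_inj[OF assms(1) S S] by blast
  qed
  moreover have "a < b" if "S (i, j) = Some a" "S (i, j') = Some b" "j < j'" for i j j' a b
    using assms(1) S[OF that(1)] S[OF that(2)] that(3) unfolding row_increasing_def by blast
  ultimately show ?thesis unfolding row_increasing_def by blast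
qed

lemma word_of_iff:
  assumes "row_increasing S"
  shows "word_of S a = Some i \<longleftrightarrow> (\<exists>j. S (i, j) = Some a)"
proof (cases "\<exists>x. S x = Some a")
  case True
  then obtain x where x: "S x = Some a" by blast
  then have "(SOME x. S x = Some a) = x"
    using row_increasing_inj[OF assms] by (intro some_equality) auto
  then have "word_of S a = Some (fst x)" using True unfolding word_of_def by simp
  moreover have "(\<exists>j. S (i, j) = Some a) \<longleftrightarrow> fst x = i"
    using x row_increasing_inj[OF assms, of x a] by (metis fst_conv prod.collapse)
  ultimately show ?thesis by simp
next
  case False
  then show ?thesis unfolding word_of_def by auto
qed

lemma dom_word_of: "row_increasing S \<Longrightarrow> dom (word_of S) = ran S"
  unfolding dom_def ran_def word_of_def by auto

lemma nth_sorted_list_of_set: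
  fixes A :: "nat set"
  assumes "finite A" "j < card A"
  shows "sorted_list_of_set A ! j \<in> A" "card {x \<in> A. x < sorted_list_of_set A ! j} = j"
proof -
  let ?xs = "sorted_list_of_set A"
  have len: "length ?xs = card A" by simp
  show "?xs ! j \<in> A" using assms len nth_mem[of j ?xs] by simp
  have sorted: "sorted_wrt (<) ?xs" by (rule strict_sorted_list_of_set)
  have "{x \<in> A. x < ?xs ! j} = (!) ?xs ` {..<j}"
  proof (intro set_eqI iffI)
    fix x assume x: "x \<in> {x \<in> A. x < ?xs ! j}"
    then have "x \<in> set ?xs" using assms by simp
    then obtain k where k: "k < length ?xs" "?xs ! k = x" by (auto simp: in_set_conv_nth)
    have "k < j"
    proof (rule ccontr)
      assume "\<not> k < j"
      then have "?xs ! j \<le> ?xs ! k"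
        using sorted_wrt_nth_less[OF sorted, of j k] k by (cases "k = j") auto
      then show False using x k by simp
    qed
    then show "x \<in> (!) ?xs ` {..<j}" using k by blast
  next
    fix x assume "x \<in> (!) ?xs ` {..<j}"
    then obtain k where "k < j" "x = ?xs ! k" by blast
    then show "x \<in> {x \<in> A. x < ?xs ! j}"
      using sorted_wrt_nth_less[OF sorted, of k j] assms len nth_mem[of k ?xs] by simp
  qed
  moreover have "inj_on ((!) ?xs) {..<j}"
    using assms len by (intro inj_on_nth) auto
  ultimately show "card {x \<in> A. x < ?xs ! j} = j" by (simp add: card_image)
qed

lemma finite_row_columns: "finite (dom S) \<Longrightarrow> finite (row_columns S i)"
proof -
  assume "finite (dom S)"
  moreover have "row_columns S i \<subseteq> snd ` dom S" unfolding row_columns_def by force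
  ultimately show ?thesis by (meson finite_imageI finite_subset)
qed

lemma left_justify_tableau_of:
  assumes S: "row_increasing S"
  shows "left_justify S = tableau_of (word_of S)"
proof (rule tableau_of_eqI)
  fix i j a
  let ?A = "row_columns S i"
  have fin: "finite ?A" using S finite_row_columns unfolding row_increasing_def by blast
  have incr: "b < a \<longleftrightarrow> k' < k" if "S (i, k) = Some a" "S (i, k') = Some b" for k k' a b
    using S that unfolding row_increasing_def
    by (metis less_asym linorder_neqE_nat option.inject order_less_irrefl)
  have column: "column (word_of S) i a = card {k' \<in> ?A. k' < k}" if k: "S (i, k) = Some a" for k a
  proof -
    have "{b. b < a \<and> word_of S b = Some i} = (\<lambda>k. the (S (i, k))) ` {k' \<in> ?A. k' < k}"
    proof (intro set_eqI iffI)
      fix b assume "b \<in> {b. b < a \<and> word_of S b = Some i}"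
      then obtain k' where "b < a" "S (i, k') = Some b" using word_of_iff[OF S] by auto
      then show "b \<in> (\<lambda>k. the (S (i, k))) ` {k' \<in> ?A. k' < k}"
        using incr[OF k] unfolding row_columns_def by (intro image_eqI[of _ _ k']) auto
    next
      fix b assume "b \<in> (\<lambda>k. the (S (i, k))) ` {k' \<in> ?A. k' < k}"
      then obtain k' where "S (i, k') = Some b" "k' < k" unfolding row_columns_def by auto
      then show "b \<in> {b. b < a \<and> word_of S b = Some i}"
        using incr[OF k] word_of_iff[OF S, of b i] by auto
    qed
    moreover have "inj_on (\<lambda>k. the (S (i, k))) {k' \<in> ?A. k' < k}"
    proof (rule inj_onI)
      fix x y assume "x \<in> {k' \<in> ?A. k' < k}" "y \<in> {k' \<in> ?A. k' < k}" "the (S (i, x)) = the (S (i, y))"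
      then obtain b where "S (i, x) = Some b" "S (i, y) = Some b" unfolding row_columns_def by auto
      then show "x = y" using row_increasing_inj[OF S, of "(i, x)" b "(i, y)"] by simp
    qed
    ultimately show ?thesis unfolding column_def by (simp add: card_image)
  qed
  show "left_justify S (i, j) = Some a \<longleftrightarrow> word_of S a = Some i \<and> column (word_of S) i a = j"
  proof
    assume "left_justify S (i, j) = Some a"
    then have "j < card ?A" and a: "S (i, sorted_list_of_set ?A ! j) = Some a"
      unfolding left_justify_def by (auto split: if_splits)
    then have "column (word_of S) i a = j" using column[OF a] nth_sorted_list_of_set(2)[OF fin] by simp
    then show "word_of S a = Some i \<and> column (word_of S) i a = j" using word_of_iff[OF S] a by blast
  next
    assume *: "word_of S a = Some i \<and> column (word_of S) i a = j"
    then obtain k where k: "S (i, k) = Some a" using word_of_iff[OF S] by blast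
    then have "k \<in> set (sorted_list_of_set ?A)" using fin unfolding row_columns_def by auto
    then obtain j' where j': "j' < card ?A" "sorted_list_of_set ?A ! j' = k"
      using length_sorted_list_of_set[of ?A] unfolding in_set_conv_nth by auto
    then have "j' = j" using nth_sorted_list_of_set(2)[OF fin j'(1)] column[OF k] * by simp
    then show "left_justify S (i, j) = Some a" using j' k unfolding left_justify_def by simp
  qed
qed

lemma syt_row_increasing: "syt U \<Longrightarrow> row_increasing U"
proof -
  assume U: "syt U"
  then obtain p where p: "dom U = young_diagram p" unfolding syt_def by blast
  have "young_diagram p \<subseteq> (\<Union>i<length p. {i} \<times> {..<p ! i})"
    unfolding young_diagram_def by auto
  then have "finite (dom U)" unfolding p by (rule finite_subset) auto
  then show ?thesis using U unfolding syt_def row_increasing_def increasing_def by blast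
qed

lemma left_justify_syt:
  assumes U: "syt U"
  shows "left_justify U = U"
proof
  fix x :: "nat \<times> nat"
  obtain p where p: "dom U = young_diagram p" using U unfolding syt_def by blast
  obtain i j where x: "x = (i, j)" by (cases x)
  define m where "m = (if i < length p then p ! i else 0)"
  have cols: "row_columns U i = {0..<m}"
    unfolding row_columns_def p young_diagram_def m_def by auto
  have "U (i, j) = None" if "\<not> j < m"
    using that p unfolding young_diagram_def m_def by (auto split: if_splits simp: domIff[symmetric])
  then show "left_justify U x = U x" unfolding left_justify_def x by (simp add: cols)
qed

text \<open>
  If \<open>x\<close> had more entries of row \<open>i + 1\<close> than of row \<open>i\<close> up
  to it, then the first column not yet reached in row \<open>i\<close> would have its entry of row
  \<open>i\<close> after \<open>x\<close> but its entry of row \<open>i + 1\<close> before; equal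
  row lengths ensure that this column exists in row \<open>i\<close>.
\<close>

lemma balanced_word_of:
  assumes S: "row_increasing S" and ran: "ran S \<subseteq> {1..n}" and rows: "tableau_rows S = {..<r}"
    and rect: "rectangular S"
    and columns: "\<And>i j a b. left_justify S (i, j) = Some a \<Longrightarrow> left_justify S (Suc i, j) = Some b \<Longrightarrow> a < b"
  shows "balanced_word n r (word_of S)"
proof -
  let ?v = "word_of S"
  have dom: "dom ?v \<subseteq> {1..n}" using dom_word_of[OF S] ran by simp
  have "0 \<notin> dom ?v" using dom by auto
  then have v0: "?v 0 = None" by (simp only: domIff not_not)
  have upto: "a \<le> n" if "?v a = Some i" for a i
    using subsetD[OF dom domI[of ?v a i, OF that]] by simp
  have count: "row_count ?v i n = card (row_columns S i)" for i
  proof -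
    have "{a. a \<le> n \<and> ?v a = Some i} = (\<lambda>j. the (S (i, j))) ` row_columns S i"
    proof (intro set_eqI iffI)
      fix a assume "a \<in> {a. a \<le> n \<and> ?v a = Some i}"
      then obtain j where "S (i, j) = Some a" using word_of_iff[OF S] by auto
      then show "a \<in> (\<lambda>j. the (S (i, j))) ` row_columns S i"
        unfolding row_columns_def by (intro image_eqI[of _ _ j]) auto
    next
      fix a assume "a \<in> (\<lambda>j. the (S (i, j))) ` row_columns S i"
      then obtain j where "S (i, j) = Some a" unfolding row_columns_def by auto
      then have "?v a = Some i" using word_of_iff[OF S] by blast
      then show "a \<in> {a. a \<le> n \<and> ?v a = Some i}" using upto by simp
    qed
    moreover have "inj_on (\<lambda>j. the (S (i, j))) (row_columns S i)"
    proof (rule inj_onI)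
      fix x y assume "x \<in> row_columns S i" "y \<in> row_columns S i" "the (S (i, x)) = the (S (i, y))"
      then obtain b where "S (i, x) = Some b" "S (i, y) = Some b" unfolding row_columns_def by auto
      then show "x = y" using row_increasing_inj[OF S, of "(i, x)" b "(i, y)"] by simp
    qed
    ultimately show ?thesis unfolding row_count_def by (simp add: card_image)
  qed
  have equal: "row_count ?v (Suc i) n = row_count ?v i n" if "Suc i < r" for i
  proof -
    have "Suc i \<in> tableau_rows S" "i \<in> tableau_rows S" using rows that by auto
    then show ?thesis using rect unfolding count rectangular_def by blast
  qed
  have lattice: "row_count ?v (Suc i) x \<le> row_count ?v i x" if i: "Suc i < r" for i x
  proof (rule ccontr)
    assume "\<not> row_count ?v (Suc i) x \<le> row_count ?v i x"
    then have k: "row_count ?v i x < row_count ?v (Suc i) x" by simp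
    then obtain b where b: "b \<le> x" "?v b = Some (Suc i)" "column ?v (Suc i) b = row_count ?v i x"
      using column_surj[of _ ?v] v0 by blast
    have "row_count ?v (Suc i) x \<le> row_count ?v (Suc i) n"
      unfolding row_count_def using upto by (intro card_mono) auto
    then have "row_count ?v i x < row_count ?v i n" using equal[OF i] k by simp
    then obtain a where a: "?v a = Some i" "column ?v i a = row_count ?v i x"
      using column_surj[of _ ?v i n] v0 by blast
    have "a < b"
      using columns[of i "row_count ?v i x" a b] a b unfolding left_justify_tableau_of[OF S] tableau_of_iff by simp
    then show False using row_count_eq_column[of ?v i a] a row_count_mono[of a x ?v i] b by simp
  qed
  have "ran ?v \<subseteq> {..<r}"
  proof
    fix i assume "i \<in> ran ?v"
    then obtain a where "?v a = Some i" unfolding ran_def by blast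
    then obtain j where "S (i, j) = Some a" using word_of_iff[OF S] by blast
    then have "i \<in> tableau_rows S" unfolding tableau_rows_def by force
    then show "i \<in> {..<r}" using rows by simp
  qed
  then show ?thesis using dom lattice equal unfolding balanced_word_def excess_def by auto
qed

lemma word_of_submap:
  assumes T: "row_increasing T" and S: "S \<subseteq>\<^sub>m T"
  shows "word_of S = word_of T |` ran S"
proof
  fix a
  have S': "row_increasing S" using row_increasing_submap[OF T S] .
  have sub: "T x = Some a" if "S x = Some a" for x a
    using S that unfolding map_le_def by (metis domI)
  have "word_of S a = Some i \<longleftrightarrow> (word_of T |` ran S) a = Some i" for i
  proof -
    have "(\<exists>j. S (i, j) = Some a) \<longleftrightarrow> a \<in> ran S \<and> (\<exists>j. T (i, j) = Some a)"
    proof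
      assume "\<exists>j. S (i, j) = Some a"
      then show "a \<in> ran S \<and> (\<exists>j. T (i, j) = Some a)" using sub unfolding ran_def by blast
    next
      assume *: "a \<in> ran S \<and> (\<exists>j. T (i, j) = Some a)"
      then obtain x j where "S x = Some a" "T (i, j) = Some a" unfolding ran_def by blast
      then show "\<exists>j. S (i, j) = Some a" using row_increasing_inj[OF T sub] by metis
    qed
    then show ?thesis unfolding restrict_iff word_of_iff[OF S'] word_of_iff[OF T] .
  qed
  then show "word_of S a = (word_of T |` ran S) a" by (metis not_None_eq)
qed

lemma component_tableau_tableau_of:
  assumes T: "row_increasing T"
  shows "component_tableau T C = tableau_of (word_of T |` endpoints C)"
proof -
  let ?S = "T |` {x. \<exists>v\<in>endpoints C. T x = Some v}"
  have sub: "?S \<subseteq>\<^sub>m T" unfolding map_le_def by (auto simp: restrict_map_def split: if_splits)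
  have "ran ?S = endpoints C \<inter> ran T"
    unfolding ran_def restrict_map_def by auto
  then have "word_of ?S = word_of T |` (endpoints C \<inter> dom (word_of T))"
    using word_of_submap[OF T sub] dom_word_of[OF T] by simp
  also have "\<dots> = word_of T |` endpoints C"
    by (auto simp: restrict_map_def domIff)
  finally show ?thesis
    using left_justify_tableau_of[OF row_increasing_submap[OF T sub]] unfolding component_tableau_def by simp
qed

lemma row_entries_sorted:
  assumes T: "row_increasing T"
  shows "sorted_wrt (<) (row_entries T i)" "set (row_entries T i) = {a. word_of T a = Some i}"
proof -
  have fin: "finite (row_columns T i)" using T finite_row_columns unfolding row_increasing_def by blast
  have "the (T (i, x)) < the (T (i, y))" if "x \<in> row_columns T i" "y \<in> row_columns T i" "x < y" for x y
    using T that unfolding row_increasing_def row_columns_def by fastforce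
  then show "sorted_wrt (<) (row_entries T i)"
    unfolding row_entries_def sorted_wrt_map
    using sorted_wrt_mono_rel[OF _ strict_sorted_list_of_set[of "row_columns T i"]] fin by simp
  show "set (row_entries T i) = {a. word_of T a = Some i}"
    unfolding row_entries_def using fin word_of_iff[OF T] unfolding row_columns_def by force
qed

lemma m_diagram_arcs:
  assumes T: "row_increasing T" and w: "balanced_word n r (word_of T)" and r: "card (tableau_rows T) = r"
  shows "m_diagram T = arcs r (word_of T)"
proof -
  have "matching T i = {(a, b). arc (word_of T) i a b}" if i: "Suc i < r" for i
  proof -
    have "matching T i = {(a, b). arc (word_of T) i a b \<and> b \<in> set (row_entries T (Suc i))}"
      unfolding matching_def row_entries_sorted(2)[OF T, of i]
      by (rule greedy_matching_prefix[OF w i])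
        (use row_entries_sorted[OF T, of "Suc i"] in auto)
    then show ?thesis using arcD unfolding row_entries_sorted(2)[OF T] by blast
  qed
  moreover have "i < r - 1 \<longleftrightarrow> Suc i < r" for i by auto
  ultimately show ?thesis unfolding m_diagram_def arcs_def r by auto
qed

text \<open>
  Standardization is strictly monotone on the entries of the standard tableau, so its column
  conditions pull back.
\<close>

lemma equivalent_syt_columns:
  assumes U: "syt U" and eq: "equivalent S U"
    and a: "left_justify S (i, j) = Some a" and b: "left_justify S (Suc i, j) = Some b"
  shows "a < b"
proof -
  let ?L = "left_justify S"
  have std: "standardize ?L = standardize U"
    using eq left_justify_syt[OF U] unfolding equivalent_def by simp
  obtain a' where a': "U (i, j) = Some a'" "card {u \<in> ran ?L. u \<le> a} = card {u \<in> ran U. u \<le> a'}"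
    using fun_cong[OF std, of "(i, j)"] a unfolding standardize_def by (cases "U (i, j)") auto
  obtain b' where b': "U (Suc i, j) = Some b'" "card {u \<in> ran ?L. u \<le> b} = card {u \<in> ran U. u \<le> b'}"
    using fun_cong[OF std, of "(Suc i, j)"] b unfolding standardize_def by (cases "U (Suc i, j)") auto
  have "a' < b'" using U a' b' unfolding syt_def increasing_def by blast
  moreover have "b' \<in> {u \<in> ran U. u \<le> b'}" using ranI[of U, OF b'(1)] by simp
  moreover have "b' \<notin> {u \<in> ran U. u \<le> a'}" using \<open>a' < b'\<close> by simp
  ultimately have "{u \<in> ran U. u \<le> a'} \<subset> {u \<in> ran U. u \<le> b'}" by fastforce
  then have "card {u \<in> ran U. u \<le> a'} < card {u \<in> ran U. u \<le> b'}"
    by (intro psubset_card_mono) auto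
  then have less: "card {u \<in> ran ?L. u \<le> a} < card {u \<in> ran ?L. u \<le> b}" using a' b' by simp
  show ?thesis
  proof (rule ccontr)
    assume "\<not> a < b"
    then have "card {u \<in> ran ?L. u \<le> b} \<le> card {u \<in> ran ?L. u \<le> a}"
      by (intro card_mono) auto
    then show False using less by simp
  qed
qed

text \<open>
  Before and after the interval its excess is zero, so there the complement has the excess of the
  whole word; inside the interval the excess of the complement is constant.
\<close>

lemma interval_decomposition:
  assumes w: "balanced_word n r w" and J: "J \<subseteq> dom w" "J \<noteq> {}" "J \<noteq> dom w"
    and interval: "\<And>x y z. x \<in> J \<Longrightarrow> z \<in> J \<Longrightarrow> x < y \<Longrightarrow> y < z \<Longrightarrow> y \<in> J"
    and v: "balanced_word n r (w |` J)"
  shows "decomposition n r w {J, dom w - J}"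
proof -
  let ?K = "dom w - J"
  have excess: "excess w i x = excess (w |` J) i x + excess (w |` ?K) i x" for i x
  proof -
    have "row_count w k x = row_count (w |` J) k x + row_count (w |` ?K) k x" for k
    proof -
      have "{a. a \<le> x \<and> w a = Some k} = {a. a \<le> x \<and> (w |` J) a = Some k} \<union> {a. a \<le> x \<and> (w |` ?K) a = Some k}"
        unfolding restrict_iff by auto
      moreover have "{a. a \<le> x \<and> (w |` J) a = Some k} \<inter> {a. a \<le> x \<and> (w |` ?K) a = Some k} = {}"
        unfolding restrict_iff by auto
      ultimately show ?thesis unfolding row_count_def by (simp add: card_Un_disjoint)
    qed
    then show ?thesis unfolding excess_def by simp
  qed
  have nonneg: "0 \<le> excess (w |` ?K) i x" if i: "Suc i < r" for i x
  proof (cases "\<exists>y\<in>J. y \<le> x")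
    case False
    then have "excess (w |` J) i x = 0"
      using excess_gap[of 0 x J w i] excess_0[OF v, of i] by force
    then show ?thesis using excess[of i x] balanced_word_excess[OF w i, of x] by simp
  next
    case True
    show ?thesis
    proof (cases "\<exists>z\<in>J. x < z")
      case False
      then have "excess (w |` J) i x = excess (w |` J) i (max x n)"
        by (intro excess_gap) auto
      then show ?thesis using balanced_word_excess_end[OF v i, of "max x n"] excess[of i x]
          balanced_word_excess[OF w i, of x] by simp
    next
      case after: True
      define m where "m = (LEAST y. y \<in> J)"
      obtain y where y: "y \<in> J" "y \<le> x" using True by blast
      have m: "m \<in> J" "m \<le> y" unfolding m_def using y by (auto intro: LeastI Least_le)
      have below: "z \<notin> J" if "z < m" for z using that not_less_Least unfolding m_def by blast
      obtain m' where m': "m = Suc m'" using m J(1) balanced_word_0[OF w] by (cases m) auto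
      obtain z where z: "z \<in> J" "x < z" using after by blast
      have mem: "u \<in> J" if "m \<le> u" "u \<le> x" for u
        using interval[OF m(1) z(1), of u] that z m by (cases "u = m") auto
      have "excess (w |` ?K) i m' = excess (w |` ?K) i x"
        using mem m' m y by (intro excess_gap) auto
      moreover have "excess (w |` J) i m' = 0"
        using excess_gap[of 0 m' J w i] excess_0[OF v, of i] below m' by force
      ultimately show ?thesis using excess[of i m'] balanced_word_excess[OF w i, of m'] by simp
    qed
  qed
  have "dom (w |` ?K) \<subseteq> dom w" "ran (w |` ?K) \<subseteq> ran w"
    by (auto simp: restrict_map_def ran_def split: if_splits)
  then have "balanced_word n r (w |` ?K)"
    using nonneg w v excess[of _ n] unfolding balanced_word_def by auto
  moreover have "noncrossing {J, ?K}"
    unfolding noncrossing_def using interval by blast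
  moreover have "partition_on (dom w) {J, ?K}"
    unfolding partition_on_def disjoint_def using J by auto
  ultimately show ?thesis using v unfolding decomposition_def by auto
qed

section \<open>Orbits\<close>

lemma injective_returns:
  assumes "finite X" and inj: "inj_on F X" and into: "F ` X \<subseteq> X" and w: "w \<in> X"
  shows "\<exists>m\<ge>1. (F ^^ m) w = w"
    and "(F ^^ a) w = (F ^^ b) w \<Longrightarrow> a < b \<Longrightarrow> (F ^^ (b - a)) w = w"
proof -
  have mem: "(F ^^ m) w \<in> X" for m using w into by (induction m) auto
  have cancel: "(F ^^ a) w = (F ^^ (a + k)) w \<Longrightarrow> (F ^^ k) w = w" for a k
  proof (induction a)
    case (Suc a)
    then have "F ((F ^^ a) w) = F ((F ^^ (a + k)) w)" by simp
    then have "(F ^^ a) w = (F ^^ (a + k)) w" using inj mem unfolding inj_on_def by blast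
    then show ?case using Suc.IH by blast
  qed simp
  show "(F ^^ a) w = (F ^^ b) w \<Longrightarrow> a < b \<Longrightarrow> (F ^^ (b - a)) w = w"
    using cancel[of a "b - a"] by simp
  have "\<not> inj (\<lambda>m. (F ^^ m) w)"
  proof
    assume "inj (\<lambda>m. (F ^^ m) w)"
    moreover have "range (\<lambda>m. (F ^^ m) w) \<subseteq> X" using mem by blast
    ultimately show False using \<open>finite X\<close> finite_subset finite_imageD infinite_UNIV_nat by metis
  qed
  then obtain a b where "(F ^^ a) w = (F ^^ b) w" "a \<noteq> b" unfolding inj_def by blast
  then obtain a b where ab: "(F ^^ a) w = (F ^^ b) w" "a < b" by (metis linorder_neqE_nat)
  then show "\<exists>m\<ge>1. (F ^^ m) w = w" using cancel[of a "b - a"] by (intro exI[of _ "b - a"]) simp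
qed

lemma card_orbit:
  assumes X: "finite X" "inj_on F X" "F ` X \<subseteq> X" "w \<in> X"
  shows "card {(F ^^ m) w | m. True} = (LEAST m. 1 \<le> m \<and> (F ^^ m) w = w)"
proof -
  let ?d = "LEAST m. 1 \<le> m \<and> (F ^^ m) w = w"
  have d: "1 \<le> ?d \<and> (F ^^ ?d) w = w"
    using injective_returns(1)[OF X] by (rule LeastI_ex[where P = "\<lambda>m. 1 \<le> m \<and> (F ^^ m) w = w"])
  have least: "?d \<le> m" if "1 \<le> m" "(F ^^ m) w = w" for m using that by (intro Least_le) simp
  have "(F ^^ (m + ?d * k)) w = (F ^^ m) w" for m k
  proof (induction k)
    case (Suc k)
    have "(F ^^ (m + ?d * Suc k)) w = (F ^^ (m + ?d * k)) ((F ^^ ?d) w)"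
      by (simp only: funpow_add[symmetric, THEN fun_cong, unfolded comp_def] mult_Suc_right)
        (simp add: add.commute add.left_commute)
    then show ?case using d Suc by simp
  qed simp
  from this[of "m mod ?d" "m div ?d" for m] have "(F ^^ m) w = (F ^^ (m mod ?d)) w" for m by simp
  moreover have "m mod ?d < ?d" for m using d by simp
  ultimately have "{(F ^^ m) w | m. True} = (\<lambda>m. (F ^^ m) w) ` {..<?d}" by blast
  moreover have "inj_on (\<lambda>m. (F ^^ m) w) {..<?d}"
  proof -
    have "\<not> a < b" if "b < ?d" "(F ^^ a) w = (F ^^ b) w" for a b
    proof
      assume "a < b"
      then have "?d \<le> b - a" using least[of "b - a"] injective_returns(2)[OF X that(2)] by simp
      then show False using that(1) \<open>a < b\<close> by simp
    qed
    then show ?thesis unfolding inj_on_def by (metis lessThan_iff linorder_neqE_nat)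
  qed
  ultimately show ?thesis by (simp add: card_image)
qed

text \<open>
  The numbers with property \<open>A\<close> are the multiples of \<open>N\<close>, so the least
  number with both properties is a multiple \<open>q * N\<close>, and \<open>q\<close> is least
  such that \<open>q * N\<close> has property \<open>H\<close>.
\<close>

lemma least_period_factorises:
  assumes A0: "A 0" and A_add: "\<And>a b. A b \<Longrightarrow> A (a + b) \<longleftrightarrow> A a"
    and F: "\<And>m. F m \<longleftrightarrow> A m \<and> H m" and ex: "\<exists>m\<ge>1. F m"
  defines "N \<equiv> LEAST m. 1 \<le> m \<and> A m"
  shows "(LEAST m::nat. 1 \<le> m \<and> F m) = (LEAST q. 1 \<le> q \<and> H (q * N)) * N"
proof -
  let ?d = "LEAST m. 1 \<le> m \<and> F m" and ?l = "LEAST q. 1 \<le> q \<and> H (q * N)"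
  have d: "1 \<le> ?d \<and> F ?d" using ex by (rule LeastI_ex)
  have N: "1 \<le> N \<and> A N" unfolding N_def by (rule LeastI[of _ ?d]) (use d F in simp)
  have mult: "A (q * N)" for q
  proof (induction q)
    case (Suc q)
    then show ?case using A_add[of N "q * N"] A_add[of "q * N" N] N by (simp add: add.commute)
  qed (use A0 in simp)
  have dvd: "m = m div N * N" if "A m" for m
  proof -
    have "A (m mod N + m div N * N)" using that by simp
    then have "A (m mod N)" using A_add[OF mult] by blast
    moreover have "m mod N < N" using N by simp
    ultimately have "m mod N = 0"
      using not_less_Least[of "m mod N" "\<lambda>m. 1 \<le> m \<and> A m"] unfolding N_def[symmetric]
      by (cases "m mod N") auto
    then show ?thesis using div_mult_mod_eq[of m N] by simp
  qed
  \<comment> \<open>The least number with both properties is a multiple of \<open>N\<close>, which bounds the least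
    \<open>q\<close> from above.\<close>
  have dq: "?d = ?d div N * N" using dvd d F by blast
  then have q: "1 \<le> ?d div N" using d by (cases "?d div N") auto
  have Hq: "H (?d div N * N)" using d F dq by simp
  have l: "1 \<le> ?l \<and> H (?l * N)" by (rule LeastI[of _ "?d div N"]) (use q Hq in simp)
  have "?l \<le> ?d div N" by (rule Least_le) (use q Hq in simp)
  then have "?l * N \<le> ?d" using dq by (metis mult_le_mono1)
  moreover have "?d \<le> ?l * N"
  proof (rule Least_le)
    show "1 \<le> ?l * N \<and> F (?l * N)" using l N F mult by simp
  qed
  ultimately show ?thesis by simp
qed

lemma finite_full_words: "finite {w. balanced_word n r w \<and> dom w = {1..n}}"
proof (rule finite_subset)
  show "{w. balanced_word n r w \<and> dom w = {1..n}} \<subseteq> {w. dom w = {1..n} \<and> ran w \<subseteq> {..<r}}"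
    unfolding balanced_word_def by blast
  show "finite {w. dom w = {1..n} \<and> ran w \<subseteq> {..<r}}" by (rule finite_set_of_finite_maps) auto
qed

lemma promote_full_words:
  assumes r: "0 < r" and n: "1 \<le> n"
  defines "X \<equiv> {w. balanced_word n r w \<and> dom w = {1..n}}"
  shows "promote n r ` X \<subseteq> X" and "inj_on (promote n r) X"
proof -
  show "promote n r ` X \<subseteq> X"
  proof
    fix v assume "v \<in> promote n r ` X"
    then obtain w where "v = promote n r w" "balanced_word n r w" "dom w = {1..n}"
      unfolding X_def by blast
    then show "v \<in> X" using balanced_promote[OF _ r] dom_promote[OF _ _ r n] unfolding X_def by blast
  qed
  show "inj_on (promote n r) X"
  proof (rule inj_onI)
    fix w v assume "w \<in> X" "v \<in> X" and eq: "promote n r w = promote n r v"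
    then have *: "balanced_word n r w" "1 \<in> dom w" "balanced_word n r v" "1 \<in> dom v"
      using n unfolding X_def by auto
    then show "w = v" using promote_start_inj[OF *] eq unfolding promote_def by simp
  qed
qed

lemma tableau_size_tableau_of: "tableau_size (tableau_of w) = card (dom w)"
proof -
  have "dom w = (\<lambda>x. the (tableau_of w x)) ` dom (tableau_of w)"
    unfolding ran_tableau_of[of w, symmetric] by (force simp: ran_def)
  moreover have "inj_on (\<lambda>x. the (tableau_of w x)) (dom (tableau_of w))"
  proof (rule inj_onI)
    fix x y assume "x \<in> dom (tableau_of w)" "y \<in> dom (tableau_of w)" "the (tableau_of w x) = the (tableau_of w y)"
    then obtain a where a: "tableau_of w x = Some a" "tableau_of w y = Some a" by auto
    obtain i j i' j' where "x = (i, j)" "y = (i', j')" by (metis prod.exhaust)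
    then show "x = y" using a tableau_of_iff[of w i j a] tableau_of_iff[of w i' j' a] by auto
  qed
  ultimately show ?thesis unfolding tableau_size_def by (metis card_image)
qed

lemma promotion_funpow:
  assumes w: "balanced_word n r w" and full: "dom w = {1..n}" and r: "0 < r" and n: "1 \<le> n"
  shows "(promotion ^^ m) (tableau_of w) = tableau_of ((promote n r ^^ m) w) \<and>
    balanced_word n r ((promote n r ^^ m) w) \<and> dom ((promote n r ^^ m) w) = {1..n}"
proof (induction m)
  case (Suc m)
  let ?v = "(promote n r ^^ m) w"
  have v: "balanced_word n r ?v" "dom ?v = {1..n}" "1 \<in> dom ?v" using Suc n by auto
  have "promotion (tableau_of ?v) = tableau_of (promote n r ?v)"
    unfolding promotion_def tableau_size_tableau_of v(2)
    using promote_with_tableau_of[OF v(1,3)] v(3) by (simp add: promote_def)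
  then show ?case using Suc balanced_promote[OF v(1) r] dom_promote[OF v(1,2) r n] by simp
qed (use w full in simp)

lemma component_promotion_funpow:
  assumes v: "balanced_word n r v" and r: "0 < r"
  shows "(component_promotion n ^^ m) (tableau_of v) = tableau_of ((promote n r ^^ m) v) \<and>
    balanced_word n r ((promote n r ^^ m) v)"
proof (induction m)
  case (Suc m)
  then show ?case
    using component_promotion_tableau_of[of n r "(promote n r ^^ m) v"] balanced_promote[OF _ r] by simp
qed (use v in simp)

lemma decomposition_funpow:
  assumes w: "balanced_word n r w" and full: "dom w = {1..n}" and r: "0 < r" and n: "1 \<le> n"
    and dec: "decomposition n r w P"
  shows "decomposition n r ((promote n r ^^ m) w) ((`) (rotate_entry n ^^ m) ` P) \<and>
    (\<forall>B\<in>P. (promote n r ^^ m) w |` ((rotate_entry n ^^ m) ` B) = (promote n r ^^ m) (w |` B))"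
proof (induction m)
  case 0
  then show ?case using dec by simp
next
  case (Suc m)
  let ?v = "(promote n r ^^ m) w" and ?rot = "rotate_entry n ^^ m"
  have v: "balanced_word n r ?v" "dom ?v = {1..n}" using promotion_funpow[OF w full r n] by auto
  interpret decomposed n r ?v "(`) ?rot ` P" by unfold_locales (use v Suc in auto)
  have "(`) (rotate_entry n ^^ Suc m) ` P = (`) (rotate_entry n) ` (`) ?rot ` P"
    by (simp add: image_image image_comp)
  moreover have "(promote n r ^^ Suc m) w |` ((rotate_entry n ^^ Suc m) ` B) = (promote n r ^^ Suc m) (w |` B)"
    if B: "B \<in> P" for B
  proof -
    have "(rotate_entry n ^^ Suc m) ` B = rotate_entry n ` ?rot ` B" by (simp add: image_comp)
    then show ?thesis using promote_restrict[OF v(2) r n, of "?rot ` B"] Suc B by simp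
  qed
  ultimately show ?case using decomposition_promote[OF v(2) r n] by simp
qed

lemma rotate_funpow_inj: "1 \<le> n \<Longrightarrow> inj_on (rotate_entry n ^^ m) {1..n} \<and> (rotate_entry n ^^ m) ` {1..n} \<subseteq> {1..n}"
proof (induction m)
  case (Suc m)
  have "rotate_entry n ` {1..n} \<subseteq> {1..n}" using Suc.prems unfolding rotate_entry_def by auto
  moreover have "inj_on (rotate_entry n \<circ> (rotate_entry n ^^ m)) {1..n}"
    using Suc inj_on_rotate[of n] by (intro comp_inj_on) (auto elim: inj_on_subset)
  moreover have "(rotate_entry n ^^ Suc m) = rotate_entry n \<circ> (rotate_entry n ^^ m)" by simp
  ultimately show ?case using Suc by (metis image_comp image_mono order_trans)
qed simp

text \<open>
  If the word is fixed, the rotated partition is a decomposition of the word itself, and the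
  finest decomposition refines it with equally many blocks. Conversely, the word is determined by
  its restrictions.
\<close>

lemma fixed_iff_components_fixed:
  assumes w: "balanced_word n r w" and full: "dom w = {1..n}" and r: "0 < r" and n: "1 \<le> n"
    and dec: "decomposition n r w P"
    and finest: "\<And>Q B. decomposition n r w Q \<Longrightarrow> B \<in> P \<Longrightarrow> \<exists>B'\<in>Q. B \<subseteq> B'"
  shows "(promote n r ^^ m) w = w \<longleftrightarrow> (`) (rotate_entry n ^^ m) ` P = P \<and>
    (\<forall>B\<in>P. \<forall>B'\<in>P. (rotate_entry n ^^ m) ` B = B' \<longrightarrow> (promote n r ^^ m) (w |` B) = w |` B')"
proof
  let ?rot = "rotate_entry n ^^ m"
  interpret decomposed n r w P by unfold_locales (fact w dec)+
  note step = decomposition_funpow[OF w full r n dec, of m]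
  {
    assume fixed: "(promote n r ^^ m) w = w"
    then have rot_dec: "decomposition n r w ((`) ?rot ` P)" using step by simp
    have sub: "B \<subseteq> {1..n}" if "B \<in> P" for B using block_dom[OF that] full by simp
    \<comment> \<open>Rotation keeps the number of blocks, so a refinement can only be an equality.\<close>
    have "inj_on ((`) ?rot) P"
      using rotate_funpow_inj[OF n, of m] sub by (intro inj_on_subset[OF inj_on_image_Pow]) auto
    then have "card P = card ((`) ?rot ` P)" by (simp add: card_image)
    then have "P = (`) ?rot ` P"
      using refinement_eq[of "dom w" P "(`) ?rot ` P"] dec rot_dec finest[OF rot_dec] full
      unfolding decomposition_def by simp
    then show "(`) ?rot ` P = P \<and>
        (\<forall>B\<in>P. \<forall>B'\<in>P. ?rot ` B = B' \<longrightarrow> (promote n r ^^ m) (w |` B) = w |` B')"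
      using step fixed by auto
  }
  assume *: "(`) ?rot ` P = P \<and>
    (\<forall>B\<in>P. \<forall>B'\<in>P. ?rot ` B = B' \<longrightarrow> (promote n r ^^ m) (w |` B) = w |` B')"
  have same: "(promote n r ^^ m) w |` B' = w |` B'" if "B' \<in> P" for B'
  proof -
    have "B' \<in> (`) ?rot ` P" using * that by simp
    then obtain B where B: "B \<in> P" "?rot ` B = B'" by blast
    then have "(promote n r ^^ m) w |` B' = (promote n r ^^ m) (w |` B)" using step by blast
    also have "\<dots> = w |` B'" using * B that by blast
    finally show ?thesis .
  qed
  show "(promote n r ^^ m) w = w"
  proof
    fix a
    show "(promote n r ^^ m) w a = w a"
    proof (cases "a \<in> dom w")
      case True
      then obtain B where "B \<in> P" "a \<in> B" using blocks(1) by blast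
      then show ?thesis using fun_cong[OF same, of B a] by (simp add: restrict_map_def)
    next
      case False
      moreover have "dom ((promote n r ^^ m) w) = dom w" using promotion_funpow[OF w full r n] full by simp
      ultimately show ?thesis by (metis domIff)
    qed
  qed
qed

theorem theorem3p12:
  fixes T :: tableau and N l :: nat
  assumes "syt T" and "rectangular T"
    and "\<exists>S. uniformly_proper_rectangular S T"
    and "N = rotational_order T"
    and "l = (LEAST q. q \<ge> 1 \<and>
           (\<forall>C\<in>diagram_components (m_diagram T). \<forall>C'\<in>diagram_components (m_diagram T).
              (rotate_entry (tableau_size T) ^^ (q * N)) ` endpoints C = endpoints C' \<longrightarrow>
              (component_promotion (tableau_size T) ^^ (q * N)) (component_tableau T C)
                = component_tableau T C'))"
  shows "card (promotion_orbit T) = l * N"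
proof -
  obtain S U where S: "skew_tableau S" "S \<subseteq>\<^sub>m T" "S \<noteq> T" "tableau_rows S = tableau_rows T"
    "rectangular S" and U: "syt U" "uniformly_equivalent S U"
    using assms(3) unfolding uniformly_proper_rectangular_def uniformly_proper_def proper_subtableau_def
    by blast
  have T: "row_increasing T" using syt_row_increasing[OF assms(1)] .
  define w where "w = word_of T"
  define n where "n = tableau_size T"
  define r where "r = card (tableau_rows T)"
  have T_tableau_of: "T = tableau_of w"
    using left_justify_tableau_of[OF T] left_justify_syt[OF assms(1)] unfolding w_def by simp
  have full: "dom w = {1..n}"
    using assms(1) dom_word_of[OF T] unfolding syt_def w_def n_def by simp
  have rows: "tableau_rows T = {..<r}"
  proof -
    obtain p where p: "is_partition p" "dom T = young_diagram p" using assms(1) unfolding syt_def by blast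
    have "p ! i \<noteq> 0" if "i < length p" for i
      using p(1) nth_mem[OF that] unfolding is_partition_def by metis
    then have "tableau_rows T = {..<length p}"
      unfolding tableau_rows_def p(2) young_diagram_def by (force simp: image_iff)
    then show ?thesis unfolding r_def by simp
  qed
  have w: "balanced_word n r w"
    unfolding w_def
  proof (rule balanced_word_of[OF T _ rows assms(2)])
    show "ran T \<subseteq> {1..n}" using full dom_word_of[OF T] unfolding w_def by simp
    show "a < b" if "left_justify T (i, j) = Some a" "left_justify T (Suc i, j) = Some b" for i j a b
    proof -
      have "T (i, j) = Some a" "T (Suc i, j) = Some b"
        using that unfolding left_justify_syt[OF assms(1)] by auto
      moreover have "increasing T" using assms(1) unfolding syt_def by blast
      ultimately show ?thesis unfolding increasing_def using lessI by blast
    qed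
  qed
  have ne: "dom T \<noteq> {}"
  proof
    assume "dom T = {}"
    then have "dom S = {}" using map_le_implies_dom_le[OF S(2)] by simp
    then show False using \<open>dom T = {}\<close> S(3) by simp
  qed
  have "finite (dom T)" using T unfolding row_increasing_def by blast
  then have n: "1 \<le> n" using ne unfolding n_def tableau_size_def by (simp add: Suc_le_eq card_gt_0_iff)
  have r: "0 < r" using ne rows unfolding tableau_rows_def by (cases r) auto
  have full_words: "(promotion ^^ m) T = tableau_of ((promote n r ^^ m) w)"
    "balanced_word n r ((promote n r ^^ m) w)" "dom ((promote n r ^^ m) w) = {1..n}" for m
    using promotion_funpow[OF w full r n, of m] T_tableau_of by auto
  have orbit: "card (promotion_orbit T) = (LEAST m. 1 \<le> m \<and> (promote n r ^^ m) w = w)"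
  proof -
    have "promotion_orbit T = tableau_of ` {(promote n r ^^ m) w | m. True}"
      unfolding promotion_orbit_def full_words by blast
    moreover have "inj tableau_of" using tableau_of_inj by (rule injI)
    ultimately have "card (promotion_orbit T) = card {(promote n r ^^ m) w | m. True}"
      by (simp add: card_image inj_on_subset)
    also have "\<dots> = (LEAST m. 1 \<le> m \<and> (promote n r ^^ m) w = w)"
      using card_orbit[OF finite_full_words promote_full_words(2,1)[OF r n]] w full by simp
    finally show ?thesis .
  qed
  define K where "K = diagram_components (m_diagram T)"
  define P where "P = endpoints ` K"
  have M: "m_diagram T = arcs r w" using m_diagram_arcs[OF T] w unfolding w_def r_def by simp
  have N: "N = (LEAST m. 1 \<le> m \<and> (`) (rotate_entry n ^^ m) ` P = P)"
    unfolding assms(4) rotational_order_def P_def K_def n_def image_image by simp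
  show ?thesis
  proof (cases "r = 1")
    case True
    \<comment> \<open>With one row the word is constant.\<close>
    have fixed: "(promote n r ^^ m) w = w" for m
    proof
      fix a
      have "v a = (if a \<in> {1..n} then Some 0 else None)"
        if "balanced_word n r v" "dom v = {1..n}" for v
      proof (cases "v a")
        case None
        then have "a \<notin> dom v" by auto
        then show ?thesis using that(2) None by simp
      next
        case (Some i)
        then have "a \<in> dom v" by auto
        moreover have "i = 0" using balanced_word_row[OF that(1) Some] True by simp
        ultimately show ?thesis using that(2) Some by simp
      qed
      note const = this
      show "(promote n r ^^ m) w a = w a"
        using const[OF full_words(2,3)[of m]] const[OF w full] by simp
    qed
    then have "card (promotion_orbit T) = 1" unfolding orbit fixed by (intro Least_equality) auto
    moreover have K0: "K = {}"
      unfolding K_def M arcs_def diagram_components_def sub_diagram_def True by auto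
    then have "N = 1" unfolding N P_def by (intro Least_equality) auto
    moreover have "l = 1"
      unfolding assms(5) K_def[symmetric] K0 by (intro Least_equality) auto
    ultimately show ?thesis by simp
  next
    case False
    then have r2: "2 \<le> r" using r by simp
    define J where "J = ran S"
    have S_incr: "row_increasing S" using row_increasing_submap[OF T S(2)] .
    have v: "word_of S = w |` J" using word_of_submap[OF T S(2)] unfolding w_def J_def .
    have J_sub: "J \<subseteq> dom w"
      using dom_word_of[OF S_incr] unfolding v J_def[symmetric] by (metis dom_restrict inf_le1)
    have "balanced_word n r (word_of S)"
    proof (rule balanced_word_of[OF S_incr _ _ S(5)])
      show "ran S \<subseteq> {1..n}" using J_sub full unfolding J_def by simp
      show "tableau_rows S = {..<r}" using S(4) rows by simp
      show "a < b" if "left_justify S (i, j) = Some a" "left_justify S (Suc i, j) = Some b" for i j a b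
        using equivalent_syt_columns[OF U(1) _ that] U(2) unfolding uniformly_equivalent_def by blast
    qed
    then have J_balanced: "balanced_word n r (w |` J)" unfolding v .
    have J_ne: "J \<noteq> {}"
    proof
      assume "J = {}"
      then have "S x = None" for x unfolding J_def using ranI[of S x] by (cases "S x") auto
      then have "dom S = {}" by (auto simp: dom_def)
      then show False using S(4) ne unfolding tableau_rows_def by auto
    qed
    \<comment> \<open>Entries determine boxes, so a subtableau with all entries of \<open>T\<close> is
      \<open>T\<close>.\<close>
    have J_proper: "J \<noteq> dom w"
    proof
      assume "J = dom w"
      have "w |` dom w = w" by (rule ext) (simp add: restrict_map_def domIff)
      then have "word_of S = w" unfolding v \<open>J = dom w\<close> .
      have "T x = S x" for x
      proof (cases "T x")
        case (Some a)
        obtain i j where x: "x = (i, j)" by (cases x)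
        have "w a = Some i" using word_of_iff[OF T] Some x unfolding w_def by blast
        then obtain j' where j': "S (i, j') = Some a"
          using word_of_iff[OF S_incr] \<open>word_of S = w\<close> by auto
        then have "T (i, j') = Some a" using S(2) unfolding map_le_def by (metis domI)
        then have "(i, j') = x" using row_increasing_inj[OF T _ Some] by blast
        then show ?thesis using Some j' by simp
      next
        case None
        then show ?thesis using S(2) unfolding map_le_def by (metis domIff)
      qed
      then show False using S(3) by auto
    qed
    \<comment> \<open>The entries of \<open>S\<close> are a translate of those of \<open>U\<close>, which are an
      initial segment.\<close>
    have interval: "y \<in> J" if xz: "x \<in> J" "z \<in> J" "x < y" "y < z" for x y z
    proof -
      obtain I k k' where I: "ran S = (+) k ` I" "ran U = (+) k' ` I"
        using U(2) unfolding uniformly_equivalent_def by blast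
      have ranU: "ran U = {1..tableau_size U}" using U(1) unfolding syt_def by blast
      obtain i i' where i: "x = k + i" "i \<in> I" "z = k + i'" "i' \<in> I"
        using xz(1,2) I(1) unfolding J_def by auto
      have "k' + i \<in> {1..tableau_size U}" "k' + i' \<in> {1..tableau_size U}"
        using I(2) i ranU by auto
      then have "k' + (y - k) \<in> {1..tableau_size U}" using xz i by auto
      then have "k' + (y - k) \<in> (+) k' ` I" unfolding I(2)[symmetric] ranU .
      then have "y - k \<in> I" by auto
      moreover have "y = k + (y - k)" using xz i by simp
      ultimately show ?thesis unfolding J_def I(1) by blast
    qed
    \<comment> \<open>Two blocks give a sub-diagram, so the components cover all arcs.\<close>
    have "decomposition n r w {J, dom w - J}"
      using interval_decomposition[OF w J_sub J_ne J_proper interval J_balanced] .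
    then have "sub_diagram (arcs r w) {c \<in> arcs r w. fst c \<in> J}"
      using sub_diagram_block[OF w r2 _ _ J_proper] by blast
    then have dec: "decomposition n r w P"
      using components_decomposition[OF w r2] unfolding P_def K_def M by blast
    have finest: "\<exists>B'\<in>Q. B \<subseteq> B'" if "decomposition n r w Q" "B \<in> P" for Q B
      using component_in_block[OF w r2 that(1)] that(2) unfolding P_def K_def M by blast
    interpret decomposed n r w P by unfold_locales (fact w dec)+
    let ?A = "\<lambda>m. (`) (rotate_entry n ^^ m) ` P = P"
    let ?H = "\<lambda>m. \<forall>B\<in>P. \<forall>B'\<in>P. (rotate_entry n ^^ m) ` B = B' \<longrightarrow> (promote n r ^^ m) (w |` B) = w |` B'"
    have component_iff: "(component_promotion n ^^ m) (component_tableau T C) = component_tableau T C' \<longleftrightarrow>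
        (promote n r ^^ m) (w |` endpoints C) = w |` endpoints C'" if "C \<in> K" for m C C'
    proof -
      have "balanced_word n r (w |` endpoints C)" using block_balanced that unfolding P_def by blast
      then show ?thesis
        using component_promotion_funpow[OF _ r, of n "w |` endpoints C" m] tableau_of_inj
        unfolding component_tableau_tableau_of[OF T] w_def[symmetric] by auto
    qed
    have "(\<forall>C\<in>K. \<forall>C'\<in>K. (rotate_entry n ^^ m) ` endpoints C = endpoints C' \<longrightarrow>
        (component_promotion n ^^ m) (component_tableau T C) = component_tableau T C') \<longleftrightarrow> ?H m" for m
      unfolding P_def ball_simps(9) by (intro ball_cong refl imp_cong component_iff)
    then have l: "l = (LEAST q. 1 \<le> q \<and> ?H (q * N))"
      unfolding assms(5) n_def[symmetric] K_def[symmetric] by simp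
    have "(LEAST m. 1 \<le> m \<and> (promote n r ^^ m) w = w) = l * N"
      unfolding l N
    proof (rule least_period_factorises)
      show "?A 0" by simp
      show "?A (a + b) \<longleftrightarrow> ?A a" if "?A b" for a b
      proof -
        have "(`) (rotate_entry n ^^ (a + b)) ` P = (`) (rotate_entry n ^^ a) ` (`) (rotate_entry n ^^ b) ` P"
          by (simp add: funpow_add image_image image_comp)
        then show ?thesis using that by simp
      qed
      show "(promote n r ^^ m) w = w \<longleftrightarrow> ?A m \<and> ?H m" for m
        using fixed_iff_components_fixed[OF w full r n dec finest] .
      show "\<exists>m\<ge>1. (promote n r ^^ m) w = w"
        using injective_returns(1)[OF finite_full_words promote_full_words(2,1)[OF r n]] w full by simp
    qed
    then show ?thesis using orbit by simp
  qed
qed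

end
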